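(* Let $\mu$ be a computable probability measure on $2^\omega$, let $T$ be a computable measure-preserving operator on $(2^\omega,\mu)$, and let $f$ be a non-negative integrable lower semicomputable function on $2^\omega$. Let $A_nf(x)=\frac1n\sum_{i<n}f(T^i(x))$. Then for every $\mu$-Oberwolfach random point $z\in2^\omega$, $\lim_nA_nf(z)$ exists.
   Context: $\mu$ computable means $\mu[\sigma]$ is a computable real uniformly in the string $\sigma$. $T$ is a computable (possibly partial) map on $2^\omega$ that preserves $\mu$. $f:2^\omega\to[0,\infty]$ is lower semicomputable if $\{x:f(x)>q\}$ is effectively open uniformly in rationals $q$. A left-c.e. bounded test over $\mu$ is a nested sequence $(\mathcal V_n)$ of uniformly $\Sigma^0_1$ classes such that for some computable sequence of rationals $(\beta_n)$ with $\beta=\sup_n\beta_n\le1$ we have $\mu(\mathcal V_n)\le\beta-\beta_n$ for all $n$; $Z$ fails it if $Z\in\bigcap_n\mathcal V_n$. $Z$ is $\mu$-Oberwolfach random if it passes every left-c.e. bounded test over $\mu$. *)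

theory Defs
  imports "HOL-Probability.Probability" "HOL-Library.Nat_Bijection" "HOL-Library.Countable"
    "HOL-Library.Sublist"
begin

text \<open>
  The total recursive functions, generated by composition, primitive recursion and minimization of
  regular functions. Functions of all arities act on argument lists; missing arguments count
  as \<open>0\<close>.
\<close>

definition nth_or_zero :: "nat \<Rightarrow> nat list \<Rightarrow> nat" where
  "nth_or_zero i xs = (if i < length xs then xs ! i else 0)"

inductive total_recursive :: "(nat list \<Rightarrow> nat) \<Rightarrow> bool" where
  zero: "total_recursive (\<lambda>xs. 0)"
| succ: "total_recursive (\<lambda>xs. Suc (nth_or_zero 0 xs))"
| proj: "total_recursive (nth_or_zero i)"
| comp: "total_recursive g \<Longrightarrow> (\<forall>f\<in>set fs. total_recursive f) \<Longrightarrow>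
    total_recursive (\<lambda>xs. g (map (\<lambda>f. f xs) fs))"
| prim_rec: "total_recursive g \<Longrightarrow> total_recursive h \<Longrightarrow>
    total_recursive (\<lambda>xs. rec_nat (g (tl xs)) (\<lambda>y r. h (r # y # tl xs)) (nth_or_zero 0 xs))"
| minimize: "total_recursive g \<Longrightarrow> (\<forall>xs. \<exists>m. g (m # xs) = 0) \<Longrightarrow>
    total_recursive (\<lambda>xs. LEAST m. g (m # xs) = 0)"

definition ce_relation :: "(nat \<Rightarrow> nat \<Rightarrow> bool) \<Rightarrow> bool" where
  "ce_relation R \<longleftrightarrow>
    (\<exists>r. total_recursive r \<and> (\<forall>a b. R a b \<longleftrightarrow> (\<exists>m. r [m, a, b] = 0)))"

text \<open>Rationals are coded by the effective surjection \<^const>\<open>nat_to_rat_surj\<close>.\<close>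

definition computable_rat_sequence :: "(nat \<Rightarrow> rat) \<Rightarrow> bool" where
  "computable_rat_sequence q \<longleftrightarrow>
    (\<exists>r. total_recursive r \<and> (\<forall>n. q n = nat_to_rat_surj (r [n])))"

text \<open>
  Elements of \<open>2\<^sup>\<omega>\<close> are functions of type \<^typ>\<open>nat \<Rightarrow> bool\<close>, whose library topology is the
  product of the discrete topologies; \<^const>\<open>borel\<close> is the corresponding Borel algebra.
\<close>

type_synonym cantor = "nat \<Rightarrow> bool"

definition cylinder :: "bool list \<Rightarrow> cantor set" where
  "cylinder \<sigma> = {x. \<forall>i<length \<sigma>. x i = \<sigma> ! i}"

definition string_encode :: "bool list \<Rightarrow> nat" where
  "string_encode \<sigma> = list_encode (map of_bool \<sigma>)"

definition uniformly_Sigma1 :: "(nat \<Rightarrow> cantor set) \<Rightarrow> bool" where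
  "uniformly_Sigma1 V \<longleftrightarrow>
    (\<exists>R. ce_relation R \<and> (\<forall>n. V n = (\<Union>\<sigma>\<in>{\<sigma>. R n (string_encode \<sigma>)}. cylinder \<sigma>)))"

definition computable_prob_measure :: "cantor measure \<Rightarrow> bool" where
  "computable_prob_measure \<mu> \<longleftrightarrow> prob_space \<mu> \<and> sets \<mu> = sets borel \<and>
    (\<exists>r. total_recursive r \<and>
      (\<forall>\<sigma> k. \<bar>measure \<mu> (cylinder \<sigma>) - of_rat (nat_to_rat_surj (r [string_encode \<sigma>, k]))\<bar>
              \<le> 1 / 2 ^ k))"

definition lower_semicomputable :: "(cantor \<Rightarrow> ennreal) \<Rightarrow> bool" where
  "lower_semicomputable f \<longleftrightarrow>
    uniformly_Sigma1 (\<lambda>n. {x. ereal (of_rat (nat_to_rat_surj n)) < enn2ereal (f x)})"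

text \<open>
  A partial computable map is given by a Turing functional, i.e. a consistent c.e. set of pairs
  of strings (if the input extends \<open>\<sigma>\<close> then the output extends \<open>\<tau>\<close>). Its domain consists of exactly
  those inputs for which the functional produces arbitrarily long outputs.
\<close>

definition computable_partial_map :: "(cantor \<Rightarrow> cantor option) \<Rightarrow> bool" where
  "computable_partial_map T \<longleftrightarrow>
    (\<exists>R. ce_relation R \<and>
      (\<forall>\<sigma> \<tau> \<sigma>' \<tau>'. R (string_encode \<sigma>) (string_encode \<tau>) \<longrightarrow>
         R (string_encode \<sigma>') (string_encode \<tau>') \<longrightarrow> prefix \<sigma> \<sigma>' \<longrightarrow> prefix \<tau> \<tau>' \<or> prefix \<tau>' \<tau>) \<and>
      (\<forall>x y. T x = Some y \<longleftrightarrow>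
         (\<forall>n. \<exists>\<sigma> \<tau>. R (string_encode \<sigma>) (string_encode \<tau>) \<and>
                 x \<in> cylinder \<sigma> \<and> y \<in> cylinder \<tau> \<and> n \<le> length \<tau>)))"

text \<open>The case \<open>A = space M\<close> says that \<open>T\<close> is defined almost everywhere.\<close>

definition measure_preserving_partial :: "'a measure \<Rightarrow> ('a \<Rightarrow> 'a option) \<Rightarrow> bool" where
  "measure_preserving_partial M T \<longleftrightarrow>
    (\<forall>A\<in>sets M. {x \<in> space M. \<exists>y\<in>A. T x = Some y} \<in> sets M \<and>
       emeasure M {x \<in> space M. \<exists>y\<in>A. T x = Some y} = emeasure M A)"

definition iterate_partial :: "('a \<Rightarrow> 'a option) \<Rightarrow> nat \<Rightarrow> 'a \<Rightarrow> 'a option" where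
  "iterate_partial T i x = ((\<lambda>p. Option.bind p T) ^^ i) (Some x)"

text \<open>Meaningful only if the first \<open>n\<close> iterates of \<open>T\<close> are defined at \<open>x\<close>.\<close>

definition birkhoff_average :: "('a \<Rightarrow> 'a option) \<Rightarrow> ('a \<Rightarrow> ennreal) \<Rightarrow> nat \<Rightarrow> 'a \<Rightarrow> ennreal" where
  "birkhoff_average T f n x = (\<Sum>i<n. f (the (iterate_partial T i x))) / of_nat n"

definition left_ce_bounded_test :: "cantor measure \<Rightarrow> (nat \<Rightarrow> cantor set) \<Rightarrow> bool" where
  "left_ce_bounded_test \<mu> V \<longleftrightarrow>
    (\<forall>n. V (Suc n) \<subseteq> V n) \<and> uniformly_Sigma1 V \<and>
    (\<exists>\<beta>. computable_rat_sequence \<beta> \<and>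
      bdd_above (range (\<lambda>n. real_of_rat (\<beta> n))) \<and> (SUP n. real_of_rat (\<beta> n)) \<le> 1 \<and>
      (\<forall>n. measure \<mu> (V n) \<le> (SUP k. real_of_rat (\<beta> k)) - real_of_rat (\<beta> n)))"

definition oberwolfach_random :: "cantor measure \<Rightarrow> cantor \<Rightarrow> bool" where
  "oberwolfach_random \<mu> z \<longleftrightarrow> (\<forall>V. left_ce_bounded_test \<mu> V \<longrightarrow> z \<notin> (\<Inter>n. V n))"

end

theory Submission
  imports Defs
begin

text \<open>
  If the stages \<open>f\<^sub>t\<close> increase to \<open>f\<close>, the maximal ergodic inequality bounds the measure of
  \<open>{x. \<exists>n. A\<^sub>n (f - f\<^sub>t) x > 1/d}\<close> by \<open>d (\<integral>f - \<integral>f\<^sub>t)\<close>, which is a left-c.e. bounded test. So it suffices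
  that the averages of each stage \<open>g = f\<^sub>t\<close>, a computable step function, converge at random points.
  The limit of \<open>A\<^sub>n g\<close> need not be computable, but the numbers \<open>\<parallel>A\<^sub>k g\<parallel>\<^sub>2\<^sup>2\<close> are uniformly right-c.e.
  with infimum \<open>I\<close>. By the parallelogram law and the maximal inequality, the set where \<open>A\<^sub>n g\<close>
  oscillates by more than \<open>6/d\<close> along indices \<open>n \<ge> N\<^sub>k\<close> has measure at most \<open>2 d\<^sup>2 (\<parallel>A\<^sub>k g\<parallel>\<^sub>2\<^sup>2 - I)\<close>;
  this is again a left-c.e. bounded test. A third test, the complements of the stages at which
  initial parts of the orbit are computed, shows that the orbit of a random point is infinite.
\<close>

section \<open>Closure properties of the total recursive functions\<close>

text \<open>Oberwolfach tests fit because \<open>\<integral>f\<close> and the infimum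
  \<open>I\<close> need only be limits of one-sided approximations: the measure of a test set is
  paid for by the distance of a computable sequence from its supremum, and neither the supremum nor
  a rate of convergence has to be computable. The sequence may also fluctuate. The oscillation test
  relies on this: which \<open>k\<close> makes \<open>\<parallel>A\<^sub>k g\<parallel>\<close>
  nearly minimal is unknown, so the index runs through all pairs of a \<open>k\<close> and a
  computation stage, each set is charged to its own \<open>k\<close>, and nestedness comes from the
  lengths \<open>N\<close>, which grow with the index. The other obstacle is that \<open>T\<close>
  is partial: test sets must be effectively open everywhere, whereas the inequalities that they
  express make sense only along infinite orbits. They are therefore stated through finite
  certificates for an initial part of the orbit. At almost every point, and at random points by the
  third test, certificates describe the true orbit; elsewhere the sets may be arbitrary, which costs
  no measure.\<close>

abbreviation arg :: "nat \<Rightarrow> nat list \<Rightarrow> nat" where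
  "arg \<equiv> nth_or_zero"

lemma arg_simps [simp]:
  "arg 0 (x # xs) = x" "arg (Suc i) (x # xs) = arg i xs" "arg i [] = 0"
  "arg (numeral k) (x # xs) = arg (pred_numeral k) xs"
  by (auto simp: nth_or_zero_def numeral_eq_Suc)

lemma arg_tl: "arg i (tl xs) = arg (Suc i) xs"
  by (cases xs) auto

lemma arg_map_upt: "arg i (map f [0..<N]) = (if i < N then f i else 0)"
  by (auto simp: nth_or_zero_def)

definition depends_below :: "nat \<Rightarrow> (nat list \<Rightarrow> nat) \<Rightarrow> bool" where
  "depends_below N f \<longleftrightarrow> (\<forall>xs ys. (\<forall>i<N. arg i xs = arg i ys) \<longrightarrow> f xs = f ys)"

lemma depends_belowD: "depends_below N f \<Longrightarrow> (\<And>i. i < N \<Longrightarrow> arg i xs = arg i ys) \<Longrightarrow> f xs = f ys"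
  by (auto simp: depends_below_def)

lemma depends_below_mono: "depends_below N f \<Longrightarrow> N \<le> M \<Longrightarrow> depends_below M f"
  by (force simp: depends_below_def)

text \<open>The rule \<open>total_recursive.comp\<close> substitutes only finitely many functions.
  Since only a finite initial part of the argument list is ever read, a whole list-valued
  environment can be substituted all the same.\<close>

lemma total_recursive_finite_dependence: "total_recursive f \<Longrightarrow> \<exists>N. depends_below N f"
proof (induction rule: total_recursive.induct)
  case zero
  then show ?case by (auto simp: depends_below_def)
next
  case succ
  have "depends_below 1 (\<lambda>xs. Suc (arg 0 xs))" by (auto simp: depends_below_def)
  then show ?case by blast
next
  case (proj i)
  have "depends_below (Suc i) (arg i)" by (auto simp: depends_below_def)
  then show ?case by blast
next
  case (comp g fs)
  then obtain M where M: "\<And>f. f \<in> set fs \<Longrightarrow> depends_below (M f) f"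
    by metis
  define N where "N = Max (M ` set fs)"
  have N: "depends_below N f" if "f \<in> set fs" for f
    by (rule depends_below_mono[OF M]) (use that in \<open>auto simp: N_def\<close>)
  have "depends_below N (\<lambda>xs. g (map (\<lambda>f. f xs) fs))"
    unfolding depends_below_def
  proof (intro allI impI)
    fix xs ys assume "\<forall>i<N. arg i xs = arg i ys"
    then have eq: "map (\<lambda>f. f xs) fs = map (\<lambda>f. f ys) fs"
      using N by (simp add: depends_below_def)
    show "g (map (\<lambda>f. f xs) fs) = g (map (\<lambda>f. f ys) fs)" by (simp only: eq)
  qed
  then show ?case by blast
next
  case (prim_rec g h)
  then obtain A B where A: "depends_below A g" and B: "depends_below B h" by blast
  have "depends_below (Suc (A + B)) (\<lambda>xs. rec_nat (g (tl xs)) (\<lambda>y r. h (r # y # tl xs)) (arg 0 xs))"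
    unfolding depends_below_def
  proof (intro allI impI)
    fix xs ys assume eq: "\<forall>i<Suc (A + B). arg i xs = arg i ys"
    have "g (tl xs) = g (tl ys)"
      by (rule depends_belowD[OF A]) (use eq in \<open>auto simp: arg_tl\<close>)
    moreover have "h (r # y # tl xs) = h (r # y # tl ys)" for r y
    proof (rule depends_belowD[OF B])
      fix i assume "i < B"
      then show "arg i (r # y # tl xs) = arg i (r # y # tl ys)"
        using eq by (cases i; cases "i - 1") (auto simp: arg_tl)
    qed
    ultimately show "rec_nat (g (tl xs)) (\<lambda>y r. h (r # y # tl xs)) (arg 0 xs)
        = rec_nat (g (tl ys)) (\<lambda>y r. h (r # y # tl ys)) (arg 0 ys)"
      using eq by simp
  qed
  then show ?case by blast
next
  case (minimize g)
  then obtain A where A: "depends_below A g" by blast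
  have "depends_below A (\<lambda>xs. LEAST m. g (m # xs) = 0)"
    unfolding depends_below_def
  proof (intro allI impI)
    fix xs ys assume eq: "\<forall>i<A. arg i xs = arg i ys"
    have "g (m # xs) = g (m # ys)" for m
    proof (rule depends_belowD[OF A])
      fix i assume "i < A"
      then show "arg i (m # xs) = arg i (m # ys)"
        using eq by (cases i) auto
    qed
    then show "(LEAST m. g (m # xs) = 0) = (LEAST m. g (m # ys) = 0)" by simp
  qed
  then show ?case by blast
qed

text \<open>An environment in the de Bruijn sense: a binder such as a bounded sum or quantifier
  pushes its variable onto the argument list, and the body reads the outer variables through
  \<open>tl\<close>. With rules for environments, recursiveness of a term follows by descending
  through its syntax with \<open>rec_intros\<close>.\<close>

definition rec_env :: "(nat list \<Rightarrow> nat list) \<Rightarrow> bool" where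
  "rec_env E \<longleftrightarrow> (\<forall>i. total_recursive (\<lambda>xs. arg i (E xs)))"

lemma total_recursive_subst:
  assumes "total_recursive f" "rec_env E"
  shows "total_recursive (\<lambda>xs. f (E xs))"
proof -
  obtain N where N: "depends_below N f"
    using total_recursive_finite_dependence[OF assms(1)] by blast
  have "total_recursive (\<lambda>xs. f (map (\<lambda>f. f xs) (map (\<lambda>i xs. arg i (E xs)) [0..<N])))"
    using assms by (intro total_recursive.comp) (auto simp: rec_env_def)
  moreover have "f (map (\<lambda>f. f xs) (map (\<lambda>i xs. arg i (E xs)) [0..<N])) = f (E xs)" for xs
    by (rule depends_belowD[OF N]) (simp add: comp_def arg_map_upt)
  ultimately show ?thesis by simp
qed

named_theorems rec_intros

lemma rec_env_id [rec_intros]: "rec_env (\<lambda>xs. xs)"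
  unfolding rec_env_def using total_recursive.proj by simp

lemma rec_env_Nil [rec_intros]: "rec_env (\<lambda>xs. [])"
  unfolding rec_env_def using total_recursive.zero by simp

lemma rec_env_tl [rec_intros]: "rec_env E \<Longrightarrow> rec_env (\<lambda>xs. tl (E xs))"
  unfolding rec_env_def by (simp add: arg_tl)

lemma rec_env_Cons [rec_intros]:
  assumes "total_recursive F" "rec_env E" shows "rec_env (\<lambda>xs. F xs # E xs)"
  unfolding rec_env_def
proof
  fix i show "total_recursive (\<lambda>xs. arg i (F xs # E xs))"
    using assms by (cases i) (auto simp: rec_env_def)
qed

lemma total_recursive_arg [rec_intros]: "rec_env E \<Longrightarrow> total_recursive (\<lambda>xs. arg i (E xs))"
  by (simp add: rec_env_def)

lemma total_recursive_Suc [rec_intros]: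
  assumes "total_recursive F" shows "total_recursive (\<lambda>xs. Suc (F xs))"
  using total_recursive_subst[OF total_recursive.succ rec_env_Cons[OF assms rec_env_Nil]] by simp

lemma total_recursive_const [rec_intros]: "total_recursive (\<lambda>xs. n)"
  by (induction n) (simp_all only: total_recursive.zero total_recursive_Suc)

lemma total_recursive_rec_nat [rec_intros]:
  assumes "total_recursive g" "total_recursive n"
    and "total_recursive (\<lambda>ys. h (arg 1 ys) (arg 0 ys) (tl (tl ys)))"
  shows "total_recursive (\<lambda>xs. rec_nat (g xs) (\<lambda>y r. h y r xs) (n xs))"
  using total_recursive_subst[OF total_recursive.prim_rec[OF assms(1,3)] rec_env_Cons[OF assms(2) rec_env_id]]
  by simp

lemma total_recursive_plus [rec_intros]:
  assumes "total_recursive F" "total_recursive G" shows "total_recursive (\<lambda>xs. F xs + G xs)"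
proof -
  have "rec_nat a (\<lambda>_ r. Suc r) b = a + b" for a b by (induction b) auto
  moreover have "total_recursive (\<lambda>xs. rec_nat (F xs) (\<lambda>_ r. Suc r) (G xs))"
    by (intro rec_intros assms)
  ultimately show ?thesis by simp
qed

lemma total_recursive_times [rec_intros]:
  assumes "total_recursive F" "total_recursive G" shows "total_recursive (\<lambda>xs. F xs * G xs)"
proof -
  have "rec_nat 0 (\<lambda>_ r. r + a) b = a * b" for a b :: nat by (induction b) auto
  moreover have "total_recursive (\<lambda>xs. rec_nat 0 (\<lambda>_ r. r + F xs) (G xs))"
    by (intro rec_intros assms assms[THEN total_recursive_subst])
  ultimately show ?thesis by simp
qed

lemma total_recursive_power [rec_intros]:
  assumes "total_recursive F" "total_recursive G" shows "total_recursive (\<lambda>xs. F xs ^ G xs)"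
proof -
  have "rec_nat 1 (\<lambda>_ r. r * a) b = a ^ b" for a b :: nat by (induction b) auto
  moreover have "total_recursive (\<lambda>xs. rec_nat 1 (\<lambda>_ r. r * F xs) (G xs))"
    by (intro rec_intros assms assms[THEN total_recursive_subst])
  ultimately show ?thesis by simp
qed

lemma total_recursive_minus [rec_intros]:
  assumes "total_recursive F" "total_recursive G" shows "total_recursive (\<lambda>xs. F xs - G xs)"
proof -
  have pred: "rec_nat 0 (\<lambda>y _. y) b = b - 1" for b :: nat by (cases b) auto
  have "rec_nat a (\<lambda>_ r. r - 1) b = a - b" for a b :: nat by (induction b) auto
  moreover have "total_recursive (\<lambda>xs. rec_nat (F xs) (\<lambda>_ r. rec_nat 0 (\<lambda>y _. y) r) (G xs))"
    by (intro rec_intros assms)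
  ultimately show ?thesis by (simp add: pred)
qed

lemma total_recursive_sum [rec_intros]:
  assumes "total_recursive B" "total_recursive (\<lambda>ys. F (arg 0 ys) (tl ys))"
  shows "total_recursive (\<lambda>xs. \<Sum>j<B xs. F j xs)"
proof -
  have "rec_nat 0 (\<lambda>y r. r + F y xs) b = (\<Sum>j<b. F j xs)" for b xs by (induction b) auto
  moreover have "total_recursive (\<lambda>ys. F (arg 1 ys) (tl (tl ys)))"
    using total_recursive_subst[OF assms(2) rec_env_tl[OF rec_env_id]] by (simp add: arg_tl)
  then have "total_recursive (\<lambda>xs. rec_nat 0 (\<lambda>y r. r + F y xs) (B xs))"
    by (intro rec_intros assms)
  ultimately show ?thesis by simp
qed

section \<open>Decidable predicates\<close>

definition decidable :: "(nat list \<Rightarrow> bool) \<Rightarrow> bool" where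
  "decidable P \<longleftrightarrow> total_recursive (\<lambda>xs. of_bool (P xs))"

lemma total_recursive_of_bool [rec_intros]:
  "decidable P \<Longrightarrow> total_recursive (\<lambda>xs. of_bool (P xs))"
  by (simp add: decidable_def)

lemma decidable_subst: "decidable P \<Longrightarrow> rec_env E \<Longrightarrow> decidable (\<lambda>xs. P (E xs))"
  unfolding decidable_def by (rule total_recursive_subst)

lemma decidable_eq_0 [rec_intros]:
  assumes "total_recursive F" shows "decidable (\<lambda>xs. F xs = 0)"
proof -
  have "total_recursive (\<lambda>xs. 1 - F xs)" by (intro rec_intros assms)
  moreover have "1 - a = of_bool (a = 0)" for a :: nat by auto
  ultimately show ?thesis by (simp add: decidable_def)
qed

lemma decidable_const [rec_intros]: "decidable (\<lambda>xs. b)"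
  unfolding decidable_def by (intro rec_intros)

lemma decidable_not [rec_intros]: "decidable P \<Longrightarrow> decidable (\<lambda>xs. \<not> P xs)"
  using decidable_eq_0[of "\<lambda>xs. of_bool (P xs)"] by (simp add: decidable_def)

lemma decidable_le [rec_intros]:
  assumes "total_recursive F" "total_recursive G" shows "decidable (\<lambda>xs. F xs \<le> G xs)"
  using decidable_eq_0[OF total_recursive_minus[OF assms]] by simp

lemma decidable_conj [rec_intros]:
  assumes "decidable P" "decidable Q" shows "decidable (\<lambda>xs. P xs \<and> Q xs)"
  unfolding decidable_def of_bool_conj by (intro rec_intros assms)

lemma decidable_less [rec_intros]:
  assumes "total_recursive F" "total_recursive G" shows "decidable (\<lambda>xs. F xs < G xs)"
  using decidable_le[OF total_recursive_Suc[OF assms(1)] assms(2)] by (simp add: Suc_le_eq)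

lemma decidable_eq [rec_intros]:
  assumes "total_recursive F" "total_recursive G" shows "decidable (\<lambda>xs. F xs = G xs)"
proof -
  have "decidable (\<lambda>xs. F xs \<le> G xs \<and> G xs \<le> F xs)" by (intro rec_intros assms)
  moreover have "F xs \<le> G xs \<and> G xs \<le> F xs \<longleftrightarrow> F xs = G xs" for xs by auto
  ultimately show ?thesis by simp
qed

lemma decidable_ex_less [rec_intros]:
  assumes "total_recursive B" "decidable (\<lambda>ys. P (arg 0 ys) (tl ys))"
  shows "decidable (\<lambda>xs. \<exists>j<B xs. P j xs)"
proof -
  have eq: "(\<exists>j<b. Q j) \<longleftrightarrow> \<not> (\<Sum>j<b. of_bool (Q j)) = (0::nat)" for b and Q :: "nat \<Rightarrow> bool"
    by (subst sum_eq_0_iff) auto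
  show ?thesis
    unfolding eq by (intro rec_intros assms)
qed

lemma decidable_all_less [rec_intros]:
  assumes "total_recursive B" "decidable (\<lambda>ys. P (arg 0 ys) (tl ys))"
  shows "decidable (\<lambda>xs. \<forall>j<B xs. P j xs)"
proof -
  have "decidable (\<lambda>xs. \<not> (\<exists>j<B xs. \<not> P j xs))"
    by (intro rec_intros assms)
  then show ?thesis by simp
qed

lemma decidable_ex_le [rec_intros]:
  assumes "total_recursive B" "decidable (\<lambda>ys. P (arg 0 ys) (tl ys))"
  shows "decidable (\<lambda>xs. \<exists>j\<le>B xs. P j xs)"
  using decidable_ex_less[OF total_recursive_Suc[OF assms(1)] assms(2)] by (simp add: less_Suc_eq_le)

lemma total_recursive_if [rec_intros]:
  assumes "decidable P" "total_recursive F" "total_recursive G"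
  shows "total_recursive (\<lambda>xs. if P xs then F xs else G xs)"
proof -
  have "total_recursive (\<lambda>xs. of_bool (P xs) * F xs + of_bool (\<not> P xs) * G xs)"
    by (intro rec_intros assms)
  moreover have "of_bool (P xs) * F xs + of_bool (\<not> P xs) * G xs = (if P xs then F xs else G xs)" for xs
    by auto
  ultimately show ?thesis by simp
qed

text \<open>Counting replaces minimization: a number is recovered as the count of the
  \<open>j\<close> below it, a bounded sum of truth values. Division and the integer-valued step
  functions of the tests are computed this way.\<close>

lemma sum_of_bool_less_eq:
  "(\<And>j. P j \<longleftrightarrow> j < m) \<Longrightarrow> m \<le> n \<Longrightarrow> (\<Sum>j<n. of_bool (P j)) = (m::nat)"
proof -
  assume P: "\<And>j. P j \<longleftrightarrow> j < m" and "m \<le> n"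
  have "(\<Sum>j<n. of_bool (P j)) = (\<Sum>j<m. (1::nat))"
    using \<open>m \<le> n\<close> by (intro sum.mono_neutral_cong_right) (auto simp: P)
  then show ?thesis by simp
qed

section \<open>Division, pairing and access to coded lists\<close>

lemma total_recursive_div [rec_intros]:
  assumes "total_recursive F" "total_recursive G"
  shows "total_recursive (\<lambda>xs. F xs div G xs)"
proof -
  have "(\<Sum>j<a. of_bool (0 < b \<and> Suc j * b \<le> a)) = a div b" for a b :: nat
    by (cases "b = 0") (simp, intro sum_of_bool_less_eq,
        simp_all add: less_eq_div_iff_mult_less_eq[symmetric] Suc_le_eq del: mult_Suc)
  moreover have "total_recursive (\<lambda>xs. \<Sum>j<F xs. of_bool (0 < G xs \<and> Suc j * G xs \<le> F xs))"
    by (intro rec_intros assms assms[THEN total_recursive_subst])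
  ultimately show ?thesis by simp
qed

lemma total_recursive_mod [rec_intros]:
  assumes "total_recursive F" "total_recursive G"
  shows "total_recursive (\<lambda>xs. F xs mod G xs)"
  unfolding modulo_nat_def by (intro rec_intros assms)

lemma total_recursive_prod_encode [rec_intros]:
  assumes "total_recursive F" "total_recursive G"
  shows "total_recursive (\<lambda>xs. prod_encode (F xs, G xs))"
  unfolding prod_encode_def triangle_def prod.case by (intro rec_intros assms)

text \<open>Both components of a pair are at most its code, so decoding is a bounded search, written
  as a sum in which only the correct pair contributes.\<close>

lemma prod_decode_fst_eq:
  "fst (prod_decode c) = (\<Sum>a<Suc c. \<Sum>b<Suc c. a * of_bool (prod_encode (a, b) = c))"
proof -
  obtain a0 b0 where c: "c = prod_encode (a0, b0)" by (metis prod_decode_inverse surj_pair)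
  have le: "a0 \<le> c" "b0 \<le> c" using le_prod_encode_1 le_prod_encode_2 c by auto
  have "(\<Sum>b<Suc c. a * of_bool (prod_encode (a, b) = c)) = (if a = a0 then a0 else 0)" for a
    using le by (auto simp: c simp del: sum.lessThan_Suc)
  then have "(\<Sum>a<Suc c. \<Sum>b<Suc c. a * of_bool (prod_encode (a, b) = c)) = (\<Sum>a<Suc c. if a = a0 then a0 else 0)"
    by presburger
  also have "\<dots> = a0" using le by (simp del: sum.lessThan_Suc add: less_Suc_eq_le)
  finally show ?thesis by (simp add: c)
qed

lemma prod_decode_snd_eq:
  "snd (prod_decode c) = (\<Sum>b<Suc c. b * of_bool (prod_encode (fst (prod_decode c), b) = c))"
proof -
  obtain a0 b0 where c: "c = prod_encode (a0, b0)" by (metis prod_decode_inverse surj_pair)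
  have le: "b0 \<le> c" using le_prod_encode_2 c by auto
  have "(\<Sum>b<Suc c. b * of_bool (prod_encode (a0, b) = c)) = (\<Sum>b<Suc c. if b = b0 then b0 else 0)"
    by (intro sum.cong) (auto simp: c)
  also have "\<dots> = b0" using le by (simp del: sum.lessThan_Suc add: less_Suc_eq_le)
  finally show ?thesis by (simp add: c)
qed

lemma total_recursive_prod_decode_fst [rec_intros]:
  assumes "total_recursive F" shows "total_recursive (\<lambda>xs. fst (prod_decode (F xs)))"
  unfolding prod_decode_fst_eq by (intro rec_intros assms assms[THEN total_recursive_subst])

lemma total_recursive_prod_decode_snd [rec_intros]:
  assumes "total_recursive F" shows "total_recursive (\<lambda>xs. snd (prod_decode (F xs)))"
  by (subst prod_decode_snd_eq) (intro rec_intros assms assms[THEN total_recursive_subst])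

text \<open>\<open>list_encode (x # xs)\<close> is the successor of
  \<open>prod_encode (x, list_encode xs)\<close>, so dropping the head means taking
  \<open>snd\<close> of the decoded predecessor. Every number is a code, which lets certificates
  quantify over plain numbers.\<close>

definition code_nth :: "nat \<Rightarrow> nat \<Rightarrow> nat" where
  "code_nth c i = fst (prod_decode (rec_nat c (\<lambda>_ r. snd (prod_decode (r - 1))) i - 1))"

lemma code_nth_list_encode: "i < length xs \<Longrightarrow> code_nth (list_encode xs) i = xs ! i"
proof (induction xs arbitrary: i)
  case (Cons x xs)
  have shift: "rec_nat c (\<lambda>_. f) (Suc i) = rec_nat (f c) (\<lambda>_. f) i" for c :: nat and f i
    by (induction i) auto
  show ?case
  proof (cases i)
    case 0
    then show ?thesis by (simp add: code_nth_def)
  next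
    case (Suc j)
    with Cons have "code_nth (list_encode xs) j = xs ! j" by simp
    then show ?thesis unfolding Suc code_nth_def shift by simp
  qed
qed simp

lemma total_recursive_code_nth [rec_intros]:
  assumes "total_recursive F" "total_recursive G"
  shows "total_recursive (\<lambda>xs. code_nth (F xs) (G xs))"
  unfolding code_nth_def by (intro rec_intros assms)

section \<open>Binary codes of finite strings\<close>

text \<open>The least significant bit comes first, so that shortening a prefix to length
  \<open>k\<close> is reduction modulo \<open>2 ^ k\<close>.\<close>

definition bits :: "cantor \<Rightarrow> nat \<Rightarrow> nat" where
  "bits x m = horner_sum of_bool 2 (map x [0..<m])"

lemma bit_bits: "bit (bits x m) i \<longleftrightarrow> i < m \<and> x i"
  by (auto simp: bits_def bit_horner_sum_bit_iff)

lemma bits_mod: "k \<le> m \<Longrightarrow> bits x m mod 2 ^ k = bits x k"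
  unfolding take_bit_eq_mod[symmetric]
  by (rule bit_eqI) (auto simp: bit_take_bit_iff bit_bits)

lemma bits_eq_mod_iff: "bits x m = b mod 2 ^ m \<longleftrightarrow> (\<forall>i<m. x i = bit b i)"
  unfolding take_bit_eq_mod[symmetric] by (auto simp: bit_eq_iff bit_take_bit_iff bit_bits)

lemma bits_less: "bits x m < 2 ^ m"
  by (metis bits_mod le_refl mod_less_divisor zero_less_numeral zero_less_power)

definition bit_list :: "nat \<Rightarrow> nat \<Rightarrow> bool list" where
  "bit_list m b = map (bit b) [0..<m]"

definition string_code :: "nat \<Rightarrow> nat \<Rightarrow> nat" where
  "string_code m b = string_encode (bit_list m b)"

lemma length_bit_list [simp]: "length (bit_list m b) = m"
  by (simp add: bit_list_def)

lemma bit_list_mod: "bit_list m (b mod 2 ^ m) = bit_list m b"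
  unfolding take_bit_eq_mod[symmetric] by (auto simp: bit_list_def bit_take_bit_iff)

lemma string_encode_inject [simp]: "string_encode \<sigma> = string_encode \<tau> \<longleftrightarrow> \<sigma> = \<tau>"
  unfolding string_encode_def list_encode_eq
  by (auto simp: inj_map_eq_map inj_def)

lemma bit_list_surj: "\<exists>b<2 ^ length \<sigma>. bit_list (length \<sigma>) b = \<sigma>"
proof -
  define b :: nat where "b = horner_sum of_bool 2 \<sigma>"
  have *: "bit_list (length \<sigma>) b = \<sigma>"
    by (auto simp: bit_list_def b_def bit_horner_sum_bit_iff intro!: nth_equalityI)
  show ?thesis
    by (rule exI[of _ "b mod 2 ^ length \<sigma>"]) (simp add: bit_list_mod *)
qed

lemma mem_cylinder_bit_list: "x \<in> cylinder (bit_list m b) \<longleftrightarrow> bits x m = b mod 2 ^ m"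
  unfolding bits_eq_mod_iff by (simp add: cylinder_def bit_list_def)

text \<open>\<open>list_encode\<close> grows at the head, hence the recursion reads the bits from
  the last to the first.\<close>

lemma string_code_eq_rec:
  "string_code m b = rec_nat 0 (\<lambda>j r. Suc (prod_encode (b div 2 ^ (m - Suc j) mod 2, r))) m"
proof -
  have "rec_nat 0 (\<lambda>j r. Suc (prod_encode (b div 2 ^ (m - Suc j) mod 2, r))) j
      = list_encode (map of_bool (map (bit b) [m - j..<m]))" if "j \<le> m" for j
    using that
  proof (induction j)
    case (Suc j)
    have "[m - Suc j..<m] = (m - Suc j) # [m - j..<m]"
      using Suc.prems by (subst upt_conv_Cons) (auto simp: Suc_diff_Suc)
    moreover have "b div 2 ^ (m - Suc j) mod 2 = of_bool (bit b (m - Suc j))"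
      by (simp add: bit_iff_odd mod_2_eq_odd)
    ultimately show ?case using Suc by simp
  qed simp
  from this[of m] show ?thesis by (simp add: string_code_def string_encode_def bit_list_def)
qed

lemma total_recursive_string_code [rec_intros]:
  assumes "total_recursive F" "total_recursive G"
  shows "total_recursive (\<lambda>xs. string_code (F xs) (G xs))"
  unfolding string_code_eq_rec by (intro rec_intros assms assms[THEN total_recursive_subst])

section \<open>Computably enumerable predicates\<close>

definition ce :: "(nat list \<Rightarrow> bool) \<Rightarrow> bool" where
  "ce P \<longleftrightarrow> (\<exists>D. decidable D \<and> (\<forall>xs. P xs \<longleftrightarrow> (\<exists>m. D (m # xs))))"

lemma ceI: "decidable D \<Longrightarrow> (\<And>xs. P xs \<longleftrightarrow> (\<exists>m. D (m # xs))) \<Longrightarrow> ce P"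
  by (auto simp: ce_def)

lemma ce_subst:
  assumes "ce P" "rec_env E" shows "ce (\<lambda>xs. P (E xs))"
proof -
  obtain D where D: "decidable D" "\<And>xs. P xs \<longleftrightarrow> (\<exists>m. D (m # xs))" using assms by (auto simp: ce_def)
  have "decidable (\<lambda>ys. D (arg 0 ys # E (tl ys)))"
  proof (rule decidable_subst[OF D(1)])
    have "rec_env (\<lambda>ys. E (tl ys))"
      unfolding rec_env_def
    proof
      fix i
      have "total_recursive (\<lambda>xs. arg i (E xs))" using assms(2) by (simp add: rec_env_def)
      then show "total_recursive (\<lambda>xs. arg i (E (tl xs)))"
        by (rule total_recursive_subst) (intro rec_intros)
    qed
    then show "rec_env (\<lambda>ys. arg 0 ys # E (tl ys))" by (intro rec_intros)
  qed
  then show ?thesis by (rule ceI) (simp add: D(2))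
qed

lemma ce_decidable [rec_intros]: "decidable P \<Longrightarrow> ce P"
  by (rule ceI[where D = "\<lambda>ys. P (tl ys)"]) (auto intro!: decidable_subst[of P] rec_intros)

text \<open>One number that bounds both witnesses serves as the common witness; the search below it
  is decidable.\<close>

lemma ce_conj [rec_intros]:
  assumes "ce P" "ce Q" shows "ce (\<lambda>xs. P xs \<and> Q xs)"
proof -
  obtain D where D: "decidable D" "\<And>xs. P xs \<longleftrightarrow> (\<exists>m. D (m # xs))" using assms by (auto simp: ce_def)
  obtain D' where D': "decidable D'" "\<And>xs. Q xs \<longleftrightarrow> (\<exists>m. D' (m # xs))" using assms by (auto simp: ce_def)
  have "decidable (\<lambda>ys. (\<exists>a\<le>arg 0 ys. D (a # tl ys)) \<and> (\<exists>a\<le>arg 0 ys. D' (a # tl ys)))"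
    by (intro rec_intros D(1)[THEN decidable_subst] D'(1)[THEN decidable_subst])
  then show ?thesis
  proof (rule ceI)
    fix xs
    show "P xs \<and> Q xs \<longleftrightarrow> (\<exists>m. (\<exists>a\<le>arg 0 (m # xs). D (a # tl (m # xs)))
        \<and> (\<exists>a\<le>arg 0 (m # xs). D' (a # tl (m # xs))))"
      unfolding D(2) D'(2) by simp (metis max.cobounded1 max.cobounded2)
  qed
qed

lemma ce_ex [rec_intros]:
  assumes "ce (\<lambda>ys. P (arg 0 ys) (tl ys))" shows "ce (\<lambda>xs. \<exists>n. P n xs)"
proof -
  obtain D where D: "decidable D" "\<And>ys. P (arg 0 ys) (tl ys) \<longleftrightarrow> (\<exists>m. D (m # ys))"
    using assms by (auto simp: ce_def)
  have P: "P n xs \<longleftrightarrow> (\<exists>m. D (m # n # xs))" for n xs using D(2)[of "n # xs"] by simp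
  have "decidable (\<lambda>ys. \<exists>n\<le>arg 0 ys. \<exists>m\<le>arg 0 ys. D (m # n # tl ys))"
    by (intro rec_intros D(1)[THEN decidable_subst])
  then show ?thesis
  proof (rule ceI)
    fix xs
    show "(\<exists>n. P n xs) \<longleftrightarrow> (\<exists>m. \<exists>n\<le>arg 0 (m # xs). \<exists>k\<le>arg 0 (m # xs). D (k # n # tl (m # xs)))"
      unfolding P by simp (metis max.cobounded1 max.cobounded2)
  qed
qed

text \<open>Collection: finitely many witnesses have a common bound, which moves the unbounded
  quantifier outside the bounded one.\<close>

lemma ce_all_less [rec_intros]:
  assumes "total_recursive B" "ce (\<lambda>ys. P (arg 0 ys) (tl ys))"
  shows "ce (\<lambda>xs. \<forall>j<B xs. P j xs)"
proof -
  obtain D where D: "decidable D" "\<And>ys. P (arg 0 ys) (tl ys) \<longleftrightarrow> (\<exists>m. D (m # ys))"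
    using assms(2) by (auto simp: ce_def)
  have P: "P n xs \<longleftrightarrow> (\<exists>m. D (m # n # xs))" for n xs using D(2)[of "n # xs"] by simp
  have "decidable (\<lambda>ys. \<forall>j<B (tl ys). \<exists>m\<le>arg 0 ys. D (m # j # tl ys))"
    by (intro rec_intros D(1)[THEN decidable_subst] assms(1)[THEN total_recursive_subst])
  then show ?thesis
  proof (rule ceI)
    fix xs
    have "(\<forall>j<B xs. \<exists>m. D (m # j # xs)) \<longleftrightarrow> (\<exists>M. \<forall>j<B xs. \<exists>m\<le>M. D (m # j # xs))"
    proof
      assume "\<forall>j<B xs. \<exists>m. D (m # j # xs)"
      then obtain m where m: "\<And>j. j < B xs \<Longrightarrow> D (m j # j # xs)" by metis
      then have "\<forall>j<B xs. \<exists>i\<le>Max (m ` {..<B xs}). D (i # j # xs)"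
        by (auto intro!: exI[of _ "m _"])
      then show "\<exists>M. \<forall>j<B xs. \<exists>m\<le>M. D (m # j # xs)" by blast
    qed blast
    then show "(\<forall>j<B xs. P j xs) \<longleftrightarrow> (\<exists>m. \<forall>j<B (tl (m # xs)). \<exists>k\<le>arg 0 (m # xs). D (k # j # tl (m # xs)))"
      by (simp add: P)
  qed
qed

lemma ce_relation_iff: "ce_relation R \<longleftrightarrow> ce (\<lambda>xs. R (arg 0 xs) (arg 1 xs))"
proof
  assume "ce_relation R"
  then obtain r where r: "total_recursive r" "\<And>a b. R a b \<longleftrightarrow> (\<exists>m. r [m, a, b] = 0)"
    by (auto simp: ce_relation_def)
  have "decidable (\<lambda>ys. r [arg 0 ys, arg 1 ys, arg 2 ys] = 0)"
    by (intro rec_intros r(1)[THEN total_recursive_subst])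
  then show "ce (\<lambda>xs. R (arg 0 xs) (arg 1 xs))"
    by (rule ceI) (simp add: r(2))
next
  assume "ce (\<lambda>xs. R (arg 0 xs) (arg 1 xs))"
  then obtain D where D: "decidable D" "\<And>xs. R (arg 0 xs) (arg 1 xs) \<longleftrightarrow> (\<exists>m. D (m # xs))"
    by (auto simp: ce_def)
  have "total_recursive (\<lambda>xs. of_bool (\<not> D xs))" by (intro rec_intros D(1))
  moreover have "R a b \<longleftrightarrow> (\<exists>m. of_bool (\<not> D [m, a, b]) = (0::nat))" for a b
    using D(2)[of "[a, b]"] by simp
  ultimately show "ce_relation R" unfolding ce_relation_def by blast
qed

lemma ce_relation_subst [rec_intros]:
  assumes "ce_relation R" "total_recursive F" "total_recursive G"
  shows "ce (\<lambda>xs. R (F xs) (G xs))"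
  using ce_subst[OF assms(1)[unfolded ce_relation_iff], of "\<lambda>xs. [F xs, G xs]"] assms(2,3)
  by (simp add: rec_intros)

text \<open>A string whose cylinder contains \<open>x\<close> is a prefix of \<open>x\<close>, so
  the union over strings becomes a search over lengths.\<close>

lemma mem_uniformly_Sigma1:
  assumes "\<forall>n. V n = (\<Union>\<sigma>\<in>{\<sigma>. R n (string_encode \<sigma>)}. cylinder \<sigma>)"
  shows "x \<in> V n \<longleftrightarrow> (\<exists>l. R n (string_code l (bits x l)))"
proof
  assume "x \<in> V n"
  then obtain \<sigma> where \<sigma>: "R n (string_encode \<sigma>)" "x \<in> cylinder \<sigma>" using assms by auto
  obtain b where b: "\<sigma> = bit_list (length \<sigma>) b" using bit_list_surj by metis
  have "bits x (length \<sigma>) = b mod 2 ^ length \<sigma>" using \<sigma>(2) b mem_cylinder_bit_list by metis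
  then have "bit_list (length \<sigma>) (bits x (length \<sigma>)) = \<sigma>" using b by (simp add: bit_list_mod)
  then show "\<exists>l. R n (string_code l (bits x l))" using \<sigma>(1) by (metis string_code_def)
next
  assume "\<exists>l. R n (string_code l (bits x l))"
  then show "x \<in> V n"
    using assms by (auto simp: string_code_def mem_cylinder_bit_list bits_less)
qed

text \<open>Here \<open>W\<close> sees a length, the number coding the prefix of that length, and
  the index. A relation on strings is recovered from it by asking for a normalized code
  \<open>b < 2 ^ l\<close>.\<close>

lemma uniformly_Sigma1I:
  assumes "ce W" "\<And>n x. x \<in> V n \<longleftrightarrow> (\<exists>l. W [l, bits x l, n])"
  shows "uniformly_Sigma1 V"
proof -
  define R where "R n c \<longleftrightarrow> (\<exists>l b. c = string_code l b \<and> b < 2 ^ l \<and> W [l, b, n])" for n c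
  have "ce_relation R"
    unfolding ce_relation_iff R_def
    by (intro rec_intros assms(1)[THEN ce_subst])
  moreover have "V n = (\<Union>\<sigma>\<in>{\<sigma>. R n (string_encode \<sigma>)}. cylinder \<sigma>)" for n
  proof (intro set_eqI iffI)
    fix x assume "x \<in> V n"
    then obtain l where "W [l, bits x l, n]" using assms(2) by blast
    then have "R n (string_encode (bit_list l (bits x l)))"
      unfolding R_def by (intro exI[of _ l] exI[of _ "bits x l"]) (simp add: string_code_def bits_less)
    then show "x \<in> (\<Union>\<sigma>\<in>{\<sigma>. R n (string_encode \<sigma>)}. cylinder \<sigma>)"
      by (auto intro!: exI[of _ "bit_list l (bits x l)"] simp: mem_cylinder_bit_list bits_less)
  next
    fix x assume "x \<in> (\<Union>\<sigma>\<in>{\<sigma>. R n (string_encode \<sigma>)}. cylinder \<sigma>)"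
    then obtain l b where "x \<in> cylinder (bit_list l b)" "b < 2 ^ l" "W [l, b, n]"
      by (auto simp: R_def string_code_def)
    then show "x \<in> V n" unfolding assms(2) mem_cylinder_bit_list by (intro exI[of _ l]) simp
  qed
  ultimately show ?thesis unfolding uniformly_Sigma1_def by blast
qed

section \<open>Ergodic averages\<close>

locale measure_preserving_map = prob_space M for M :: "'a measure" +
  fixes T :: "'a \<Rightarrow> 'a"
  assumes measurable_T [measurable]: "T \<in> measurable M M"
    and distr_T: "distr M M T = M"
begin

lemma integral_T: "f \<in> borel_measurable M \<Longrightarrow> (\<integral>x. f (T x) \<partial>M) = (\<integral>x. (f x :: real) \<partial>M)"
  using integral_distr[OF measurable_T, of f] distr_T by simp

lemma measurable_funpow_T [measurable]: "(T ^^ i) \<in> measurable M M"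
  by (induction i) (auto simp: comp_def)

lemma borel_measurable_funpow_T [measurable]:
  "f \<in> borel_measurable M \<Longrightarrow> (\<lambda>x. f ((T ^^ i) x) :: real) \<in> borel_measurable M"
  by (rule measurable_compose[OF measurable_funpow_T])

lemma integral_funpow_T: "f \<in> borel_measurable M \<Longrightarrow> (\<integral>x. f ((T ^^ i) x) \<partial>M) = (\<integral>x. (f x :: real) \<partial>M)"
proof (induction i)
  case (Suc i)
  have "(\<integral>x. f ((T ^^ Suc i) x) \<partial>M) = (\<integral>x. f ((T ^^ i) (T x)) \<partial>M)"
    by (simp add: funpow_swap1)
  also have "\<dots> = (\<integral>x. f ((T ^^ i) x) \<partial>M)"
    using Suc.prems by (intro integral_T[where f = "\<lambda>x. f ((T ^^ i) x)"] borel_measurable_funpow_T)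
  finally show ?case using Suc by simp
qed simp

lemma integrable_bounded:
  "f \<in> borel_measurable M \<Longrightarrow> (\<And>x. \<bar>f x\<bar> \<le> (B::real)) \<Longrightarrow> integrable M f"
  by (rule integrable_const_bound[where B = B]) auto

definition bsum :: "nat \<Rightarrow> ('a \<Rightarrow> real) \<Rightarrow> 'a \<Rightarrow> real" where
  "bsum n f x = (\<Sum>i<n. f ((T ^^ i) x))"

definition avg :: "nat \<Rightarrow> ('a \<Rightarrow> real) \<Rightarrow> 'a \<Rightarrow> real" where
  "avg n f x = bsum n f x / n"

lemma measurable_bsum [measurable]: "f \<in> borel_measurable M \<Longrightarrow> bsum n f \<in> borel_measurable M"
  unfolding bsum_def by (intro borel_measurable_sum borel_measurable_funpow_T)

lemma measurable_avg [measurable]: "f \<in> borel_measurable M \<Longrightarrow> avg n f \<in> borel_measurable M"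
  unfolding avg_def by (intro borel_measurable_divide measurable_bsum borel_measurable_const)

text \<open>This is the maximum of \<open>bsum n u x\<close> over \<open>n \<le> N\<close>, written
  as a recursion along the orbit because the maximal inequality compares its values at
  \<open>x\<close> and \<open>T x\<close>.\<close>

fun max_excess :: "('a \<Rightarrow> real) \<Rightarrow> nat \<Rightarrow> 'a \<Rightarrow> real" where
  "max_excess u 0 x = 0"
| "max_excess u (Suc N) x = max 0 (u x + max_excess u N (T x))"

lemma max_excess_nonneg: "0 \<le> max_excess u N x"
  by (cases N) auto

lemma max_excess_mono: "max_excess u N x \<le> max_excess u (Suc N) x"
proof (induction N arbitrary: x)
  case (Suc N)
  then show ?case by (simp add: max.coboundedI2)
qed simp

lemma bsum_Suc_shift: "bsum (Suc n) f x = f x + bsum n f (T x)"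
  unfolding bsum_def sum.lessThan_Suc_shift by (simp add: funpow_swap1)

lemma max_excess_ge: "n \<le> N \<Longrightarrow> bsum n u x \<le> max_excess u N x"
proof (induction N arbitrary: n x)
  case 0
  then show ?case by (simp add: bsum_def)
next
  case (Suc N)
  show ?case
  proof (cases n)
    case 0
    then show ?thesis by (simp add: bsum_def)
  next
    case (Suc m)
    then show ?thesis using Suc.IH[of m "T x"] Suc.prems by (simp add: bsum_Suc_shift)
  qed
qed

lemma max_excess_attained: "\<exists>n\<le>N. max_excess u N x = bsum n u x"
proof (induction N arbitrary: x)
  case 0
  then show ?case by (simp add: bsum_def)
next
  case (Suc N)
  obtain n where "n \<le> N" "max_excess u N (T x) = bsum n u (T x)" using Suc by blast
  then have "max_excess u (Suc N) x = max 0 (bsum (Suc n) u x)" "Suc n \<le> Suc N"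
    by (simp_all add: bsum_Suc_shift)
  moreover have "bsum 0 u x = 0" by (simp add: bsum_def)
  ultimately show ?case
    by (metis le0 max_def)
qed

lemma measurable_max_excess [measurable]:
  assumes [measurable]: "u \<in> borel_measurable M"
  shows "max_excess u N \<in> borel_measurable M"
proof (induction N)
  case (Suc N)
  note [measurable] = Suc
  show ?case unfolding max_excess.simps by measurable
qed simp

lemma max_excess_bound:
  assumes "\<And>x. \<bar>u x\<bar> \<le> B" shows "\<bar>max_excess u N x\<bar> \<le> N * B"
proof (induction N arbitrary: x)
  case (Suc N)
  have "0 \<le> B" using assms[of x] by linarith
  then show ?case using Suc[of "T x"] assms[of x] by (auto simp: algebra_simps max_def abs_if split: if_splits)
qed simp

text \<open>Garsia's argument: \<open>max_excess u N x - max_excess u N (T x)\<close> is at most \<open>u x\<close> on the set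
  where \<open>max_excess u N\<close> is positive, and it is nonpositive elsewhere.\<close>

lemma maximal_inequality_finite:
  assumes [measurable]: "u \<in> borel_measurable M" and B: "\<And>x. \<bar>u x\<bar> \<le> B"
  shows "0 \<le> (\<integral>x. u x * indicator {x. 0 < max_excess u N x} x \<partial>M)"
proof -
  let ?m = "max_excess u N"
  have int: "integrable M ?m" "integrable M (\<lambda>x. ?m (T x))"
    "integrable M (\<lambda>x. u x * indicator {x. 0 < ?m x} x)"
    by (rule integrable_bounded[where B = "N * B"], measurable, rule max_excess_bound[OF B])
       (rule integrable_bounded[where B = "N * B"], measurable, rule max_excess_bound[OF B],
        rule integrable_bounded[where B = B], measurable, 
        use B in \<open>auto simp: indicator_def intro: order_trans[OF abs_ge_zero]\<close>)
  have "0 = (\<integral>x. ?m x - ?m (T x) \<partial>M)"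
    using int by (simp add: integral_T)
  also have "\<dots> \<le> (\<integral>x. u x * indicator {x. 0 < ?m x} x \<partial>M)"
  proof (intro integral_mono Bochner_Integration.integrable_diff int)
    fix x
    show "?m x - ?m (T x) \<le> u x * indicator {x. 0 < ?m x} x"
    proof (cases N)
      case (Suc K)
      then show ?thesis
        using max_excess_mono[of u K "T x"] max_excess_nonneg[of u N "T x"]
        by (auto simp: indicator_def max_def simp del: max_excess.simps(2) split: if_splits)
           (auto simp: max_def split: if_splits)
    qed simp
  qed
  finally show ?thesis .
qed

text \<open>The finite version is applied to \<open>h - \<delta>\<close>, whose Birkhoff sum is
  positive exactly when that of \<open>h\<close> exceeds \<open>n * \<delta>\<close>; the sets for
  finite horizons \<open>N\<close> increase to the set in the statement.\<close>

lemma maximal_inequality: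
  assumes [measurable]: "h \<in> borel_measurable M" and h: "\<And>x. 0 \<le> h x" "\<And>x. h x \<le> B"
    and "0 < \<delta>"
  shows "\<delta> * measure M {x\<in>space M. \<exists>n. n * \<delta> < bsum n h x} \<le> (\<integral>x. h x \<partial>M)"
proof -
  define u where "u x = h x - \<delta>" for x
  have [measurable]: "u \<in> borel_measurable M" unfolding u_def by measurable
  have u: "\<bar>u x\<bar> \<le> B + \<delta>" for x using h[of x] \<open>0 < \<delta>\<close> by (auto simp: u_def abs_if)
  have bsum_u: "bsum n u x = bsum n h x - n * \<delta>" for n x
    by (simp add: bsum_def u_def sum_subtractf)
  define E where "E N = {x\<in>space M. 0 < max_excess u N x}" for N
  have [measurable]: "E N \<in> sets M" for N unfolding E_def by measurable
  have fin: "\<delta> * measure M (E N) \<le> (\<integral>x. h x \<partial>M)" for N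
  proof -
    have "0 \<le> B" using h order_trans by blast
    then have ih: "integrable M h" "integrable M (\<lambda>x. h x * indicator (E N) x)"
      using h by (auto intro!: integrable_bounded[where B = B] simp: indicator_def)
    have id: "integrable M (\<lambda>x. \<delta> * indicator (E N) x)"
      by (auto intro!: integrable_real_indicator simp: less_top[symmetric])
    have "0 \<le> (\<integral>x. u x * indicator {x. 0 < max_excess u N x} x \<partial>M)"
      by (rule maximal_inequality_finite[OF _ u]) measurable
    also have "\<dots> = (\<integral>x. h x * indicator (E N) x - \<delta> * indicator (E N) x \<partial>M)"
      by (intro Bochner_Integration.integral_cong) (auto simp: E_def u_def indicator_def)
    also have "\<dots> = (\<integral>x. h x * indicator (E N) x \<partial>M) - \<delta> * measure M (E N)"
      using ih id by (simp add: sets.Int_space_eq2)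
    also have "(\<integral>x. h x * indicator (E N) x \<partial>M) \<le> (\<integral>x. h x \<partial>M)"
      using ih h by (intro integral_mono) (auto simp: indicator_def)
    finally show ?thesis by simp
  qed
  have "incseq E"
    using max_excess_mono by (intro incseq_SucI) (auto simp: E_def intro: less_le_trans)
  then have "(\<lambda>N. measure M (E N)) \<longlonglongrightarrow> measure M (\<Union>N. E N)"
    by (intro finite_Lim_measure_incseq) auto
  then have "\<delta> * measure M (\<Union>N. E N) \<le> (\<integral>x. h x \<partial>M)"
    by (intro LIMSEQ_le_const2[OF tendsto_mult_left]) (use fin in auto)
  also have "(\<Union>N. E N) = {x\<in>space M. \<exists>n. n * \<delta> < bsum n h x}"
  proof (intro set_eqI iffI)
    fix x assume "x \<in> (\<Union>N. E N)"
    then obtain N where "x \<in> space M" "0 < max_excess u N x" by (auto simp: E_def)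
    then show "x \<in> {x\<in>space M. \<exists>n. n * \<delta> < bsum n h x}"
      using max_excess_attained[of N u x] by (auto simp: bsum_u)
  next
    fix x assume "x \<in> {x\<in>space M. \<exists>n. n * \<delta> < bsum n h x}"
    then obtain n where "x \<in> space M" "0 < bsum n u x" by (auto simp: bsum_u)
    then show "x \<in> (\<Union>N. E N)"
      using max_excess_ge[of n n u x] by (auto simp: E_def intro!: exI[of _ n])
  qed
  finally show ?thesis .
qed

section \<open>Comparing averages of different lengths\<close>

lemma bsum_bounds:
  assumes "\<And>x. 0 \<le> g x" "\<And>x. g x \<le> K"
  shows "0 \<le> bsum n g x" "bsum n g x \<le> n * K"
  using assms sum_bounded_above[of "{..<n}" "\<lambda>i. g ((T ^^ i) x)" K]
  by (auto simp: bsum_def sum_nonneg)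

lemma bsum_add: "bsum (m + n) f x = bsum m f x + bsum n f ((T ^^ m) x)"
  by (induction n) (auto simp: bsum_def funpow_add comp_def add.commute)

text \<open>The windows of length \<open>Q\<close> starting at \<open>x\<close> and at its
  \<open>i\<close>-th iterate differ by two blocks of \<open>i\<close> terms, one at each end, with
  all terms in \<open>[0, K]\<close>.\<close>

lemma avg_shift:
  assumes "\<And>x. 0 \<le> g x" "\<And>x. g x \<le> K"
  shows "\<bar>avg Q g ((T ^^ i) x) - avg Q g x\<bar> \<le> K * i / Q"
proof -
  have "bsum Q g ((T ^^ i) x) - bsum Q g x = bsum i g ((T ^^ Q) x) - bsum i g x"
    using bsum_add[of Q i g x] bsum_add[of i Q g x] by (simp add: add.commute)
  then have "avg Q g ((T ^^ i) x) - avg Q g x = (bsum i g ((T ^^ Q) x) - bsum i g x) / Q"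
    unfolding avg_def by (simp add: diff_divide_distrib[symmetric])
  moreover have "\<bar>bsum i g ((T ^^ Q) x) - bsum i g x\<bar> \<le> K * i"
    using bsum_bounds[of g K i x] bsum_bounds[of g K i "(T ^^ Q) x"] assms by (auto simp: mult.commute abs_if)
  ultimately show ?thesis by (simp add: divide_right_mono)
qed

lemma avg_commute: "avg n (avg k g) x = avg k (avg n g) x"
proof -
  have "(\<Sum>i<n. \<Sum>j<k. g ((T ^^ j) ((T ^^ i) x))) = (\<Sum>j<k. \<Sum>i<n. g ((T ^^ i) ((T ^^ j) x)))"
    by (subst sum.swap) (simp add: funpow_add[symmetric, THEN fun_cong, unfolded comp_def] add.commute)
  then show ?thesis by (simp add: avg_def bsum_def sum_divide_distrib[symmetric] mult.commute)
qed

lemma avg_near: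
  assumes "0 < n" "\<And>i. i < n \<Longrightarrow> \<bar>f ((T ^^ i) x) - c\<bar> \<le> e"
  shows "\<bar>avg n f x - c\<bar> \<le> e"
proof -
  have eq: "avg n f x - c = (\<Sum>i<n. f ((T ^^ i) x) - c) / n"
    using assms(1) by (simp add: avg_def bsum_def sum_subtractf field_simps)
  have "\<bar>\<Sum>i<n. f ((T ^^ i) x) - c\<bar> \<le> n * e"
    using sum_abs[of "\<lambda>i. f ((T ^^ i) x) - c" "{..<n}"]
      sum_bounded_above[of "{..<n}" "\<lambda>i. \<bar>f ((T ^^ i) x) - c\<bar>" e] assms(2)
    by (auto intro: order_trans)
  then show ?thesis unfolding eq using assms(1) by (simp add: pos_divide_le_eq mult.commute)
qed

text \<open>A short average hardly changes a long one: the error is small when \<open>Q\<close> is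
  large against \<open>n\<close>. Commutation then yields the companion for the opposite regime, an
  inner average that is short against \<open>n\<close>.\<close>

lemma avg_avg_near_outer:
  assumes "\<And>x. 0 \<le> g x" "\<And>x. g x \<le> K" "0 < n"
  shows "\<bar>avg n (avg Q g) x - avg Q g x\<bar> \<le> K * n / Q"
proof (rule avg_near)
  have "0 \<le> K" using assms(1)[of x] assms(2)[of x] by simp
  fix i assume "i < n"
  then have "K * real i / Q \<le> K * n / Q" using \<open>0 \<le> K\<close> by (intro divide_right_mono mult_left_mono) auto
  then show "\<bar>avg Q g ((T ^^ i) x) - avg Q g x\<bar> \<le> K * n / Q"
    using avg_shift[of g K Q i x, OF assms(1,2)] by linarith
qed fact

lemma avg_avg_near_inner:
  assumes "\<And>x. 0 \<le> g x" "\<And>x. g x \<le> K" "0 < k"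
  shows "\<bar>avg n (avg k g) x - avg n g x\<bar> \<le> K * k / n"
  using avg_avg_near_outer[OF assms, where Q = n and x = x] avg_commute[of n k g x] by simp

lemma avg_square_le: "(avg n f x)\<^sup>2 \<le> avg n (\<lambda>x. (f x)\<^sup>2) x"
proof (cases "n = 0")
  case False
  have "(\<Sum>i<n. f ((T ^^ i) x))\<^sup>2 \<le> (\<Sum>i<n. (f ((T ^^ i) x))\<^sup>2) * n"
    using sum_squared_le_sum_of_squares[of "\<lambda>i. f ((T ^^ i) x)" "{..<n}"] by simp
  then show ?thesis using False by (simp add: avg_def bsum_def field_simps power2_eq_square)
qed (simp add: avg_def)

lemma integral_avg:
  assumes [measurable]: "f \<in> borel_measurable M" and "\<And>x. \<bar>f x\<bar> \<le> B" "0 < n"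
  shows "(\<integral>x. avg n f x \<partial>M) = (\<integral>x. f x \<partial>M)"
proof -
  have "integrable M (\<lambda>x. f ((T ^^ i) x))" for i
    using assms(2) by (intro integrable_bounded[where B = B]) auto
  then have "(\<integral>x. bsum n f x \<partial>M) = n * (\<integral>x. f x \<partial>M)"
    unfolding bsum_def by (subst Bochner_Integration.integral_sum) (auto simp: integral_funpow_T)
  then show ?thesis using assms(3) by (simp add: avg_def)
qed

lemma avg_abs_le: "(\<And>x. \<bar>f x\<bar> \<le> B) \<Longrightarrow> 0 < n \<Longrightarrow> \<bar>avg n f x\<bar> \<le> B"
  using avg_near[of n f x 0 B] by simp

lemma integral_square_avg_le:
  assumes [measurable]: "f \<in> borel_measurable M" and B: "\<And>x. \<bar>f x\<bar> \<le> B" and "0 < n"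
  shows "(\<integral>x. (avg n f x)\<^sup>2 \<partial>M) \<le> (\<integral>x. (f x)\<^sup>2 \<partial>M)"
proof -
  have sq: "\<bar>(f x)\<^sup>2\<bar> \<le> B\<^sup>2" for x using power_mono[OF B[of x], where n = 2] by simp
  have "\<bar>(avg n f x)\<^sup>2\<bar> \<le> B\<^sup>2" for x
    using power_mono[OF avg_abs_le[of f B n, OF B \<open>0 < n\<close>], where n = 2] by simp
  then have "(\<integral>x. (avg n f x)\<^sup>2 \<partial>M) \<le> (\<integral>x. avg n (\<lambda>x. (f x)\<^sup>2) x \<partial>M)"
    using avg_abs_le[of "\<lambda>x. (f x)\<^sup>2", OF sq \<open>0 < n\<close>] avg_square_le
    by (intro integral_mono integrable_bounded[where B = "B\<^sup>2"]) auto
  also have "\<dots> = (\<integral>x. (f x)\<^sup>2 \<partial>M)"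
    using sq \<open>0 < n\<close> by (intro integral_avg[where B = "B\<^sup>2"]) auto
  finally show ?thesis .
qed

section \<open>Squared L2 norms of the averages and oscillation\<close>

context
  fixes g :: "'a \<Rightarrow> real" and K :: real
  assumes meas_g [measurable]: "g \<in> borel_measurable M"
    and g_nonneg: "\<And>x. 0 \<le> g x" and g_le: "\<And>x. g x \<le> K"
begin

definition avg_norm2 :: "nat \<Rightarrow> real" where
  "avg_norm2 n = (\<integral>x. (avg n g x)\<^sup>2 \<partial>M)"

private lemma K_nonneg: "0 \<le> K"
  using g_nonneg g_le order_trans by blast

private lemma avg_g_abs: "0 < n \<Longrightarrow> \<bar>avg n g x\<bar> \<le> K"
  by (rule avg_abs_le) (auto simp: g_nonneg g_le)

private lemma midpoint_bounds:
  assumes "0 < k" "0 < Q"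
  shows "\<bar>(avg k g x + avg Q g x) / 2\<bar> \<le> K"
  using avg_g_abs[OF assms(1), of x] avg_g_abs[OF assms(2), of x]
  by (auto simp: abs_le_iff)

text \<open>For large \<open>N\<close>, \<open>avg N g\<close> is close to the
  \<open>N\<close>-average of the midpoint of \<open>avg k g\<close> and \<open>avg Q g\<close>, and
  averaging does not increase the L2 norm. So in the limit no midpoint has a norm below the infimum,
  which is what the parallelogram law needs.\<close>

lemma avg_norm2_le_midpoint:
  assumes "0 < k" "0 < Q" "0 < N"
  shows "avg_norm2 N \<le> (\<integral>x. ((avg k g x + avg Q g x) / 2)\<^sup>2 \<partial>M) + 2 * K * (K * (k + Q) / N)"
proof -
  define u where "u x = (avg k g x + avg Q g x) / 2" for x
  have [measurable]: "u \<in> borel_measurable M" unfolding u_def by measurable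
  have u: "\<bar>u x\<bar> \<le> K" for x using midpoint_bounds assms by (simp add: u_def)
  \<comment> \<open>Twice the bound on the distance of the two averages; the factor
    \<open>2 * K\<close> that later accompanies it bounds their sum.\<close>
  define e where "e = K * (k + Q) / N"
  have pw: "(avg N g x)\<^sup>2 \<le> (avg N u x)\<^sup>2 + 2 * K * e" for x
  proof -
    have "avg N u x = (avg N (avg k g) x + avg N (avg Q g) x) / 2"
      by (simp add: u_def avg_def bsum_def sum.distrib sum_divide_distrib[symmetric] add_divide_distrib)
    moreover have "\<bar>avg N (avg k g) x - avg N g x\<bar> \<le> K * k / N"
      "\<bar>avg N (avg Q g) x - avg N g x\<bar> \<le> K * Q / N"
      using avg_avg_near_inner[of g K, OF g_nonneg g_le] assms by auto
    ultimately have diff: "\<bar>avg N u x - avg N g x\<bar> \<le> (K * k / N + K * Q / N) / 2"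
      by (auto simp: abs_if field_simps split: if_splits)
    also have "\<dots> \<le> e"
    proof -
      have "K * k / N + K * Q / N = e" by (simp add: e_def ring_distribs add_divide_distrib)
      moreover have "0 \<le> e" using K_nonneg by (simp add: e_def)
      ultimately show ?thesis by simp
    qed
    finally have diff: "\<bar>avg N g x - avg N u x\<bar> \<le> e" by (simp add: abs_minus_commute)
    have "(avg N g x)\<^sup>2 - (avg N u x)\<^sup>2 = (avg N g x + avg N u x) * (avg N g x - avg N u x)"
      by (simp add: power2_eq_square algebra_simps)
    also have "\<dots> \<le> \<bar>avg N g x + avg N u x\<bar> * \<bar>avg N g x - avg N u x\<bar>"
      by (metis abs_ge_self abs_mult)
    also have "\<dots> \<le> (2 * K) * e"
      using diff abs_triangle_ineq[of "avg N g x" "avg N u x"] avg_g_abs[OF assms(3), of x]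
        avg_abs_le[of u K N x, OF u assms(3)] K_nonneg
      by (intro mult_mono) auto
    finally show ?thesis by simp
  qed
  have bd: "\<bar>(avg N g x)\<^sup>2\<bar> \<le> K\<^sup>2" "\<bar>(avg N u x)\<^sup>2\<bar> \<le> K\<^sup>2" for x
    using power_mono[OF avg_g_abs[OF assms(3)], where n = 2] power_mono[OF avg_abs_le[of u K N, OF u assms(3)], where n = 2]
    by auto
  have int: "integrable M (\<lambda>x. (avg N g x)\<^sup>2)" "integrable M (\<lambda>x. (avg N u x)\<^sup>2)"
    using bd by (auto intro!: integrable_bounded[where B = "K\<^sup>2"])
  have "avg_norm2 N \<le> (\<integral>x. (avg N u x)\<^sup>2 + 2 * K * e \<partial>M)"
    unfolding avg_norm2_def using int pw by (intro integral_mono) auto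
  also have "\<dots> = (\<integral>x. (avg N u x)\<^sup>2 \<partial>M) + 2 * K * e"
    using int by (simp add: prob_space)
  also have "(\<integral>x. (avg N u x)\<^sup>2 \<partial>M) \<le> (\<integral>x. (u x)\<^sup>2 \<partial>M)"
    by (rule integral_square_avg_le[OF _ u assms(3)]) measurable
  finally show ?thesis by (simp add: u_def e_def)
qed

text \<open>Comparing with \<open>avg Q g\<close> for a large \<open>Q\<close> replaces the mean ergodic limit: if \<open>avg_norm2 Q\<close> is
  close to the infimum \<open>I\<close>, the parallelogram law bounds the distance of \<open>avg k g\<close> and \<open>avg Q g\<close>
  in terms of \<open>avg_norm2 k - I\<close>.\<close>

lemma oscillation_bound:
  assumes I: "\<And>n. 0 < n \<Longrightarrow> I \<le> avg_norm2 n" "\<And>\<epsilon>. 0 < \<epsilon> \<Longrightarrow> \<exists>n>0. avg_norm2 n < I + \<epsilon>"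
    and k: "0 < k" and \<delta>: "0 < \<delta>" and N: "K * k \<le> \<delta> * real N" "0 < N"
  shows "measure M {x\<in>space M. \<exists>n\<ge>N. \<exists>m\<ge>N. 6 * \<delta> < avg n g x - avg m g x} \<le> 2 * (avg_norm2 k - I) / \<delta>\<^sup>2"
proof -
  \<comment> \<open>Truncation at \<open>L\<close> lets \<open>Q\<close> be chosen after
    \<open>L\<close>, so large that \<open>avg Q g\<close> hardly moves under averaging over
    \<open>n \<le> L\<close> steps.\<close>
  define V where "V (L :: nat) = {x\<in>space M. \<exists>n\<in>{N..L}. \<exists>m\<in>{N..L}. 6 * \<delta> < avg n g x - avg m g x}" for L
  have [measurable]: "V L \<in> sets M" for L
  proof -
    have "V L = (\<Union>n\<in>{N..L}. \<Union>m\<in>{N..L}. {x\<in>space M. 6 * \<delta> < avg n g x - avg m g x})"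
      by (auto simp: V_def)
    moreover have "{x\<in>space M. 6 * \<delta> < avg n g x - avg m g x} \<in> sets M" for n m
      by (intro borel_measurable_less borel_measurable_diff measurable_avg meas_g borel_measurable_const)
    ultimately show ?thesis by (auto intro!: sets.finite_UN)
  qed
  have lim0: "(\<lambda>L. c / real L) \<longlonglongrightarrow> 0" for c
    by (rule lim_const_over_n)
  \<comment> \<open>The midpoint bound with \<open>k = Q = P\<close> says that the norm of a long
    average exceeds that of \<open>avg P g\<close> by little, so nearly minimal norms occur at
    arbitrarily large lengths.\<close>
  have large: "\<exists>Q\<ge>L. 0 < Q \<and> avg_norm2 Q < I + \<epsilon>" if pos: "0 < \<epsilon>" for L \<epsilon>
  proof -
    obtain P where P: "0 < P" "avg_norm2 P < I + \<epsilon> / 2"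
      using I(2)[OF half_gt_zero[OF pos]] by blast
    have "\<forall>\<^sub>F Q in sequentially. 2 * K * K * (P + P) / real Q < \<epsilon> / 2"
      by (rule order_tendstoD(2)[OF lim0]) (use that in simp)
    then have "\<forall>\<^sub>F Q in sequentially. L \<le> Q \<and> 0 < Q \<and> 2 * K * K * (P + P) / real Q < \<epsilon> / 2"
      using eventually_ge_at_top[of L] eventually_gt_at_top[of 0] by eventually_elim simp
    then obtain Q where Q: "L \<le> Q" "0 < Q" "2 * K * K * (P + P) / real Q < \<epsilon> / 2"
      using eventually_happens'[OF sequentially_bot] by blast
    have "avg_norm2 Q \<le> avg_norm2 P + 2 * K * (K * (P + P) / Q)"
      using avg_norm2_le_midpoint[OF P(1) P(1) Q(2)] by (simp add: avg_norm2_def)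
    then show ?thesis using P Q by (intro exI[of _ Q]) (auto simp: mult.assoc)
  qed
  have fin: "measure M (V L) \<le> (2 * (avg_norm2 k - I) + 2 * \<epsilon>) / \<delta>\<^sup>2" if "0 < \<epsilon>" for L \<epsilon>
  proof -
    obtain Q where Q: "0 < Q" "avg_norm2 Q < I + \<epsilon>" and QL: "K * L \<le> \<delta> * Q"
    proof -
      obtain R :: nat where R: "K * L / \<delta> \<le> R" using real_arch_simple by blast
      obtain Q where "Q \<ge> R" "0 < Q" "avg_norm2 Q < I + \<epsilon>" using large \<open>0 < \<epsilon>\<close> by blast
      moreover from this have "K * L / \<delta> \<le> Q" using R by linarith
      then have "K * L \<le> \<delta> * Q" using \<delta> by (simp add: field_simps)
      ultimately show ?thesis using that by blast
    qed
    define h where "h x = avg k g x - avg Q g x" for x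
    have [measurable]: "h \<in> borel_measurable M" unfolding h_def by measurable
    have h: "\<bar>h x\<bar> \<le> 2 * K" for x
      using avg_g_abs[OF k, of x] avg_g_abs[OF Q(1), of x] by (auto simp: h_def)
    have h2: "(h x)\<^sup>2 \<le> (2 * K)\<^sup>2" for x using power_mono[OF h[of x], where n = 2] by simp
    \<comment> \<open>Three errors of size \<open>\<delta>\<close>: the average of \<open>h\<close>
      by Cauchy-Schwarz, the inner average over \<open>k\<close> because \<open>n \<ge> N\<close>,
      the outer average over \<open>n\<close> because \<open>n \<le> L\<close> and \<open>Q\<close>
      is large. Two such comparisons explain the threshold \<open>6 * \<delta>\<close>.\<close>
    have near: "\<bar>avg n g x - avg Q g x\<bar> \<le> 3 * \<delta>"
      if "n \<in> {N..L}" "\<not> real n * \<delta>\<^sup>2 < bsum n (\<lambda>x. (h x)\<^sup>2) x" for n x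
    proof -
      have n: "0 < n" using that N(2) by auto
      have "avg n (\<lambda>x. (h x)\<^sup>2) x \<le> \<delta>\<^sup>2"
        using that(2) n by (simp add: avg_def field_simps)
      then have "(avg n h x)\<^sup>2 \<le> \<delta>\<^sup>2" using avg_square_le[of n h x] by linarith
      then have 1: "\<bar>avg n h x\<bar> \<le> \<delta>" using \<delta> by (simp add: abs_le_square_iff[symmetric])
      have 2: "avg n h x = avg n (avg k g) x - avg n (avg Q g) x"
        by (simp add: h_def avg_def bsum_def sum_subtractf diff_divide_distrib)
      have 3: "\<bar>avg n (avg k g) x - avg n g x\<bar> \<le> K * k / n"
        using avg_avg_near_inner[of g K, OF g_nonneg g_le k] .
      have 4: "\<bar>avg n (avg Q g) x - avg Q g x\<bar> \<le> K * n / Q"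
        using avg_avg_near_outer[of g K, OF g_nonneg g_le n] .
      have "K * k \<le> \<delta> * n" using that(1) \<delta> by (intro order_trans[OF N(1)] mult_left_mono) auto
      then have 5: "K * k / n \<le> \<delta>" using n by (simp add: field_simps)
      have "K * n \<le> K * L" using that(1) K_nonneg by (auto intro: mult_left_mono)
      then have "K * n \<le> \<delta> * Q" using QL by linarith
      then have 6: "K * n / Q \<le> \<delta>" using Q(1) by (simp add: field_simps)
      show ?thesis using 1 2 3 4 5 6 by linarith
    qed
    have "V L \<subseteq> {x\<in>space M. \<exists>n. n * \<delta>\<^sup>2 < bsum n (\<lambda>x. (h x)\<^sup>2) x}"
    proof
      fix x assume "x \<in> V L"
      then obtain n m where nm: "x \<in> space M" "n \<in> {N..L}" "m \<in> {N..L}" "6 * \<delta> < avg n g x - avg m g x"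
        by (auto simp: V_def)
      then have "\<not> (\<bar>avg n g x - avg Q g x\<bar> \<le> 3 * \<delta> \<and> \<bar>avg m g x - avg Q g x\<bar> \<le> 3 * \<delta>)" by linarith
      then show "x \<in> {x\<in>space M. \<exists>n. n * \<delta>\<^sup>2 < bsum n (\<lambda>x. (h x)\<^sup>2) x}" using near nm by blast
    qed
    then have "\<delta>\<^sup>2 * measure M (V L) \<le> \<delta>\<^sup>2 * measure M {x\<in>space M. \<exists>n. n * \<delta>\<^sup>2 < bsum n (\<lambda>x. (h x)\<^sup>2) x}"
      by (intro mult_left_mono finite_measure_mono) auto
    also have "\<dots> \<le> (\<integral>x. (h x)\<^sup>2 \<partial>M)"
      using \<delta> h2 by (intro maximal_inequality[where B = "(2 * K)\<^sup>2"]) auto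
    also have "\<dots> = (\<integral>x. 2 * (avg k g x)\<^sup>2 + 2 * (avg Q g x)\<^sup>2 - 4 * ((avg k g x + avg Q g x) / 2)\<^sup>2 \<partial>M)"
      by (intro Bochner_Integration.integral_cong) (auto simp: h_def power2_eq_square field_simps)
    also have "\<dots> = 2 * avg_norm2 k + 2 * avg_norm2 Q - 4 * (\<integral>x. ((avg k g x + avg Q g x) / 2)\<^sup>2 \<partial>M)"
    proof -
      have "integrable M (\<lambda>x. (f x)\<^sup>2)" if "f \<in> borel_measurable M" "\<And>x. \<bar>f x\<bar> \<le> K" for f
        using that power_mono[OF that(2), where n = 2] by (intro integrable_bounded[where B = "K\<^sup>2"]) auto
      then have "integrable M (\<lambda>x. (avg k g x)\<^sup>2)" "integrable M (\<lambda>x. (avg Q g x)\<^sup>2)"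
        "integrable M (\<lambda>x. ((avg k g x + avg Q g x) / 2)\<^sup>2)"
        using avg_g_abs k Q midpoint_bounds by (auto simp del: power_divide)
      then show ?thesis by (simp add: avg_norm2_def del: power_divide)
    qed
    also have "\<dots> \<le> 2 * avg_norm2 k + 2 * avg_norm2 Q - 4 * I"
    proof -
      \<comment> \<open>Letting \<open>R\<close> grow in the midpoint bound removes the error term
        and leaves \<open>I\<close> below the squared norm of the midpoint.\<close>
      have "I \<le> (\<integral>x. ((avg k g x + avg Q g x) / 2)\<^sup>2 \<partial>M) + 2 * K * (K * (k + Q) / R)" if "1 \<le> R" for R :: nat
        using avg_norm2_le_midpoint[OF k Q(1), of R] I(1)[of R] that by simp
      moreover have "(\<lambda>R. (\<integral>x. ((avg k g x + avg Q g x) / 2)\<^sup>2 \<partial>M) + 2 * K * (K * (k + Q) / real R))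
          \<longlonglongrightarrow> (\<integral>x. ((avg k g x + avg Q g x) / 2)\<^sup>2 \<partial>M) + 2 * K * 0"
        by (intro tendsto_intros lim0)
      ultimately have "I \<le> (\<integral>x. ((avg k g x + avg Q g x) / 2)\<^sup>2 \<partial>M) + 2 * K * 0"
        by (rule LIMSEQ_le_const[rotated, OF exI[of _ 1], OF allI, OF impI])
      then show ?thesis by simp
    qed
    also have "\<dots> \<le> 2 * (avg_norm2 k - I) + 2 * \<epsilon>" using Q by simp
    finally show ?thesis using \<delta> by (simp add: field_simps)
  qed
  have fin': "measure M (V L) \<le> 2 * (avg_norm2 k - I) / \<delta>\<^sup>2" for L
  proof (rule field_le_epsilon)
    fix e :: real assume "0 < e"
    then have "measure M (V L) \<le> (2 * (avg_norm2 k - I) + 2 * (e * \<delta>\<^sup>2 / 2)) / \<delta>\<^sup>2"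
      using \<delta> by (intro fin) auto
    also have "\<dots> = 2 * (avg_norm2 k - I) / \<delta>\<^sup>2 + e" using \<delta> by (simp add: field_simps)
    finally show "measure M (V L) \<le> 2 * (avg_norm2 k - I) / \<delta>\<^sup>2 + e" .
  qed
  have "incseq V" by (intro incseq_SucI) (auto simp: V_def, force)
  then have "(\<lambda>L. measure M (V L)) \<longlonglongrightarrow> measure M (\<Union>L. V L)"
    by (intro finite_Lim_measure_incseq) auto
  then have "measure M (\<Union>L. V L) \<le> 2 * (avg_norm2 k - I) / \<delta>\<^sup>2"
    by (rule LIMSEQ_le_const2) (use fin' in auto)
  also have "(\<Union>L. V L) = {x\<in>space M. \<exists>n\<ge>N. \<exists>m\<ge>N. 6 * \<delta> < avg n g x - avg m g x}"
  proof (intro set_eqI iffI)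
    fix x assume "x \<in> {x\<in>space M. \<exists>n\<ge>N. \<exists>m\<ge>N. 6 * \<delta> < avg n g x - avg m g x}"
    then obtain n m where "x \<in> space M" "N \<le> n" "N \<le> m" "6 * \<delta> < avg n g x - avg m g x" by blast
    then have "x \<in> V (max n m)" unfolding V_def by fastforce
    then show "x \<in> (\<Union>L. V L)" by blast
  qed (auto simp: V_def, blast)
  finally show ?thesis .
qed

end

end

section \<open>Codes of rationals\<close>

definition magnitude :: "nat \<Rightarrow> nat" where
  "magnitude a = (if a mod 2 = 0 then a div 2 else Suc (a div 2))"

text \<open>The integer part of \<open>2 ^ k\<close> times the coded rational, cut off at
  \<open>0\<close>. A code is a pair of coded integers whose parities give their signs, so equal
  parities mean a nonnegative quotient; a zero denominator yields \<open>0\<close> here as it does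
  for \<open>Fract\<close>.\<close>

definition dyadic_floor :: "nat \<Rightarrow> nat \<Rightarrow> nat" where
  "dyadic_floor k c = (if fst (prod_decode c) mod 2 = snd (prod_decode c) mod 2
     then 2 ^ k * magnitude (fst (prod_decode c)) div magnitude (snd (prod_decode c)) else 0)"

lemma int_decode_magnitude:
  "int_decode a = (if a mod 2 = 0 then int (magnitude a) else - int (magnitude a))"
  by (auto simp: int_decode_def sum_decode_def magnitude_def even_iff_mod_2_eq_zero)

lemma dyadic_floor_eq: "dyadic_floor k c = nat \<lfloor>2 ^ k * real_of_rat (nat_to_rat_surj c)\<rfloor>"
proof -
  obtain a b where c: "prod_decode c = (a, b)" by force
  have q: "real_of_rat (nat_to_rat_surj c) = of_int (int_decode a) / of_int (int_decode b)"
  proof (cases "int_decode b = 0")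
    case False
    then show ?thesis by (simp add: nat_to_rat_surj_def c of_rat_rat)
  qed (simp add: nat_to_rat_surj_def c rat_number_collapse)
  have pos: "nat \<lfloor>2 ^ k * (real u / real v)\<rfloor> = 2 ^ k * u div v" for u v :: nat
    using floor_divide_of_nat_eq[of "2 ^ k * u" v, where 'a = real] by simp
  have neg: "nat \<lfloor>2 ^ k * (- real u / real v)\<rfloor> = 0" for u v :: nat
  proof (rule nat_le_0)
    have "2 ^ k * (- real u / real v) \<le> (0 :: real)"
      by (intro mult_nonneg_nonpos divide_nonpos_nonneg) auto
    from floor_mono[OF this] show "\<lfloor>2 ^ k * (- real u / real v)\<rfloor> \<le> 0"
      by (simp only: floor_zero)
  qed
  have "a mod 2 = 0 \<or> a mod 2 = 1" "b mod 2 = 0 \<or> b mod 2 = 1" by auto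
  then show ?thesis
    unfolding q dyadic_floor_def c int_decode_magnitude using pos neg
    by (auto simp: minus_divide_left[symmetric] simp del: of_nat_0_eq_iff)
qed

lemma dyadic_floor_le: "dyadic_floor k c / 2 ^ k \<le> max 0 (real_of_rat (nat_to_rat_surj c))"
proof -
  let ?q = "real_of_rat (nat_to_rat_surj c)"
  have "real (nat \<lfloor>2 ^ k * ?q\<rfloor>) \<le> max 0 (2 ^ k * ?q)" by linarith
  also have "\<dots> = 2 ^ k * max 0 ?q"
  proof (cases "0 \<le> ?q")
    case True
    then show ?thesis by (simp only: max_absorb2 mult_nonneg_nonneg zero_le_power zero_le_numeral)
  next
    case False
    then have "2 ^ k * ?q \<le> 0" by (intro mult_nonneg_nonpos) auto
    with False show ?thesis by (simp only: max_absorb1 linear not_le less_imp_le mult_zero_right)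
  qed
  finally show ?thesis by (simp add: dyadic_floor_eq field_simps)
qed

lemma dyadic_floor_gt: "real_of_rat (nat_to_rat_surj c) - 1 / 2 ^ k < dyadic_floor k c / 2 ^ k"
proof -
  let ?q = "real_of_rat (nat_to_rat_surj c)"
  have "2 ^ k * ?q - 1 < real (nat \<lfloor>2 ^ k * ?q\<rfloor>)" by linarith
  then have "(2 ^ k * ?q - 1) / 2 ^ k < real (nat \<lfloor>2 ^ k * ?q\<rfloor>) / 2 ^ k"
    by (intro divide_strict_right_mono) auto
  then show ?thesis by (simp add: dyadic_floor_eq diff_divide_distrib)
qed

lemma total_recursive_magnitude [rec_intros]:
  assumes "total_recursive F" shows "total_recursive (\<lambda>xs. magnitude (F xs))"
  unfolding magnitude_def by (intro rec_intros assms)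

lemma total_recursive_dyadic_floor [rec_intros]:
  assumes "total_recursive F" "total_recursive G"
  shows "total_recursive (\<lambda>xs. dyadic_floor (F xs) (G xs))"
  unfolding dyadic_floor_def by (intro rec_intros assms)

text \<open>The subtraction is built into the code because the sequence \<open>\<beta>\<close> of a
  test may be negative, while recursive functions have natural values.\<close>

definition quotient_code :: "nat \<Rightarrow> nat \<Rightarrow> nat \<Rightarrow> nat" where
  "quotient_code a b d = prod_encode (if b \<le> a then 2 * (a - b) else Suc (2 * (b - a - 1)), 2 * d)"

lemma quotient_code:
  assumes "0 < d"
  shows "real_of_rat (nat_to_rat_surj (quotient_code a b d)) = (real a - real b) / real d"
proof -
  have "int_decode (if b \<le> a then 2 * (a - b) else Suc (2 * (b - a - 1))) = int a - int b"
    "int_decode (2 * d) = int d"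
    by (auto simp: int_decode_def sum_decode_def)
  then show ?thesis
    using assms by (simp add: nat_to_rat_surj_def quotient_code_def of_rat_rat)
qed

lemma total_recursive_quotient_code [rec_intros]:
  assumes "total_recursive F" "total_recursive G" "total_recursive H"
  shows "total_recursive (\<lambda>xs. quotient_code (F xs) (G xs) (H xs))"
  unfolding quotient_code_def by (intro rec_intros assms)

section \<open>Tests from integrals of step functions\<close>

lemma sets_bits: "{x. bits x m = b} \<in> sets borel"
proof -
  have coord: "{x :: cantor. x i = c} \<in> sets borel" for i c
  proof -
    have "open ((\<lambda>x :: cantor. x i) -` {c})"
      by (rule open_vimage[OF discrete_topology_class.open_discrete continuous_on_product_coordinates])
    then show ?thesis by (auto simp: vimage_def)
  qed
  show ?thesis
  proof (cases "b < 2 ^ m")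
    case True
    then have "{x. bits x m = b} = (\<Inter>i\<in>{..<m}. {x. x i = bit b i})"
      using bits_eq_mod_iff[of _ m b] by auto
    moreover have "(\<Inter>i\<in>{..<m}. {x :: cantor. x i = bit b i}) \<in> sets borel"
      using coord by (cases "m = 0") (auto intro!: sets.finite_INT)
    ultimately show ?thesis by simp
  next
    case False
    then have "{x. bits x m = b} = {}" using bits_less by auto
    then show ?thesis by simp
  qed
qed

lemma measurable_bits [measurable]: "(\<lambda>x. bits x m) \<in> measurable borel (count_space UNIV)"
  by (subst measurable_count_space_eq2_countable) (auto simp: vimage_def sets_bits)

locale computable_measure = prob_space \<mu> for \<mu> :: "cantor measure" +
  assumes computable: "computable_prob_measure \<mu>"
begin

lemma sets_borel [measurable_cong, simp]: "sets \<mu> = sets borel"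
  using computable by (simp add: computable_prob_measure_def)

lemma space_UNIV [simp]: "space \<mu> = UNIV"
  using sets_eq_imp_space_eq[OF sets_borel] by simp

lemma integrable_step: "integrable \<mu> (\<lambda>x. real (F (bits x s)))"
proof (rule integrable_const_bound)
  show "AE x in \<mu>. norm (real (F (bits x s))) \<le> Max (F ` {..<2 ^ s})"
    by (auto simp: bits_less intro!: Max_ge)
  show "(\<lambda>x. real (F (bits x s))) \<in> borel_measurable \<mu>"
    by measurable
qed

lemma integral_step:
  "(\<integral>x. real (F (bits x s)) \<partial>\<mu>) = (\<Sum>b<2 ^ s. real (F b) * measure \<mu> {x. bits x s = b})"
proof -
  have "real (F (bits x s)) = (\<Sum>b<2 ^ s. real (F b) * indicator {x. bits x s = b} x)" for x
    by (simp add: indicator_def if_distrib[where f = "\<lambda>a. _ * a"] bits_less cong: if_cong)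
  then have "(\<integral>x. real (F (bits x s)) \<partial>\<mu>)
      = (\<integral>x. (\<Sum>b<2 ^ s. real (F b) * indicator {x. bits x s = b} x) \<partial>\<mu>)" by presburger
  also have "\<dots> = (\<Sum>b<2 ^ s. real (F b) * measure \<mu> {x. bits x s = b})"
    by (subst Bochner_Integration.integral_sum)
       (auto simp: sets_bits less_top[symmetric] intro!: integrable_real_indicator)
  finally show ?thesis .
qed

text \<open>One error \<open>1 / 2 ^ k\<close> comes from the computability of the measure and one
  from rounding down; cutting off at \<open>0\<close> does no harm since measures are
  nonnegative.\<close>

lemma measure_approx:
  obtains p :: "nat \<Rightarrow> nat \<Rightarrow> nat \<Rightarrow> nat"
    where "total_recursive (\<lambda>xs. p (arg 0 xs) (arg 1 xs) (arg 2 xs))"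
      and "\<And>k m b. b < 2 ^ m \<Longrightarrow> \<bar>measure \<mu> {x. bits x m = b} - p k m b / 2 ^ k\<bar> \<le> 2 / 2 ^ k"
proof -
  obtain r where r: "total_recursive r"
    "\<And>\<sigma> k. \<bar>measure \<mu> (cylinder \<sigma>) - of_rat (nat_to_rat_surj (r [string_encode \<sigma>, k]))\<bar> \<le> 1 / 2 ^ k"
    using computable by (auto simp: computable_prob_measure_def)
  define p where "p k m b = dyadic_floor k (r [string_code m b, k])" for k m b
  show ?thesis
  proof (rule that)
    show "total_recursive (\<lambda>xs. p (arg 0 xs) (arg 1 xs) (arg 2 xs))"
      unfolding p_def by (intro rec_intros r(1)[THEN total_recursive_subst])
    fix k m b :: nat assume "b < 2 ^ m"
    then have "cylinder (bit_list m b) = {x. bits x m = b}" by (auto simp: mem_cylinder_bit_list)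
    then have "\<bar>measure \<mu> {x. bits x m = b} - of_rat (nat_to_rat_surj (r [string_code m b, k]))\<bar> \<le> 1 / 2 ^ k"
      using r(2)[of "bit_list m b" k] by (simp add: string_code_def)
    moreover have "2 / 2 ^ k = 1 / 2 ^ k + (1 / 2 ^ k :: real)" "0 < (1 / 2 ^ k :: real)" by simp_all
    ultimately show "\<bar>measure \<mu> {x. bits x m = b} - p k m b / 2 ^ k\<bar> \<le> 2 / 2 ^ k"
      using dyadic_floor_le[of k "r [string_code m b, k]"] dyadic_floor_gt[of "r [string_code m b, k]" k]
        measure_nonneg[of \<mu> "{x. bits x m = b}"]
      unfolding p_def abs_le_iff max_def by (simp only: split: if_splits) linarith+
  qed
qed

text \<open>All three tests pass through this lemma. The \<open>I s\<close> are integrals of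
  explicit step functions, hence uniformly computable, whereas \<open>B\<close> may be
  noncomputable. Rational lower approximations of \<open>I s\<close>, shifted by an integer, form
  \<open>\<beta>\<close>, and the gap \<open>B - I s\<close> pays for \<open>V s\<close>. Values
  near \<open>B\<close> are asked for only at arbitrarily large \<open>s\<close>, which leaves room
  for an enumeration that keeps returning to poor stages.\<close>

lemma oberwolfach_random_avoids:
  fixes F :: "nat \<Rightarrow> nat \<Rightarrow> nat" and e :: "nat \<Rightarrow> nat" and B :: real
  defines "I \<equiv> \<lambda>s. (\<integral>x. real (F s (bits x s)) \<partial>\<mu>) / real (e s)"
  assumes z: "oberwolfach_random \<mu> z"
    and V: "uniformly_Sigma1 V" "\<And>n. V (Suc n) \<subseteq> V n"
    and F: "total_recursive (\<lambda>xs. F (arg 0 xs) (arg 1 xs))"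
    and e: "total_recursive (\<lambda>xs. e (arg 0 xs))" "\<And>s. 0 < e s"
    and le: "\<And>s. measure \<mu> (V s) + I s \<le> B"
    and lim: "\<And>s0 \<epsilon>. 0 < \<epsilon> \<Longrightarrow> \<exists>s\<ge>s0. B - \<epsilon> < I s"
  shows "\<exists>s. z \<notin> V s"
proof -
  obtain p where p: "total_recursive (\<lambda>xs. p (arg 0 xs) (arg 1 xs) (arg 2 xs))"
    "\<And>k m b. b < 2 ^ m \<Longrightarrow> \<bar>measure \<mu> {x. bits x m = b} - p k m b / 2 ^ k\<bar> \<le> 2 / 2 ^ k"
    by (rule measure_approx) blast
  \<comment> \<open>Precision: the error of the weighted sum is at most
    \<open>S * (2 / 2 ^ k s)\<close>, where \<open>S\<close> is the sum of the values of
    \<open>F s\<close>, and \<open>S < 2 ^ S\<close> turns this into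
    \<open>1 / 2 ^ s\<close>.\<close>
  define k where "k s = Suc (s + (\<Sum>b<2 ^ s. F s b))" for s
  define N where "N s = (\<Sum>b<2 ^ s. F s b * p (k s) s b)" for s
  \<comment> \<open>The measure bounds involve only the difference between \<open>\<beta>\<close>
    and its supremum, so subtracting an integer \<open>c \<ge> B\<close> brings the supremum below
    \<open>1\<close> at no cost.\<close>
  define c where "c = nat \<lceil>B\<rceil>"
  define b1 where "b1 s = N s * 2 ^ s" for s
  define b2 where "b2 s = 2 ^ k s * e s + c * (2 ^ k s * e s * 2 ^ s)" for s
  define d where "d s = 2 ^ k s * e s * 2 ^ s" for s
  define \<beta> where "\<beta> s = nat_to_rat_surj (quotient_code (b1 s) (b2 s) (d s))" for s
  have F': "total_recursive (\<lambda>xs. F (G xs) (H xs))" if "total_recursive G" "total_recursive H" for G H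
    using total_recursive_subst[OF F, of "\<lambda>xs. [G xs, H xs]"] that by (simp add: rec_intros)
  have e': "total_recursive (\<lambda>xs. e (G xs))" if "total_recursive G" for G
    using total_recursive_subst[OF e(1), of "\<lambda>xs. [G xs]"] that by (simp add: rec_intros)
  have p': "total_recursive (\<lambda>xs. p (G xs) (H xs) (L xs))"
    if "total_recursive G" "total_recursive H" "total_recursive L" for G H L
    using total_recursive_subst[OF p(1), of "\<lambda>xs. [G xs, H xs, L xs]"] that by (simp add: rec_intros)
  have "total_recursive (\<lambda>xs. quotient_code (b1 (arg 0 xs)) (b2 (arg 0 xs)) (d (arg 0 xs)))"
    unfolding b1_def b2_def d_def N_def k_def by (intro rec_intros F' e' p')
  then have \<beta>_comp: "computable_rat_sequence \<beta>"
    unfolding computable_rat_sequence_def \<beta>_def by (intro exI conjI) (assumption, simp)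
  have \<beta>: "real_of_rat (\<beta> s) = N s / (2 ^ k s * e s) - 1 / 2 ^ s - c" for s
  proof -
    have "0 < d s" using e(2) by (simp add: d_def)
    then have "real_of_rat (\<beta> s) = (real (b1 s) - real (b2 s)) / real (d s)"
      unfolding \<beta>_def by (rule quotient_code)
    also have "\<dots> = N s / (2 ^ k s * e s) - 1 / 2 ^ s - c"
      using e(2)[of s] by (simp add: b1_def b2_def d_def field_simps)
    finally show ?thesis .
  qed
  have approx: "\<bar>I s - N s / (2 ^ k s * e s)\<bar> \<le> 1 / 2 ^ s" for s
  proof -
    let ?S = "\<Sum>b<2 ^ s. F s b"
    have "\<bar>(\<integral>x. real (F s (bits x s)) \<partial>\<mu>) - real (N s) / 2 ^ k s\<bar>
        = \<bar>\<Sum>b<2 ^ s. real (F s b) * (measure \<mu> {x. bits x s = b} - p (k s) s b / 2 ^ k s)\<bar>"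
      unfolding integral_step N_def by (simp add: sum_divide_distrib sum_subtractf right_diff_distrib)
    also have "\<dots> \<le> (\<Sum>b<2 ^ s. real (F s b) * (2 / 2 ^ k s))"
      by (intro order_trans[OF sum_abs] sum_mono, unfold abs_mult abs_of_nat) (intro mult_left_mono p(2), auto)
    also have "\<dots> = real ?S * (2 / 2 ^ k s)"
      by (simp only: of_nat_sum sum_distrib_right)
    also have "\<dots> \<le> 2 ^ ?S * (2 / 2 ^ k s)"
      by (intro mult_right_mono less_imp_le[OF of_nat_less_two_power]) auto
    also have "\<dots> = 1 / 2 ^ s" by (simp add: k_def power_add)
    finally have "\<bar>(\<integral>x. real (F s (bits x s)) \<partial>\<mu>) - real (N s) / 2 ^ k s\<bar> \<le> 1 / 2 ^ s" (is "?a \<le> _") .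
    moreover have "\<bar>I s - N s / (2 ^ k s * e s)\<bar> = \<bar>(\<integral>x. real (F s (bits x s)) \<partial>\<mu>) - real (N s) / 2 ^ k s\<bar> / e s"
    proof -
      have "I s - N s / (2 ^ k s * e s) = ((\<integral>x. real (F s (bits x s)) \<partial>\<mu>) - real (N s) / 2 ^ k s) / e s"
        by (simp add: I_def diff_divide_distrib)
      then show ?thesis by (simp add: abs_divide)
    qed
    moreover have "?a / e s \<le> ?a"
      using divide_left_mono[of 1 "real (e s)" ?a] e(2)[of s] by simp
    ultimately show ?thesis by linarith
  qed
  \<comment> \<open>The \<open>1 / 2 ^ s\<close> subtracted in \<open>\<beta>\<close> absorbs the
    approximation error, so \<open>\<beta> s\<close> never overshoots; \<open>lo\<close> shows that
    the loss vanishes in the limit.\<close>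
  have up: "real_of_rat (\<beta> s) \<le> I s - c" for s
    using approx[of s] unfolding \<beta> by (simp add: abs_le_iff)
  have lo: "I s - 2 / 2 ^ s - c \<le> real_of_rat (\<beta> s)" for s
  proof -
    have "2 / 2 ^ s = 1 / 2 ^ s + (1 / 2 ^ s :: real)" by simp
    then show ?thesis using approx[of s] unfolding \<beta> abs_le_iff by linarith
  qed
  have upB: "real_of_rat (\<beta> s) \<le> B - c" for s
    using up[of s] le[of s] measure_nonneg[of \<mu> "V s"] by linarith
  then have bdd: "bdd_above (range (\<lambda>n. real_of_rat (\<beta> n)))" by (intro bdd_aboveI[of _ "B - c"]) auto
  have sup: "(SUP n. real_of_rat (\<beta> n)) = B - c"
  proof (rule antisym)
    show "(SUP n. real_of_rat (\<beta> n)) \<le> B - c" using upB by (intro cSUP_least) auto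
    show "B - c \<le> (SUP n. real_of_rat (\<beta> n))"
    proof (rule field_le_epsilon)
      fix \<epsilon> :: real assume \<epsilon>: "0 < \<epsilon>"
      obtain s0 where s0: "(1/2) ^ s0 < \<epsilon> / 4"
        using real_arch_pow_inv[of "\<epsilon> / 4" "1/2"] \<epsilon> by auto
      obtain s where s: "s0 \<le> s" "B - \<epsilon> / 2 < I s" using lim[of "\<epsilon> / 2" s0] \<epsilon> by auto
      have "(1/2 :: real) ^ s \<le> (1/2) ^ s0" using s(1) by (intro power_decreasing) auto
      moreover have "2 / 2 ^ s = 2 * (1/2 :: real) ^ s" by (simp add: power_one_over)
      ultimately have "2 / 2 ^ s < \<epsilon> / 2" using s0 by linarith
      then have "B - c - \<epsilon> \<le> real_of_rat (\<beta> s)" using lo[of s] s(2) by linarith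
      also have "\<dots> \<le> (SUP n. real_of_rat (\<beta> n))" by (intro cSUP_upper bdd) auto
      finally show "B - c \<le> (SUP n. real_of_rat (\<beta> n)) + \<epsilon>" by simp
    qed
  qed
  have "left_ce_bounded_test \<mu> V"
    unfolding left_ce_bounded_test_def
  proof (intro conjI allI exI)
    show "computable_rat_sequence \<beta>" by fact
    show "bdd_above (range (\<lambda>n. real_of_rat (\<beta> n)))" by fact
    show "(SUP n. real_of_rat (\<beta> n)) \<le> 1"
      unfolding sup c_def by linarith
    show "measure \<mu> (V n) \<le> (SUP n. real_of_rat (\<beta> n)) - real_of_rat (\<beta> n)" for n
      unfolding sup using up[of n] le[of n] by linarith
  qed (use V in auto)
  then show ?thesis using z by (auto simp: oberwolfach_random_def)
qed

end

section \<open>Certificates for orbits of a computable partial map\<close>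

lemma string_code_mod: "string_code m (b mod 2 ^ m) = string_code m b"
  by (simp add: string_code_def bit_list_mod)

lemma string_code_bits: "p \<le> l \<Longrightarrow> string_code p (bits x l) = string_code p (bits x p)"
  by (metis bits_mod string_code_mod)

lemma bit_list_bits: "bit_list m (bits x m) = map x [0..<m]"
  by (auto simp: bit_list_def bit_bits)

lemma mem_cylinderE:
  assumes "x \<in> cylinder \<sigma>"
  obtains "string_encode \<sigma> = string_code (length \<sigma>) (bits x (length \<sigma>))"
proof -
  have "\<sigma> = map x [0..<length \<sigma>]" using assms by (auto simp: cylinder_def intro!: nth_equalityI)
  then show ?thesis using that by (simp add: string_code_def bit_list_bits)
qed

lemma prefix_map_upt: "p \<le> q \<Longrightarrow> prefix (map x [0..<p]) (map x [0..<q])"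
  unfolding prefix_def
  by (intro exI[of _ "map x [p..<q]"]) (metis le_add_diff_inverse map_append upt_add_eq_append zero_le)

locale functional =
  fixes T :: "cantor \<Rightarrow> cantor option" and R :: "nat \<Rightarrow> nat \<Rightarrow> bool"
  assumes ce_R: "ce_relation R"
    and consistent: "\<And>\<sigma> \<tau> \<sigma>' \<tau>'. R (string_encode \<sigma>) (string_encode \<tau>) \<Longrightarrow>
      R (string_encode \<sigma>') (string_encode \<tau>') \<Longrightarrow> prefix \<sigma> \<sigma>' \<Longrightarrow> prefix \<tau> \<tau>' \<or> prefix \<tau>' \<tau>"
    and T_iff_cylinder: "\<And>x y. T x = Some y \<longleftrightarrow> (\<forall>n. \<exists>\<sigma> \<tau>. R (string_encode \<sigma>) (string_encode \<tau>) \<and>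
      x \<in> cylinder \<sigma> \<and> y \<in> cylinder \<tau> \<and> n \<le> length \<tau>)"
begin

lemma T_iff:
  "T x = Some y \<longleftrightarrow> (\<forall>n. \<exists>p q. R (string_code p (bits x p)) (string_code q (bits y q)) \<and> n \<le> q)"
proof -
  have "(\<exists>\<sigma> \<tau>. R (string_encode \<sigma>) (string_encode \<tau>) \<and> x \<in> cylinder \<sigma> \<and> y \<in> cylinder \<tau> \<and> n \<le> length \<tau>)
    \<longleftrightarrow> (\<exists>p q. R (string_code p (bits x p)) (string_code q (bits y q)) \<and> n \<le> q)" for n
  proof
    assume "\<exists>\<sigma> \<tau>. R (string_encode \<sigma>) (string_encode \<tau>) \<and> x \<in> cylinder \<sigma> \<and> y \<in> cylinder \<tau> \<and> n \<le> length \<tau>"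
    then show "\<exists>p q. R (string_code p (bits x p)) (string_code q (bits y q)) \<and> n \<le> q"
      by (metis mem_cylinderE)
  next
    assume "\<exists>p q. R (string_code p (bits x p)) (string_code q (bits y q)) \<and> n \<le> q"
    then obtain p q where "R (string_code p (bits x p)) (string_code q (bits y q))" "n \<le> q" by blast
    then show "\<exists>\<sigma> \<tau>. R (string_encode \<sigma>) (string_encode \<tau>) \<and> x \<in> cylinder \<sigma> \<and> y \<in> cylinder \<tau> \<and> n \<le> length \<tau>"
      by (intro exI[of _ "bit_list p (bits x p)"] exI[of _ "bit_list q (bits y q)"])
         (simp add: string_code_def mem_cylinder_bit_list bits_less)
  qed
  then show ?thesis unfolding T_iff_cylinder by simp
qed

text \<open>Both inputs are prefixes of the same point and thus comparable, so consistency of the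
  functional makes the outputs agree wherever both are long enough.\<close>

lemma consistent_bits:
  assumes "R (string_code p (bits x p)) (string_code q B)" "R (string_code p' (bits x p')) (string_code q' B')"
    and "i < q" "i < q'"
  shows "bit B i = bit B' i"
proof -
  have *: "bit B i = bit B' i"
    if "R (string_code p (bits x p)) (string_code q B)" "R (string_code p' (bits x p')) (string_code q' B')"
      "i < q" "i < q'" "p \<le> p'" for p q B p' q' B'
  proof -
    have "prefix (bit_list q B) (bit_list q' B') \<or> prefix (bit_list q' B') (bit_list q B)"
      using that(1,2) unfolding string_code_def
      by (rule consistent) (simp add: bit_list_bits prefix_map_upt that(5))
    then have "bit_list q B ! i = bit_list q' B' ! i"
      using that(3,4) by (auto simp: prefix_def nth_append)
    then show ?thesis using that(3,4) by (simp add: bit_list_def)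
  qed
  show ?thesis using *[OF assms] *[OF assms(2,1,4,3)] by (cases "p \<le> p'") auto
qed

text \<open>The functional may read a shorter prefix and write a longer one than recorded:
  \<open>string_code p v\<close> uses the lowest \<open>p\<close> bits of \<open>v\<close>, and the
  output is cut to length \<open>l'\<close>. Hence a step stays valid when the input prefix is
  lengthened.\<close>

definition chain_step :: "nat \<Rightarrow> nat \<Rightarrow> nat \<Rightarrow> nat \<Rightarrow> bool" where
  "chain_step l v l' v' \<longleftrightarrow>
    (\<exists>p q B. p \<le> l \<and> l' \<le> q \<and> R (string_code p v) (string_code q B) \<and> v' = B mod 2 ^ l')"

lemma ce_chain_step [rec_intros]:
  assumes "total_recursive F" "total_recursive G" "total_recursive H" "total_recursive K"
  shows "ce (\<lambda>xs. chain_step (F xs) (G xs) (H xs) (K xs))"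
  unfolding chain_step_def
  by (intro rec_intros ce_R assms[THEN total_recursive_subst])

lemma chain_step_sound:
  assumes "T x = Some y" "chain_step l (bits x l) l' v'"
  shows "bits y l' = v'"
proof -
  obtain p q B where pq: "p \<le> l" "l' \<le> q" "R (string_code p (bits x p)) (string_code q B)" "v' = B mod 2 ^ l'"
    using assms(2) string_code_bits unfolding chain_step_def by metis
  obtain p' q' where q': "R (string_code p' (bits x p')) (string_code q' (bits y q'))" "q \<le> q'"
    using assms(1) unfolding T_iff by blast
  show ?thesis
    unfolding pq(4) bits_eq_mod_iff
  proof (intro allI impI)
    fix i assume "i < l'"
    then show "y i = bit B i"
      using consistent_bits[OF pq(3) q'(1), of i] pq(2) q'(2) by (simp add: bit_bits)
  qed
qed

lemma chain_step_complete:
  assumes "T x = Some y"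
  obtains p where "\<And>l. p \<le> l \<Longrightarrow> chain_step l (bits x l) l' (bits y l')"
proof -
  obtain p q where "R (string_code p (bits x p)) (string_code q (bits y q))" "l' \<le> q"
    using assms unfolding T_iff by blast
  then have "chain_step l (bits x l) l' (bits y l')" if "p \<le> l" for l
    unfolding chain_step_def using that
    by (intro exI[of _ p] exI[of _ q] exI[of _ "bits y q"]) (simp add: string_code_bits[OF that] bits_mod)
  then show ?thesis using that by blast
qed

text \<open>By \<open>consistent_bits\<close> the outputs, of unbounded length, are prefixes of one
  limit point. Its bit \<open>i\<close> is read from an output requested to have length at least
  \<open>i + 1\<close>.\<close>

lemma defined_if_chain_steps:
  assumes "\<And>L. \<exists>l l' v'. L \<le> l' \<and> chain_step l (bits x l) l' v'"
  shows "\<exists>y. T x = Some y"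
proof -
  have "\<exists>p q B. L \<le> q \<and> R (string_code p (bits x p)) (string_code q B)" for L
    using assms[of L] string_code_bits unfolding chain_step_def by (metis order_trans)
  then obtain p q B where R: "\<And>L. L \<le> q L" "\<And>L. R (string_code (p L) (bits x (p L))) (string_code (q L) (B L))"
    by metis
  define y where "y i = bit (B (Suc i)) i" for i
  have y: "bits y (q L) = B L mod 2 ^ q L" for L
    unfolding bits_eq_mod_iff y_def
  proof (intro allI impI)
    fix i assume "i < q L"
    then show "bit (B (Suc i)) i = bit (B L) i"
      using consistent_bits[OF R(2) R(2), of i "Suc i" L] R(1)[of "Suc i"] by (simp only: Suc_le_eq)
  qed
  have "T x = Some y"
    unfolding T_iff
  proof
    fix n
    show "\<exists>p q. R (string_code p (bits x p)) (string_code q (bits y q)) \<and> n \<le> q"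
      using R[of n] by (intro exI[of _ "p n"] exI[of _ "q n"]) (simp add: y string_code_mod)
  qed
  then show ?thesis by blast
qed

text \<open>\<open>l\<close> and \<open>v\<close> code lists: \<open>v ! j\<close> is the prefix of length \<open>l ! j\<close> of the \<open>j\<close>-th point of the
  orbit, which must be long enough to determine the next prefix.\<close>

definition orbit_cert :: "nat \<Rightarrow> nat \<Rightarrow> nat \<Rightarrow> nat \<Rightarrow> nat \<Rightarrow> bool" where
  "orbit_cert n L w l0 b \<longleftrightarrow> (\<exists>l v. code_nth l 0 = l0 \<and> code_nth v 0 = b \<and>
     (\<forall>j<n. L \<le> code_nth l j \<and> code_nth w j = code_nth v j mod 2 ^ L) \<and>
     (\<forall>j<n - 1. chain_step (code_nth l j) (code_nth v j) (code_nth l (Suc j)) (code_nth v (Suc j))))"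

lemma ce_orbit_cert [rec_intros]:
  assumes "total_recursive F" "total_recursive G" "total_recursive H" "total_recursive K" "total_recursive L"
  shows "ce (\<lambda>xs. orbit_cert (F xs) (G xs) (H xs) (K xs) (L xs))"
  unfolding orbit_cert_def
  by (intro rec_intros assms assms[THEN total_recursive_subst])

text \<open>Only the first \<open>n\<close> points of the orbit are assumed to exist, while the
  certificate may run on to \<open>N\<close>: \<open>defined_if_orbit_certs\<close> applies this
  with a certificate reaching one point beyond those known.\<close>

lemma orbit_cert_prefixes:
  assumes "\<And>j. Suc j < n \<Longrightarrow> T (y j) = Some (y (Suc j))" "n \<le> N"
    and "code_nth v 0 = bits (y 0) (code_nth l 0)"
    and "\<forall>j<N - 1. chain_step (code_nth l j) (code_nth v j) (code_nth l (Suc j)) (code_nth v (Suc j))"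
    and "j < n"
  shows "code_nth v j = bits (y j) (code_nth l j)"
  using \<open>j < n\<close>
proof (induction j)
  case 0
  then show ?case using assms(3) by simp
next
  case (Suc j)
  moreover from this have "j < N - 1" using assms(2) by simp
  ultimately have "chain_step (code_nth l j) (bits (y j) (code_nth l j)) (code_nth l (Suc j)) (code_nth v (Suc j))"
    using assms(4) by fastforce
  then show ?case using chain_step_sound[OF assms(1)] Suc.prems by simp
qed

lemma orbit_cert_sound:
  assumes "\<And>j. Suc j < n \<Longrightarrow> T (y j) = Some (y (Suc j))"
    and "orbit_cert n L w l0 (bits (y 0) l0)" "j < n"
  shows "code_nth w j = bits (y j) L"
proof -
  obtain l v where lv: "code_nth l 0 = l0" "code_nth v 0 = bits (y 0) l0"
    "\<forall>j<n. L \<le> code_nth l j \<and> code_nth w j = code_nth v j mod 2 ^ L"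
    "\<forall>j<n - 1. chain_step (code_nth l j) (code_nth v j) (code_nth l (Suc j)) (code_nth v (Suc j))"
    using assms(2) unfolding orbit_cert_def by blast
  have "code_nth v j = bits (y j) (code_nth l j)"
  proof (rule orbit_cert_prefixes[of n y n v l, OF assms(1) order_refl _ lv(4) assms(3)])
    show "code_nth v 0 = bits (y 0) (code_nth l 0)" by (simp only: lv(1,2))
  qed
  then show ?thesis using lv(3) assms(3) by (simp add: bits_mod)
qed

text \<open>Lengths are chosen backwards: the length \<open>K\<close> wanted at the last point
  dictates how much of the point before it must be known, and so on down to the first.\<close>

lemma chain_lengths:
  assumes "\<And>j. j < n \<Longrightarrow> T (y j) = Some (y (Suc j))" "L \<le> K"
  shows "\<exists>l. l n = K \<and> (\<forall>j\<le>n. L \<le> l j) \<and>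
    (\<forall>j<n. chain_step (l j) (bits (y j) (l j)) (l (Suc j)) (bits (y (Suc j)) (l (Suc j))))"
  using assms
proof (induction n arbitrary: K)
  case 0
  then show ?case by (intro exI[of _ "\<lambda>_. K"]) auto
next
  case (Suc n)
  obtain p where p: "\<And>l. p \<le> l \<Longrightarrow> chain_step l (bits (y n) l) K (bits (y (Suc n)) K)"
    using chain_step_complete[of "y n" "y (Suc n)" K] Suc.prems(1)[of n] by auto
  obtain l where l: "l n = max p L" "\<forall>j\<le>n. L \<le> l j"
    "\<forall>j<n. chain_step (l j) (bits (y j) (l j)) (l (Suc j)) (bits (y (Suc j)) (l (Suc j)))"
    using Suc.IH[of "max p L"] Suc.prems(1) by auto
  show ?case
    using l p[of "max p L"] Suc.prems(2)
    by (intro exI[of _ "l(Suc n := K)"]) (auto simp: less_Suc_eq le_Suc_eq)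
qed

lemma orbit_cert_complete:
  assumes "\<And>j. Suc j < n \<Longrightarrow> T (y j) = Some (y (Suc j))" "0 < n"
  shows "\<exists>l0. orbit_cert n L (list_encode (map (\<lambda>j. bits (y j) L) [0..<n])) l0 (bits (y 0) l0)"
proof -
  obtain l where l: "\<forall>j\<le>n - 1. L \<le> l j"
    "\<forall>j<n - 1. chain_step (l j) (bits (y j) (l j)) (l (Suc j)) (bits (y (Suc j)) (l (Suc j)))"
    using chain_lengths[of "n - 1" y L L] assms(1) by auto
  have nth: "code_nth (list_encode (map f [0..<n])) j = f j" if "j < n" for f j
    using that by (simp add: code_nth_list_encode)
  have "orbit_cert n L (list_encode (map (\<lambda>j. bits (y j) L) [0..<n])) (l 0) (bits (y 0) (l 0))"
    unfolding orbit_cert_def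
    by (intro exI[of _ "list_encode (map l [0..<n])"] exI[of _ "list_encode (map (\<lambda>j. bits (y j) (l j)) [0..<n])"])
       (use l assms(2) in \<open>auto simp: nth bits_mod\<close>)
  then show ?thesis by blast
qed

text \<open>A certificate for \<open>n + 2\<close> points contains a step out of \<open>y n\<close>
  whose output has length at least \<open>L\<close>; having one for every \<open>L\<close> makes the
  functional defined at \<open>y n\<close>.\<close>

lemma defined_if_orbit_certs:
  assumes "\<And>j. j < n \<Longrightarrow> T (y j) = Some (y (Suc j))"
    and "\<And>L. \<exists>w l0. orbit_cert (Suc (Suc n)) L w l0 (bits (y 0) l0)"
  shows "\<exists>y'. T (y n) = Some y'"
proof (rule defined_if_chain_steps)
  fix L
  obtain w l v where lv: "code_nth v 0 = bits (y 0) (code_nth l 0)"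
    "\<forall>j<Suc (Suc n). L \<le> code_nth l j \<and> code_nth w j = code_nth v j mod 2 ^ L"
    "\<forall>j<Suc (Suc n) - 1. chain_step (code_nth l j) (code_nth v j) (code_nth l (Suc j)) (code_nth v (Suc j))"
    using assms(2)[of L] unfolding orbit_cert_def by blast
  have "code_nth v n = bits (y n) (code_nth l n)"
    by (rule orbit_cert_prefixes[of "Suc n" y, OF _ _ lv(1,3)]) (use assms(1) in auto)
  moreover have "chain_step (code_nth l n) (code_nth v n) (code_nth l (Suc n)) (code_nth v (Suc n))"
    using lv(3) by auto
  ultimately show "\<exists>l l' v'. L \<le> l' \<and> chain_step l (bits (y n) l) l' v'"
    using lv(2) by (metis lessI)
qed

end

section \<open>The map made total, and its almost everywhere infinite orbits\<close>

lemma uniformly_Sigma1_sets: "uniformly_Sigma1 V \<Longrightarrow> V n \<in> sets borel"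
proof -
  assume "uniformly_Sigma1 V"
  then obtain R where V: "V n = (\<Union>\<sigma>\<in>{\<sigma>. R n (string_encode \<sigma>)}. cylinder \<sigma>)"
    unfolding uniformly_Sigma1_def by blast
  have "cylinder \<sigma> \<in> sets borel" for \<sigma>
  proof -
    obtain b where "bit_list (length \<sigma>) b = \<sigma>" "b < 2 ^ length \<sigma>" using bit_list_surj by blast
    then have "cylinder \<sigma> = {x. bits x (length \<sigma>) = b}"
      using mem_cylinder_bit_list[of _ "length \<sigma>" b] by auto
    then show ?thesis by (simp add: sets_bits)
  qed
  then show ?thesis unfolding V by (intro sets.countable_UN') auto
qed

lemma (in measure_preserving_map) distr_funpow: "distr M M (T ^^ j) = M"
proof (induction j)
  case 0
  then show ?case by (simp add: id_def distr_id)
next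
  case (Suc j)
  have "distr M M (T ^^ Suc j) = distr (distr M M (T ^^ j)) M T"
    by (simp add: distr_distr comp_def)
  then show ?case using Suc distr_T by (simp add: comp_def)
qed

lemma (in measure_preserving_map) AE_funpow:
  assumes "AE x in M. P x" shows "AE x in M. P ((T ^^ j) x)"
  by (rule AE_distrD[OF measurable_funpow_T[of j]], subst distr_funpow, rule assms)

locale computable_system = computable_measure \<mu> + functional T R
  for \<mu> :: "cantor measure" and T :: "cantor \<Rightarrow> cantor option" and R +
  assumes T_preserving: "measure_preserving_partial \<mu> T"
begin

text \<open>The values off the domain concern a null set only; the identity keeps preimages
  measurable there.\<close>

definition T' :: "cantor \<Rightarrow> cantor" where
  "T' x = (case T x of Some y \<Rightarrow> y | None \<Rightarrow> x)"

lemma vimage_T: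
  assumes "A \<in> sets \<mu>"
  shows "{x. \<exists>y\<in>A. T x = Some y} \<in> sets \<mu>" "emeasure \<mu> {x. \<exists>y\<in>A. T x = Some y} = emeasure \<mu> A"
  using T_preserving assms by (auto simp: measure_preserving_partial_def)

lemma AE_defined: "AE x in \<mu>. T x = Some (T' x)"
proof -
  let ?D = "{x. \<exists>y\<in>UNIV. T x = Some y}"
  have D: "?D \<in> sets \<mu>" "emeasure \<mu> ?D = 1"
    using vimage_T[of UNIV] emeasure_space_1 by auto
  have "AE x in \<mu>. x \<in> ?D"
    using D by (intro AE_prob_1) (simp add: emeasure_eq_measure)
  then show ?thesis by eventually_elim (auto simp: T'_def)
qed

lemma measurable_T': "T' \<in> measurable \<mu> \<mu>"
proof (rule measurableI)
  fix A assume A: "A \<in> sets \<mu>"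
  have "T' -` A \<inter> space \<mu> = {x. \<exists>y\<in>A. T x = Some y} \<union> (A - {x. \<exists>y\<in>UNIV. T x = Some y})"
    by (auto simp: T'_def split: option.splits)
  then show "T' -` A \<inter> space \<mu> \<in> sets \<mu>"
    using vimage_T(1)[OF A] vimage_T(1)[of UNIV] A by (auto simp del: sets_borel)
qed auto

sublocale measure_preserving_map \<mu> T'
proof
  show "T' \<in> measurable \<mu> \<mu>" by (rule measurable_T')
  show "distr \<mu> \<mu> T' = \<mu>"
  proof (rule measure_eqI)
    fix A assume "A \<in> sets (distr \<mu> \<mu> T')"
    then have A: "A \<in> sets \<mu>" by simp
    have "emeasure (distr \<mu> \<mu> T') A = emeasure \<mu> (T' -` A \<inter> space \<mu>)"
      using measurable_T' A by (rule emeasure_distr)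
    also have "\<dots> = emeasure \<mu> {x. \<exists>y\<in>A. T x = Some y}"
      by (rule emeasure_eq_AE)
         (use AE_defined vimage_T(1)[OF A] measurable_sets[OF measurable_T' A] in \<open>auto elim: eventually_mono\<close>)
    finally show "emeasure (distr \<mu> \<mu> T') A = emeasure \<mu> A" using vimage_T(2)[OF A] by simp
  qed simp
qed

abbreviation orbit :: "cantor \<Rightarrow> nat \<Rightarrow> cantor" where
  "orbit x j \<equiv> (T' ^^ j) x"

text \<open>At such points \<open>orbit\<close> is the true orbit of \<open>T\<close> throughout;
  only there are the test sets below compared with inequalities between averages.\<close>

definition regular :: "cantor \<Rightarrow> bool" where
  "regular x \<longleftrightarrow> (\<forall>j. T (orbit x j) = Some (orbit x (Suc j)))"

lemma AE_regular: "AE x in \<mu>. regular x"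
  unfolding regular_def AE_all_countable using AE_funpow[OF AE_defined] by simp

lemma regular_sound: "regular x \<Longrightarrow> orbit_cert n L w l (bits x l) \<Longrightarrow> j < n \<Longrightarrow> code_nth w j = bits (orbit x j) L"
  using orbit_cert_sound[of n "orbit x" L w l j] by (simp add: regular_def)

definition orbit_code :: "nat \<Rightarrow> nat \<Rightarrow> cantor \<Rightarrow> nat" where
  "orbit_code n L x = list_encode (map (\<lambda>j. bits (orbit x j) L) [0..<n])"

lemma code_nth_orbit_code: "j < n \<Longrightarrow> code_nth (orbit_code n L x) j = bits (orbit x j) L"
  by (simp add: orbit_code_def code_nth_list_encode)

lemma regular_complete:
  "regular x \<Longrightarrow> 0 < n \<Longrightarrow> \<exists>l. orbit_cert n L (orbit_code n L x) l (bits x l)"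
  using orbit_cert_complete[of n "orbit x" L] by (simp add: regular_def orbit_code_def)

text \<open>The tests need a notion of verification by a given stage, so one decidable matrix of the
  enumerable predicate \<open>orbit_cert\<close> is fixed once and for all.\<close>

definition cert_dec :: "nat list \<Rightarrow> bool" where
  "cert_dec = (SOME D. decidable D \<and> (\<forall>xs. orbit_cert (arg 0 xs) (arg 1 xs) (arg 2 xs) (arg 3 xs) (arg 4 xs)
     \<longleftrightarrow> (\<exists>m. D (m # xs))))"

lemma cert_dec:
  "decidable cert_dec" "orbit_cert n L w l b \<longleftrightarrow> (\<exists>m. cert_dec [m, n, L, w, l, b])"
proof -
  have "ce (\<lambda>xs. orbit_cert (arg 0 xs) (arg 1 xs) (arg 2 xs) (arg 3 xs) (arg 4 xs))"
    by (intro rec_intros)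
  then have *: "decidable cert_dec \<and> (\<forall>xs. orbit_cert (arg 0 xs) (arg 1 xs) (arg 2 xs) (arg 3 xs) (arg 4 xs)
     \<longleftrightarrow> (\<exists>m. cert_dec (m # xs)))"
    unfolding ce_def cert_dec_def by (rule someI_ex)
  then show "decidable cert_dec" by blast
  from * have "orbit_cert (arg 0 xs) (arg 1 xs) (arg 2 xs) (arg 3 xs) (arg 4 xs)
     \<longleftrightarrow> (\<exists>m. cert_dec (m # xs))" for xs by blast
  from this[of "[n, L, w, l, b]"] show "orbit_cert n L w l b \<longleftrightarrow> (\<exists>m. cert_dec [m, n, L, w, l, b])"
    by simp
qed

text \<open>The stage bounds the witness, the prefix length and \<open>w\<close> itself. Reducing
  \<open>b\<close> modulo \<open>2 ^ l\<close> makes the check depend on a short prefix alone, so a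
  certificate, once found, persists at later stages.\<close>

definition cert_by :: "nat \<Rightarrow> nat \<Rightarrow> nat \<Rightarrow> nat \<Rightarrow> nat \<Rightarrow> bool" where
  "cert_by t n L w b \<longleftrightarrow> w \<le> t \<and> (\<exists>m\<le>t. \<exists>l\<le>t. cert_dec [m, n, L, w, l, b mod 2 ^ l])"

lemma decidable_cert_by [rec_intros]:
  assumes "total_recursive F" "total_recursive G" "total_recursive H" "total_recursive K" "total_recursive B"
  shows "decidable (\<lambda>xs. cert_by (F xs) (G xs) (H xs) (K xs) (B xs))"
  unfolding cert_by_def
  by (intro rec_intros cert_dec(1)[THEN decidable_subst] assms assms[THEN total_recursive_subst])

lemma cert_by_bits:
  "cert_by t n L w (bits x t) \<longleftrightarrow> w \<le> t \<and> (\<exists>m\<le>t. \<exists>l\<le>t. cert_dec [m, n, L, w, l, bits x l])"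
  unfolding cert_by_def using bits_mod by metis

lemma cert_by_mono: "cert_by t n L w (bits x t) \<Longrightarrow> t \<le> t' \<Longrightarrow> cert_by t' n L w (bits x t')"
  unfolding cert_by_bits by (meson order_trans)

lemma cert_by_sound: "cert_by t n L w (bits x t) \<Longrightarrow> \<exists>l. orbit_cert n L w l (bits x l)"
  unfolding cert_by_bits cert_dec(2) by blast

lemma cert_by_complete:
  assumes "orbit_cert n L w l (bits x l)"
  shows "\<exists>t. cert_by t n L w (bits x t)"
proof -
  obtain m where "cert_dec [m, n, L, w, l, bits x l]" using assms cert_dec(2) by blast
  then show ?thesis
    unfolding cert_by_bits
    by (intro exI[of _ "max w (max m l)"] conjI exI[of _ m] exI[of _ l]) auto
qed

section \<open>Random points have an infinite orbit\<close>

text \<open>Almost every point is regular and so receives a certificate; the sets of points still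
  lacking one at stage \<open>s\<close> shrink to a null set. The approximations to
  \<open>B = 1\<close> are the measures of their complements, which are finite unions of cylinders
  of length \<open>s\<close>.\<close>

lemma oberwolfach_random_orbit_cert:
  assumes z: "oberwolfach_random \<mu> z" and "0 < n"
  shows "\<exists>w l. orbit_cert n L w l (bits z l)"
proof -
  define P where "P s b \<longleftrightarrow> (\<exists>w\<le>s. cert_by s n L w b)" for s b
  define V where "V s = {x. \<not> P s (bits x s)}" for s
  have P_rec: "decidable (\<lambda>xs. P (F xs) (G xs))" if "total_recursive F" "total_recursive G" for F G
    unfolding P_def by (intro rec_intros that that[THEN total_recursive_subst])
  have mono: "V t \<subseteq> V s" if "s \<le> t" for s t
    unfolding V_def P_def using cert_by_mono[OF _ that] that by (auto intro: order_trans)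
  have Sigma1: "uniformly_Sigma1 V"
  \<comment> \<open>The lack of a certificate at stage \<open>s\<close> is decided by the prefix of
    length exactly \<open>s\<close>, hence the condition that the length \<open>arg 0\<close> equals
    the index \<open>arg 2\<close>.\<close>
  proof (rule uniformly_Sigma1I[where W = "\<lambda>xs. arg 0 xs = arg 2 xs \<and> \<not> P (arg 2 xs) (arg 1 xs)"])
    show "ce (\<lambda>xs. arg 0 xs = arg 2 xs \<and> \<not> P (arg 2 xs) (arg 1 xs))"
      by (intro rec_intros P_rec)
  qed (auto simp: V_def)
  have V_sets [measurable]: "V s \<in> sets \<mu>" for s using uniformly_Sigma1_sets[OF Sigma1] by simp
  have int: "(\<integral>x. real (of_bool (P s (bits x s))) \<partial>\<mu>) / real 1 = 1 - measure \<mu> (V s)" for s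
  proof -
    have "(\<integral>x. real (of_bool (P s (bits x s))) \<partial>\<mu>) = (\<integral>x. indicator (- V s) x \<partial>\<mu>)"
      by (intro Bochner_Integration.integral_cong) (auto simp: V_def indicator_def)
    also have "\<dots> = measure \<mu> (space \<mu> - V s)" by (simp add: Compl_eq_Diff_UNIV)
    also have "\<dots> = 1 - measure \<mu> (V s)" by (rule prob_compl) (rule V_sets)
    finally show ?thesis by simp
  qed
  have "AE x in \<mu>. x \<notin> (\<Inter>s. V s)"
    using AE_regular
  proof eventually_elim
    fix x assume "regular x"
    then obtain l where "orbit_cert n L (orbit_code n L x) l (bits x l)"
      using regular_complete \<open>0 < n\<close> by blast
    then obtain t where "cert_by t n L (orbit_code n L x) (bits x t)"
      using cert_by_complete by blast
    moreover from this have "orbit_code n L x \<le> t" by (simp add: cert_by_def)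
    ultimately show "x \<notin> (\<Inter>s. V s)" by (auto simp: V_def P_def)
  qed
  moreover have "(\<Inter>s. V s) \<in> sets \<mu>" by (intro sets.countable_INT) (auto simp del: sets_borel intro: V_sets)
  ultimately have "measure \<mu> (\<Inter>s. V s) = 0"
    by (intro measure_eq_0_null_sets) (simp only: AE_iff_null_sets)
  moreover have "(\<lambda>s. measure \<mu> (V s)) \<longlonglongrightarrow> measure \<mu> (\<Inter>s. V s)"
    using mono V_sets by (intro finite_Lim_measure_decseq) (auto simp: decseq_def)
  ultimately have lim: "(\<lambda>s. measure \<mu> (V s)) \<longlonglongrightarrow> 0" by simp
  have "\<exists>s. z \<notin> V s"
  proof (rule oberwolfach_random_avoids[where F = "\<lambda>s b. of_bool (P s b)" and e = "\<lambda>_. 1" and B = 1, OF z Sigma1])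
    show "total_recursive (\<lambda>xs. of_bool (P (arg 0 xs) (arg 1 xs)))"
      by (intro rec_intros P_rec)
    show "\<exists>s\<ge>s0. 1 - \<epsilon> < (\<integral>x. real (of_bool (P s (bits x s))) \<partial>\<mu>) / real 1" if "0 < \<epsilon>" for s0 \<epsilon>
    proof -
      have "\<forall>\<^sub>F s in sequentially. measure \<mu> (V s) < \<epsilon>" using order_tendstoD(2)[OF lim that] .
      then obtain N where "\<And>s. N \<le> s \<Longrightarrow> measure \<mu> (V s) < \<epsilon>" by (auto simp: eventually_sequentially)
      then show ?thesis unfolding int by (intro exI[of _ "max s0 N"]) auto
    qed
    show "measure \<mu> (V s) + (\<integral>x. real (of_bool (P s (bits x s))) \<partial>\<mu>) / real 1 \<le> 1" for s
      unfolding int by simp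
  qed (use mono in \<open>auto intro: rec_intros\<close>)
  then show ?thesis unfolding V_def P_def using cert_by_sound by blast
qed

lemma oberwolfach_random_regular:
  assumes z: "oberwolfach_random \<mu> z" shows "regular z"
proof -
  have "T (orbit z j) = Some (orbit z (Suc j))" for j
  proof (induction j rule: less_induct)
    case (less j)
    then have "\<exists>y. T (orbit z j) = Some y"
      by (intro defined_if_orbit_certs) (auto intro: oberwolfach_random_orbit_cert[OF z])
    then show ?case using T'_def[of "orbit z j"] by auto
  qed
  then show ?thesis by (simp add: regular_def)
qed

end

context computable_system
begin

section \<open>Convergence of the averages of a computable step function\<close>

context
  fixes \<phi> :: "nat \<Rightarrow> nat" and K L :: nat
  assumes \<phi>_rec: "total_recursive (\<lambda>xs. \<phi> (arg 0 xs))"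
    and \<phi>_le: "\<And>b. \<phi> b \<le> K"
begin

private definition g :: "cantor \<Rightarrow> real" where
  "g x = real (\<phi> (bits x L))"

private definition code_sum :: "nat \<Rightarrow> nat \<Rightarrow> nat" where
  "code_sum n w = (\<Sum>j<n. \<phi> (code_nth w j))"

private lemma g_facts: "g \<in> borel_measurable \<mu>" "0 \<le> g x" "g x \<le> real K"
  using \<phi>_le borel_measurable_integrable[OF integrable_step] unfolding g_def[abs_def] by auto

private lemma code_sum_rec:
  assumes "total_recursive F" "total_recursive G"
  shows "total_recursive (\<lambda>xs. code_sum (F xs) (G xs))"
proof -
  have \<phi>: "total_recursive (\<lambda>xs. \<phi> (H xs))" if "total_recursive H" for H
    using total_recursive_subst[OF \<phi>_rec, of "\<lambda>xs. [H xs]"] that by (simp add: rec_intros)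
  show ?thesis
    unfolding code_sum_def by (intro rec_intros \<phi> assms assms[THEN total_recursive_subst])
qed

private lemma code_sum_eq:
  assumes "regular x" "orbit_cert N L w l (bits x l)" "n \<le> N"
  shows "real (code_sum n w) = bsum n g x"
  using regular_sound[OF assms(1,2)] assms(3) by (simp add: code_sum_def bsum_def g_def)

private lemma code_sum_le: "code_sum n w \<le> n * K"
  using sum_bounded_above[of "{..<n}" "\<lambda>j. \<phi> (code_nth w j)" K] \<phi>_le by (simp add: code_sum_def)

lemma oberwolfach_random_step_oscillation:
  assumes z: "oberwolfach_random \<mu> z" and d: "0 < d"
  shows "\<exists>N. \<forall>n\<ge>N. \<forall>m\<ge>N. avg n (\<lambda>x. real (\<phi> (bits x L))) z - avg m (\<lambda>x. real (\<phi> (bits x L))) z \<le> 6 / real d"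
proof -
  define a where "a n = avg_norm2 g n" for n
  \<comment> \<open>Large enough for \<open>oscillation_bound\<close> with
    \<open>\<delta> = 1 / d\<close> at the length \<open>len s \<le> Suc s\<close>, and
    nondecreasing in \<open>s\<close>, which makes the sets \<open>V s\<close> nested.\<close>
  define N where "N s = Suc (K * d * Suc s)" for s
  define I where "I = (INF n\<in>{0<..}. a n)"
  \<comment> \<open>The factor \<open>2 / \<delta>\<^sup>2\<close> of the oscillation bound at
    \<open>\<delta> = 1 / d\<close>.\<close>
  define C where "C = 2 * d\<^sup>2"
  \<comment> \<open>The inequality \<open>6 / d < code_sum n w / n - code_sum m w / m\<close>,
    multiplied by \<open>d * n * m\<close> and freed of subtraction.\<close>
  define Q where "Q n m w \<longleftrightarrow> 6 * n * m + d * n * code_sum m w < d * m * code_sum n w" for n m w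
  define V where "V s = {x. \<exists>l n m w. N s \<le> n \<and> N s \<le> m \<and> Q n m w \<and> orbit_cert (n + m) L w l (bits x l)}" for s
  \<comment> \<open>The index codes a length, shifted by one to be positive, together with a
    computation stage, so every length recurs with arbitrarily late stages.\<close>
  define len where "len s = Suc (fst (prod_decode s))" for s
  \<comment> \<open>At a regular point the number of such \<open>j\<close> is \<open>0\<close> until
    the orbit is certified, and then \<open>(K * len s)\<^sup>2\<close> minus the squared Birkhoff
    sum. Subtracting from the maximum turns a squared norm, approximable from above, into a quantity
    approximable from below; after scaling by \<open>C\<close> and division by
    \<open>(len s)\<^sup>2\<close> its integrals tend to \<open>C * (K\<^sup>2 - a k)\<close> along
    the indices of length \<open>k\<close>.\<close>
  define P where "P s b j \<longleftrightarrow> (\<exists>w\<le>s. cert_by s (len s) L w b \<and> j + (code_sum (len s) w)\<^sup>2 < (K * len s)\<^sup>2)" for s b j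
  define F where "F s b = C * (\<Sum>j<(K * len s)\<^sup>2. of_bool (P s b j))" for s b
  have a_nonneg: "0 \<le> a n" for n by (simp add: a_def avg_norm2_def[OF g_facts])
  have bdd: "bdd_below (a ` {0<..})" using a_nonneg by (intro bdd_belowI[of _ 0]) auto
  have I_le: "I \<le> a n" if "0 < n" for n
    unfolding I_def using bdd that by (intro cINF_lower) auto
  have I_near: "\<exists>n>0. a n < I + \<epsilon>" if "0 < \<epsilon>" for \<epsilon>
  proof -
    have "Inf (a ` {0<..}) < I + \<epsilon>" using that by (simp add: I_def)
    then show ?thesis by (subst (asm) cInf_less_iff) (use bdd in auto)
  qed
  have Q_iff: "Q n m w \<longleftrightarrow> 6 * (1 / d) < real (code_sum n w) / n - real (code_sum m w) / m" if "0 < n" "0 < m" for n m w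
  proof -
    have "Q n m w \<longleftrightarrow> real (6 * n * m + d * n * code_sum m w) < real (d * m * code_sum n w)"
      unfolding Q_def of_nat_less_iff ..
    also have "\<dots> \<longleftrightarrow> 6 * (1 / d) < real (code_sum n w) / n - real (code_sum m w) / m"
      using that d by (simp add: field_simps)
    finally show ?thesis .
  qed
  have N_pos: "0 < N s" for s by (simp add: N_def algebra_simps)
  have V_regular: "x \<in> V s \<longleftrightarrow> (\<exists>n\<ge>N s. \<exists>m\<ge>N s. 6 * (1 / d) < avg n g x - avg m g x)" if x: "regular x" for x s
  proof
    assume "x \<in> V s"
    then obtain l n m w where *: "N s \<le> n" "N s \<le> m" "Q n m w" "orbit_cert (n + m) L w l (bits x l)"
      by (auto simp: V_def)
    then have "real (code_sum n w) = bsum n g x" "real (code_sum m w) = bsum m g x"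
      using code_sum_eq[OF x *(4)] by auto
    then have "6 * (1 / d) < avg n g x - avg m g x"
      using *(1,2,3) N_pos[of s] Q_iff[of n m w] by (simp add: avg_def)
    then show "\<exists>n\<ge>N s. \<exists>m\<ge>N s. 6 * (1 / d) < avg n g x - avg m g x" using * by blast
  next
    assume "\<exists>n\<ge>N s. \<exists>m\<ge>N s. 6 * (1 / d) < avg n g x - avg m g x"
    then obtain n m where *: "N s \<le> n" "N s \<le> m" "6 * (1 / d) < avg n g x - avg m g x" by blast
    then have pos: "0 < n" "0 < m" using N_pos[of s] by auto
    \<comment> \<open>A certificate for \<open>n + m\<close> points contains both the first
      \<open>n\<close> and the first \<open>m\<close> points, so one \<open>w\<close> serves both
      averages.\<close>
    define w where "w = orbit_code (n + m) L x"
    obtain l where l: "orbit_cert (n + m) L w l (bits x l)"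
      using regular_complete[OF x, of "n + m" L] pos unfolding w_def by auto
    have "real (code_sum n w) = bsum n g x" "real (code_sum m w) = bsum m g x"
      using code_sum_eq[OF x l] by auto
    then have "Q n m w" using *(3) Q_iff[OF pos] by (simp add: avg_def)
    then show "x \<in> V s" unfolding V_def using * l by blast
  qed
  have Sigma1: "uniformly_Sigma1 V"
  proof (rule uniformly_Sigma1I[where W = "\<lambda>xs. \<exists>n m w. N (arg 2 xs) \<le> n \<and> N (arg 2 xs) \<le> m \<and> Q n m w \<and>
      orbit_cert (n + m) L w (arg 0 xs) (arg 1 xs)"])
    show "ce (\<lambda>xs. \<exists>n m w. N (arg 2 xs) \<le> n \<and> N (arg 2 xs) \<le> m \<and> Q n m w \<and>
      orbit_cert (n + m) L w (arg 0 xs) (arg 1 xs))"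
      unfolding N_def Q_def by (intro rec_intros code_sum_rec)
  qed (auto simp: V_def)
  have V_sets: "V s \<in> sets \<mu>" for s using uniformly_Sigma1_sets[OF Sigma1] by simp
  have "N s \<le> N (Suc s)" for s by (simp add: N_def algebra_simps)
  then have nested: "V (Suc s) \<subseteq> V s" for s
    unfolding V_def using order_trans by blast
  have measure_V: "measure \<mu> (V s) \<le> C * (a (len s) - I)" for s
  proof -
    have "len s \<le> Suc s"
      using le_prod_encode_1[of "fst (prod_decode s)" "snd (prod_decode s)"] by (simp add: len_def)
    then have "real K * real d * real (len s) \<le> real K * real d * real (Suc s)"
      by (intro mult_left_mono) auto
    also have "\<dots> \<le> real (N s)" by (simp add: N_def algebra_simps)
    finally have N_large: "real K * real (len s) \<le> 1 / real d * real (N s)"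
      using d by (simp add: field_simps)
    have "measure \<mu> (V s) \<le> measure \<mu> {x\<in>space \<mu>. \<exists>n\<ge>N s. \<exists>m\<ge>N s. 6 * (1 / d) < avg n g x - avg m g x}"
    proof (rule finite_measure_mono_AE)
      show "AE x in \<mu>. x \<in> V s \<longrightarrow> x \<in> {x\<in>space \<mu>. \<exists>n\<ge>N s. \<exists>m\<ge>N s. 6 * (1 / d) < avg n g x - avg m g x}"
        using AE_regular by eventually_elim (auto simp: V_regular)
      have eq: "{x\<in>space \<mu>. \<exists>n\<ge>N s. \<exists>m\<ge>N s. 6 * (1 / d) < avg n g x - avg m g x}
          = (\<Union>n\<in>{N s..}. \<Union>m\<in>{N s..}. {x\<in>space \<mu>. 6 * (1 / d) < avg n g x - avg m g x})"
        by auto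
      have meas: "{x\<in>space \<mu>. 6 * (1 / d) < avg n g x - avg m g x} \<in> sets \<mu>" for n m
        by (intro borel_measurable_less borel_measurable_diff measurable_avg g_facts borel_measurable_const)
      show "{x\<in>space \<mu>. \<exists>n\<ge>N s. \<exists>m\<ge>N s. 6 * (1 / d) < avg n g x - avg m g x} \<in> sets \<mu>"
        unfolding eq by (intro sets.countable_UN'' countableI_type meas)
    qed
    also have "\<dots> \<le> 2 * (a (len s) - I) / (1 / d)\<^sup>2"
      unfolding a_def
      by (rule oscillation_bound[OF g_facts])
         (use I_le I_near N_large N_pos d in \<open>auto simp: a_def len_def\<close>)
    also have "\<dots> = C * (a (len s) - I)" using d by (simp add: C_def field_simps)
    finally show ?thesis .
  qed
  have bsum_le: "(bsum n g x)\<^sup>2 \<le> (K * n)\<^sup>2" for n x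
  proof -
    have "(bsum n g x)\<^sup>2 \<le> (real n * real K)\<^sup>2"
      using bsum_bounds[OF g_facts(2,3)] by (intro power_mono)
    then show ?thesis by (simp add: mult.commute)
  qed
  have F_le: "real (F s (bits x s)) \<le> C * ((K * len s)\<^sup>2 - (bsum (len s) g x)\<^sup>2)" if x: "regular x" for x s
  proof -
    have "(\<Sum>j<(K * len s)\<^sup>2. of_bool (P s (bits x s) j)) \<le> (K * len s)\<^sup>2 - (bsum (len s) g x)\<^sup>2"
    proof (cases "\<exists>w\<le>s. cert_by s (len s) L w (bits x s)")
      case True
      then obtain w where w: "cert_by s (len s) L w (bits x s)" by blast
      have eq: "real (code_sum (len s) w') = bsum (len s) g x" if "cert_by s (len s) L w' (bits x s)" for w'
        using cert_by_sound[OF that] code_sum_eq[OF x] by blast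
      \<comment> \<open>Several \<open>w\<close> may be certified, but at a regular point all of
        them give the true Birkhoff sum, so the existential in \<open>P\<close> does not enlarge the
        count.\<close>
      then have eq': "code_sum (len s) w' = code_sum (len s) w" if "cert_by s (len s) L w' (bits x s)" for w'
        using w that by (metis of_nat_eq_iff)
      have "(\<Sum>j<(K * len s)\<^sup>2. of_bool (P s (bits x s) j)) \<le> (K * len s)\<^sup>2 - (code_sum (len s) w)\<^sup>2"
      proof -
        have "(\<Sum>j<(K * len s)\<^sup>2. of_bool (P s (bits x s) j)) \<le> (\<Sum>j<(K * len s)\<^sup>2. of_bool (j < (K * len s)\<^sup>2 - (code_sum (len s) w)\<^sup>2) :: nat)"
          by (intro sum_mono) (auto simp: P_def dest!: eq')
        also have "\<dots> = (K * len s)\<^sup>2 - (code_sum (len s) w)\<^sup>2" by (rule sum_of_bool_less_eq) auto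
        finally show ?thesis .
      qed
      moreover have "(code_sum (len s) w)\<^sup>2 \<le> (K * len s)\<^sup>2"
        using code_sum_le[of "len s" w] by (intro power_mono) (auto simp: mult.commute)
      ultimately have "real (\<Sum>j<(K * len s)\<^sup>2. of_bool (P s (bits x s) j)) \<le> real ((K * len s)\<^sup>2) - real ((code_sum (len s) w)\<^sup>2)"
        by (simp only: of_nat_diff[symmetric] of_nat_le_iff)
      then show ?thesis using eq[OF w] by simp
    next
      case False
      then have "\<not> P s (bits x s) j" for j by (auto simp: P_def)
      then show ?thesis using bsum_le[of "len s" x] by simp
    qed
    then have "real C * (\<Sum>j<(K * len s)\<^sup>2. of_bool (P s (bits x s) j)) \<le> real C * ((K * len s)\<^sup>2 - (bsum (len s) g x)\<^sup>2)"
      by (intro mult_left_mono) auto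
    then show ?thesis by (simp add: F_def)
  qed
  have F_eventually: "\<exists>t0. \<forall>s\<ge>t0. len s = k \<longrightarrow> real (F s (bits x s)) = C * ((K * k)\<^sup>2 - (bsum k g x)\<^sup>2)"
    if x: "regular x" and k: "0 < k" for x k
  proof -
    define w where "w = orbit_code k L x"
    obtain l where l: "orbit_cert k L w l (bits x l)" using regular_complete[OF x k] w_def by blast
    then obtain t0 where t0: "cert_by t0 k L w (bits x t0)" using cert_by_complete by blast
    have eq: "real (code_sum k w) = bsum k g x" using code_sum_eq[OF x l] by simp
    show ?thesis
    proof (intro exI[of _ t0] allI impI)
      fix s assume s: "t0 \<le> s" "len s = k"
      have w: "cert_by s k L w (bits x s)" using cert_by_mono[OF t0 s(1)] .
      have "w \<le> s" using w by (simp add: cert_by_def)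
      have "(K * k)\<^sup>2 - (code_sum k w)\<^sup>2 \<le> (\<Sum>j<(K * k)\<^sup>2. of_bool (P s (bits x s) j))"
      proof -
        have "(K * k)\<^sup>2 - (code_sum k w)\<^sup>2 = (\<Sum>j<(K * k)\<^sup>2. of_bool (j < (K * k)\<^sup>2 - (code_sum k w)\<^sup>2))"
          by (rule sum_of_bool_less_eq[symmetric]) auto
        also have "\<dots> \<le> (\<Sum>j<(K * k)\<^sup>2. of_bool (P s (bits x s) j))"
          using w \<open>w \<le> s\<close> s by (intro sum_mono) (auto simp: P_def less_diff_conv)
        finally show ?thesis .
      qed
      then have "C * ((K * k)\<^sup>2 - (code_sum k w)\<^sup>2) \<le> F s (bits x s)" by (simp add: F_def s(2))
      then have "real (C * ((K * k)\<^sup>2 - (code_sum k w)\<^sup>2)) \<le> real (F s (bits x s))" by (rule of_nat_mono)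
      moreover have "(code_sum k w)\<^sup>2 \<le> (K * k)\<^sup>2"
        using code_sum_le[of k w] by (intro power_mono) (auto simp: mult.commute)
      ultimately have "C * ((K * k)\<^sup>2 - (bsum k g x)\<^sup>2) \<le> real (F s (bits x s))"
        by (simp add: of_nat_diff eq)
      then show "real (F s (bits x s)) = C * ((K * k)\<^sup>2 - (bsum k g x)\<^sup>2)"
        using F_le[OF x, of s] s(2) by simp
    qed
  qed
  have int_limit: "(\<integral>x. C * ((K * k)\<^sup>2 - (bsum k g x)\<^sup>2) \<partial>\<mu>) / (real k)\<^sup>2 = C * ((real K)\<^sup>2 - a k)" if "0 < k" for k
  proof -
    have int: "integrable \<mu> (\<lambda>x. (bsum k g x)\<^sup>2)"
      using bsum_le g_facts(1) by (intro integrable_bounded[where B = "real ((K * k)\<^sup>2)"]) auto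
    have "a k = (\<integral>x. (bsum k g x)\<^sup>2 \<partial>\<mu>) / (real k)\<^sup>2"
      by (simp add: a_def avg_norm2_def[OF g_facts] avg_def power_divide)
    moreover have "(\<integral>x. C * ((K * k)\<^sup>2 - (bsum k g x)\<^sup>2) \<partial>\<mu>) = C * ((K * k)\<^sup>2 - (\<integral>x. (bsum k g x)\<^sup>2 \<partial>\<mu>))"
      using int prob_space by simp
    ultimately show ?thesis using that by (simp add: power_mult_distrib field_simps)
  qed
  have int_sq: "integrable \<mu> (\<lambda>x. C * ((K * k)\<^sup>2 - (bsum k g x)\<^sup>2))" for k
    using bsum_le g_facts(1) by (intro integrable_bounded[where B = "real C * real ((K * k)\<^sup>2)"])
      (auto simp: abs_mult intro!: mult_left_mono)
  have "\<exists>s. z \<notin> V s"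
  proof (rule oberwolfach_random_avoids[where F = F and e = "\<lambda>s. (len s)\<^sup>2" and B = "C * ((real K)\<^sup>2 - I)", OF z Sigma1 nested])
    show "total_recursive (\<lambda>xs. F (arg 0 xs) (arg 1 xs))"
      unfolding F_def P_def len_def power2_eq_square by (intro rec_intros code_sum_rec)
    show "total_recursive (\<lambda>xs. (len (arg 0 xs))\<^sup>2)"
      unfolding len_def by (intro rec_intros)
    show "0 < (len s)\<^sup>2" for s by (simp add: len_def)
    show "measure \<mu> (V s) + (\<integral>x. real (F s (bits x s)) \<partial>\<mu>) / real ((len s)\<^sup>2) \<le> C * ((real K)\<^sup>2 - I)" for s
    proof -
      have "(\<integral>x. real (F s (bits x s)) \<partial>\<mu>) \<le> (\<integral>x. C * ((K * len s)\<^sup>2 - (bsum (len s) g x)\<^sup>2) \<partial>\<mu>)"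
        using AE_regular F_le by (intro integral_mono_AE integrable_step int_sq) (auto elim!: eventually_mono)
      then have "(\<integral>x. real (F s (bits x s)) \<partial>\<mu>) / real ((len s)\<^sup>2)
          \<le> (\<integral>x. C * ((K * len s)\<^sup>2 - (bsum (len s) g x)\<^sup>2) \<partial>\<mu>) / (real (len s))\<^sup>2"
        by (simp add: divide_right_mono)
      also have "\<dots> = C * ((real K)\<^sup>2 - a (len s))" by (rule int_limit) (simp add: len_def)
      finally show ?thesis using measure_V[of s] by (simp add: algebra_simps)
    qed
    show "\<exists>s\<ge>s0. C * ((real K)\<^sup>2 - I) - \<epsilon> < (\<integral>x. real (F s (bits x s)) \<partial>\<mu>) / real ((len s)\<^sup>2)" if \<epsilon>: "0 < \<epsilon>" for s0 \<epsilon>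
    proof -
      have C: "0 < real C" using d by (simp add: C_def)
      \<comment> \<open>One \<open>k\<close> with nearly minimal norm is fixed and only the stage
        \<open>t\<close> grows; \<open>F\<close> is then eventually constant at each regular point,
        and dominated convergence applies.\<close>
      obtain k where k: "0 < k" "a k < I + \<epsilon> / C" using I_near[of "\<epsilon> / C"] \<epsilon> C by auto
      define s where "s t = prod_encode (k - 1, t)" for t
      have len_s: "len (s t) = k" for t using k(1) by (simp add: len_def s_def)
      have s_ge: "t \<le> s t" for t unfolding s_def by (rule le_prod_encode_2)
      have "(\<lambda>t. \<integral>x. real (F (s t) (bits x (s t))) \<partial>\<mu>) \<longlonglongrightarrow> (\<integral>x. C * ((K * k)\<^sup>2 - (bsum k g x)\<^sup>2) \<partial>\<mu>)"
      proof (rule integral_dominated_convergence[where w = "\<lambda>_. real C * real ((K * k)\<^sup>2)"])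
        show "AE x in \<mu>. (\<lambda>t. real (F (s t) (bits x (s t)))) \<longlonglongrightarrow> C * ((K * k)\<^sup>2 - (bsum k g x)\<^sup>2)"
          using AE_regular
        proof eventually_elim
          fix x assume "regular x"
          then obtain t0 where t0: "\<forall>s\<ge>t0. len s = k \<longrightarrow> real (F s (bits x s)) = C * ((K * k)\<^sup>2 - (bsum k g x)\<^sup>2)"
            using F_eventually k(1) by blast
          have "\<forall>\<^sub>F t in sequentially. real (F (s t) (bits x (s t))) = C * ((K * k)\<^sup>2 - (bsum k g x)\<^sup>2)"
            unfolding eventually_sequentially using t0 len_s s_ge by (meson order_trans)
          then show "(\<lambda>t. real (F (s t) (bits x (s t)))) \<longlonglongrightarrow> C * ((K * k)\<^sup>2 - (bsum k g x)\<^sup>2)"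
            by (rule tendsto_eventually)
        qed
        show "AE x in \<mu>. norm (real (F (s t) (bits x (s t)))) \<le> real C * real ((K * k)\<^sup>2)" for t
          using AE_regular
        proof eventually_elim
          fix x assume "regular x"
          from F_le[OF this, of "s t"] have "real (F (s t) (bits x (s t))) \<le> C * ((K * k)\<^sup>2 - (bsum k g x)\<^sup>2)"
            by (simp add: len_s)
          also have "\<dots> \<le> real C * real ((K * k)\<^sup>2)" by (intro mult_left_mono) auto
          finally show "norm (real (F (s t) (bits x (s t)))) \<le> real C * real ((K * k)\<^sup>2)" by simp
        qed
        show "(\<lambda>x. C * ((K * k)\<^sup>2 - (bsum k g x)\<^sup>2)) \<in> borel_measurable \<mu>"
          using int_sq by (rule borel_measurable_integrable)
        show "(\<lambda>x. real (F (s t) (bits x (s t)))) \<in> borel_measurable \<mu>" for t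
          using integrable_step by (rule borel_measurable_integrable)
      qed simp
      then have "(\<lambda>t. (\<integral>x. real (F (s t) (bits x (s t))) \<partial>\<mu>) / (real k)\<^sup>2) \<longlonglongrightarrow> C * ((real K)\<^sup>2 - a k)"
        unfolding int_limit[OF k(1), symmetric] using k(1) by (intro tendsto_divide tendsto_const) auto
      moreover have "C * ((real K)\<^sup>2 - I) - \<epsilon> < C * ((real K)\<^sup>2 - a k)"
        using k(2) C by (simp add: field_simps)
      ultimately have "\<forall>\<^sub>F t in sequentially. C * ((real K)\<^sup>2 - I) - \<epsilon> < (\<integral>x. real (F (s t) (bits x (s t))) \<partial>\<mu>) / (real k)\<^sup>2"
        by (rule order_tendstoD(1))
      then obtain t where "s0 \<le> t" "C * ((real K)\<^sup>2 - I) - \<epsilon> < (\<integral>x. real (F (s t) (bits x (s t))) \<partial>\<mu>) / (real k)\<^sup>2"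
        unfolding eventually_sequentially by (metis nat_le_linear)
      then show ?thesis using s_ge[of t] len_s[of t] by (intro exI[of _ "s t"]) auto
    qed
  qed
  then obtain s where "z \<notin> V s" by blast
  then have "\<forall>n\<ge>N s. \<forall>m\<ge>N s. avg n g z - avg m g z \<le> 6 / d"
    using V_regular[OF oberwolfach_random_regular[OF z]] by (auto simp: not_less)
  then show ?thesis unfolding g_def[abs_def] by blast
qed

end

end

section \<open>Lower semicomputable functions\<close>

lemma dyadic_floor_Suc: "2 * dyadic_floor t n \<le> dyadic_floor (Suc t) n"
proof -
  have "2 * \<lfloor>2 ^ t * real_of_rat (nat_to_rat_surj n)\<rfloor> \<le> \<lfloor>2 * (2 ^ t * real_of_rat (nat_to_rat_surj n))\<rfloor>"
    by linarith
  then show ?thesis by (simp add: dyadic_floor_eq mult.assoc)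
qed

lemma sum_lessThan_double: "(\<Sum>i<2 * J. h i) = (\<Sum>j<J. h (2 * j) + h (Suc (2 * j)) :: nat)"
  by (induction J) auto

lemma ennreal_le_if_ereal_le:
  assumes "ereal q \<le> enn2ereal y" "r \<le> max 0 q" shows "ennreal r \<le> y"
proof -
  have "enn2ereal (ennreal r) = ereal (max 0 r)" by (simp add: ennreal.rep_eq max_def)
  also have "\<dots> \<le> max 0 (ereal q)" using assms(2) by (auto simp: max_def split: if_splits)
  also have "\<dots> \<le> enn2ereal y" using assms(1) by simp
  finally show ?thesis by (simp add: less_eq_ennreal.rep_eq)
qed

text \<open>\<open>\<phi> t b\<close> is \<open>2 ^ t\<close> times the largest rational found below
  \<open>f\<close> by stage \<open>t\<close>, rounded down to the grid and cut off at
  \<open>t\<close>. The cut-off bounds each stage although \<open>f\<close> may be unbounded or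
  infinite; the factor \<open>2\<close> in the monotonicity accounts for the finer grid at stage
  \<open>Suc t\<close>.\<close>

lemma lower_semicomputable_stages:
  assumes "lower_semicomputable f"
  obtains \<phi> :: "nat \<Rightarrow> nat \<Rightarrow> nat"
  where "total_recursive (\<lambda>xs. \<phi> (arg 0 xs) (arg 1 xs))"
    and "\<And>t b. 2 * \<phi> t (b mod 2 ^ t) \<le> \<phi> (Suc t) b"
    and "\<And>x. (SUP t. ennreal (\<phi> t (bits x t) / 2 ^ t)) = f x"
    and "\<And>t b. \<phi> t b \<le> t * 2 ^ t"
proof -
  obtain R where R: "ce_relation R" and V: "\<forall>n. {x. ereal (of_rat (nat_to_rat_surj n)) < enn2ereal (f x)}
      = (\<Union>\<sigma>\<in>{\<sigma>. R n (string_encode \<sigma>)}. cylinder \<sigma>)"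
    using assms unfolding lower_semicomputable_def uniformly_Sigma1_def by blast
  obtain D where D: "decidable D" "\<And>xs. R (arg 0 xs) (arg 1 xs) \<longleftrightarrow> (\<exists>m. D (m # xs))"
    using R unfolding ce_relation_iff ce_def by blast
  have above: "ereal (of_rat (nat_to_rat_surj n)) < enn2ereal (f x)
      \<longleftrightarrow> (\<exists>l m. D [m, n, string_code l (bits x l)])" for n x
    using mem_uniformly_Sigma1[OF V, of x n] D(2)[of "[n, string_code _ (bits x _)]"] by simp
  define hit where "hit t n b \<longleftrightarrow> (\<exists>m\<le>t. \<exists>l\<le>t. D [m, n, string_code l b])" for t n b
  define P where "P t b j \<longleftrightarrow> (\<exists>n\<le>t. hit t n b \<and> j < dyadic_floor t n)" for t b j
  define \<phi> where "\<phi> t b = (\<Sum>j<t * 2 ^ t. of_bool (P t b j) :: nat)" for t b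
  have hit_bits: "hit t n (bits x t) \<longleftrightarrow> (\<exists>m\<le>t. \<exists>l\<le>t. D [m, n, string_code l (bits x l)])" for t n x
    unfolding hit_def using string_code_bits by metis
  show ?thesis
  proof (rule that)
    show "total_recursive (\<lambda>xs. \<phi> (arg 0 xs) (arg 1 xs))"
      unfolding \<phi>_def P_def hit_def by (intro rec_intros D(1)[THEN decidable_subst])
    show "\<phi> t b \<le> t * 2 ^ t" for t b
      using sum_bounded_above[of "{..<t * 2 ^ t}" "\<lambda>j. of_bool (P t b j)" "1 :: nat"] by (simp add: \<phi>_def)
    show "2 * \<phi> t (b mod 2 ^ t) \<le> \<phi> (Suc t) b" for t b
    proof -
      have hit: "hit t n (b mod 2 ^ t) \<Longrightarrow> hit (Suc t) n b" for n
      proof -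
        assume "hit t n (b mod 2 ^ t)"
        then obtain m l where ml: "m \<le> t" "l \<le> t" "D [m, n, string_code l (b mod 2 ^ t)]"
          by (auto simp: hit_def)
        have "b mod 2 ^ t mod 2 ^ l = b mod 2 ^ l"
          using ml(2) by (simp add: mod_mod_cancel le_imp_power_dvd)
        then have "string_code l (b mod 2 ^ t) = string_code l b" by (metis string_code_mod)
        then show ?thesis unfolding hit_def using ml le_SucI by metis
      qed
      have P: "P (Suc t) b (2 * j)" "P (Suc t) b (Suc (2 * j))" if P: "P t (b mod 2 ^ t) j" for j
      proof -
        obtain n where n: "n \<le> t" "hit t n (b mod 2 ^ t)" "j < dyadic_floor t n" using P by (auto simp: P_def)
        have "Suc (2 * j) < dyadic_floor (Suc t) n" using n(3) dyadic_floor_Suc[of t n] by simp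
        then show "P (Suc t) b (2 * j)" "P (Suc t) b (Suc (2 * j))"
          using n(1) hit[OF n(2)] unfolding P_def by (meson Suc_lessD le_SucI)+
      qed
      have "2 * \<phi> t (b mod 2 ^ t) = (\<Sum>j<t * 2 ^ t. of_bool (P t (b mod 2 ^ t) j) + of_bool (P t (b mod 2 ^ t) j))"
        by (simp add: \<phi>_def sum.distrib)
      also have "\<dots> \<le> (\<Sum>j<t * 2 ^ t. of_bool (P (Suc t) b (2 * j)) + of_bool (P (Suc t) b (Suc (2 * j))))"
        using P by (intro sum_mono add_mono) auto
      also have "\<dots> = (\<Sum>i<2 * (t * 2 ^ t). of_bool (P (Suc t) b i))" by (simp only: sum_lessThan_double)
      also have "\<dots> \<le> \<phi> (Suc t) b" unfolding \<phi>_def by (intro sum_mono2) auto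
      finally show ?thesis .
    qed
    show "(SUP t. ennreal (\<phi> t (bits x t) / 2 ^ t)) = f x" for x
    proof (rule antisym)
      show "(SUP t. ennreal (\<phi> t (bits x t) / 2 ^ t)) \<le> f x"
      proof (rule SUP_least)
        fix t
        \<comment> \<open>Finitely many rationals are known at stage \<open>t\<close>; the one with
          the largest floor dominates the whole count.\<close>
        define H where "H = {n. n \<le> t \<and> hit t n (bits x t)}"
        have "finite H" by (simp add: H_def)
        show "ennreal (\<phi> t (bits x t) / 2 ^ t) \<le> f x"
        proof (cases "H = {}")
          case True
          then have "\<not> P t (bits x t) j" for j by (auto simp: P_def H_def)
          then show ?thesis by (simp add: \<phi>_def)
        next
          case False
          then have "Max (dyadic_floor t ` H) \<in> dyadic_floor t ` H"
            using \<open>finite H\<close> by (intro Max_in) auto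
          then obtain n0 where n0: "n0 \<in> H" "dyadic_floor t n0 = Max (dyadic_floor t ` H)"
            by (metis imageE)
          have "dyadic_floor t n \<le> dyadic_floor t n0" if "n \<in> H" for n
            unfolding n0(2) using that \<open>finite H\<close> by auto
          then have "P t (bits x t) j \<Longrightarrow> j < dyadic_floor t n0" for j
            by (fastforce simp: P_def H_def)
          then have "\<phi> t (bits x t) \<le> card {..<dyadic_floor t n0}"
            unfolding \<phi>_def by (simp add: Int_def) (intro card_mono[of "{..<dyadic_floor t n0}", simplified], auto)
          then have "real (\<phi> t (bits x t)) / 2 ^ t \<le> dyadic_floor t n0 / 2 ^ t"
            by (intro divide_right_mono) auto
          also have "\<dots> \<le> max 0 (of_rat (nat_to_rat_surj n0))" by (rule dyadic_floor_le)
          finally have "real (\<phi> t (bits x t)) / 2 ^ t \<le> max 0 (of_rat (nat_to_rat_surj n0))" .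
          moreover have "ereal (of_rat (nat_to_rat_surj n0)) < enn2ereal (f x)"
            unfolding above using n0(1) by (auto simp: H_def hit_bits)
          ultimately show ?thesis by (intro ennreal_le_if_ereal_le) auto
        qed
      qed
      show "f x \<le> (SUP t. ennreal (\<phi> t (bits x t) / 2 ^ t))"
      proof (rule dense_le)
        fix y assume "y < f x"
        then have "enn2ereal y < enn2ereal (f x)" by (simp add: less_ennreal.rep_eq)
        then obtain q where q: "enn2ereal y < ereal (real_of_rat q)" "ereal (real_of_rat q) < enn2ereal (f x)"
          using ereal_dense3 by blast
        obtain n where n: "q = nat_to_rat_surj n" using surj_nat_to_rat_surj by (metis surjD)
        define r where "r = enn2real y"
        have y: "y = ennreal r" "0 \<le> r" "r < of_rat q"
        proof -
          have "y < \<top>" using \<open>y < f x\<close> top_greatest by (rule less_le_trans)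
          then show *: "y = ennreal r" by (simp add: r_def)
          show "0 \<le> r" by (simp add: r_def)
          then show "r < of_rat q" using q(1) unfolding * by simp
        qed
        obtain l m where lm: "D [m, n, string_code l (bits x l)]" using above q(2) n by blast
        obtain e where e: "(1/2) ^ e < of_rat q - r"
          using real_arch_pow_inv[of "of_rat q - r" "1/2"] y(3) by auto
        \<comment> \<open>Late enough for the witness to be found, for rounding to lose less than
          \<open>q - r\<close>, and for the cut-off at \<open>t\<close> not to fall below
          \<open>q\<close>.\<close>
        define t where "t = Max {n, m, l, e, nat \<lceil>of_rat q\<rceil>}"
        have t: "n \<le> t" "m \<le> t" "l \<le> t" "e \<le> t" "nat \<lceil>real_of_rat q\<rceil> \<le> t" by (simp_all add: t_def le_max_iff_disj)
        have "hit t n (bits x t)" unfolding hit_bits using lm t by blast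
        then have P: "P t (bits x t) j" if "j < dyadic_floor t n" for j
          using that t(1) by (auto simp: P_def)
        have "real_of_rat q \<le> t" using t(5) by linarith
        then have "max 0 (real_of_rat q) \<le> t" by simp
        then have "real (dyadic_floor t n) / 2 ^ t \<le> t"
          using dyadic_floor_le[of t n] unfolding n by (rule order_trans[rotated])
        then have "real (dyadic_floor t n) \<le> real (t * 2 ^ t)" by (simp add: field_simps)
        then have "dyadic_floor t n \<le> t * 2 ^ t" by (simp only: of_nat_le_iff)
        then have "dyadic_floor t n = (\<Sum>j<t * 2 ^ t. of_bool (j < dyadic_floor t n))"
          by (intro sum_of_bool_less_eq[symmetric]) auto
        also have "\<dots> \<le> \<phi> t (bits x t)" unfolding \<phi>_def using P by (intro sum_mono) auto
        finally have "real (dyadic_floor t n) / 2 ^ t \<le> \<phi> t (bits x t) / 2 ^ t"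
          by (intro divide_right_mono) auto
        moreover have "of_rat q - 1 / 2 ^ t < real (dyadic_floor t n) / 2 ^ t"
          unfolding n by (rule dyadic_floor_gt)
        moreover have "1 / 2 ^ t \<le> (1 / 2 :: real) ^ e"
          using power_decreasing[OF t(4), of "1/2 :: real"] by (simp add: power_one_over)
        ultimately have "r \<le> \<phi> t (bits x t) / 2 ^ t" using e by linarith
        then have "y \<le> ennreal (\<phi> t (bits x t) / 2 ^ t)" unfolding y(1) by (rule ennreal_leI)
        also have "\<dots> \<le> (SUP t. ennreal (\<phi> t (bits x t) / 2 ^ t))" by (rule SUP_upper) simp
        finally show "y \<le> (SUP t. ennreal (\<phi> t (bits x t) / 2 ^ t))" .
      qed
    qed
  qed
qed

section \<open>The part of \<open>f\<close> not yet enumerated at a stage\<close>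

context computable_system
begin

context
  fixes f :: "cantor \<Rightarrow> ennreal" and \<phi> :: "nat \<Rightarrow> nat \<Rightarrow> nat"
  assumes \<phi>_rec: "total_recursive (\<lambda>xs. \<phi> (arg 0 xs) (arg 1 xs))"
    and \<phi>_mono: "\<And>t b. 2 * \<phi> t (b mod 2 ^ t) \<le> \<phi> (Suc t) b"
    and \<phi>_sup: "\<And>x. (SUP t. ennreal (\<phi> t (bits x t) / 2 ^ t)) = f x"
    and \<phi>_le: "\<And>t b. \<phi> t b \<le> t * 2 ^ t"
    and f_finite: "(\<integral>\<^sup>+ x. f x \<partial>\<mu>) < \<infinity>"
begin

definition approx :: "nat \<Rightarrow> cantor \<Rightarrow> real" where
  "approx t x = \<phi> t (bits x t) / 2 ^ t"

private lemma approx_nonneg: "0 \<le> approx t x"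
  by (simp add: approx_def)

private lemma approx_le: "approx t x \<le> t"
proof -
  have "real (\<phi> t (bits x t)) \<le> real (t * 2 ^ t)" using \<phi>_le by (simp only: of_nat_le_iff)
  then show ?thesis by (simp add: approx_def field_simps)
qed

lemma approx_mono: "s \<le> t \<Longrightarrow> approx s x \<le> approx t x"
proof (induction rule: dec_induct)
  case (step n)
  have "2 * real (\<phi> n (bits x n)) \<le> \<phi> (Suc n) (bits x (Suc n))"
    using \<phi>_mono[of n "bits x (Suc n)"] bits_mod[of n "Suc n" x] by simp
  then have "approx n x \<le> approx (Suc n) x" by (simp add: approx_def field_simps)
  then show ?case using step by simp
qed simp

private lemma approx_integrable: "integrable \<mu> (approx t)"
  unfolding approx_def[abs_def] by (intro integrable_divide integrable_step)

private lemma nn_integral_approx: "(\<integral>\<^sup>+ x. ennreal (approx t x) \<partial>\<mu>) = ennreal (\<integral>x. approx t x \<partial>\<mu>)"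
  by (intro nn_integral_eq_integral approx_integrable) (simp add: approx_nonneg)

private lemma nn_integral_f: "(\<integral>\<^sup>+ x. f x \<partial>\<mu>) = (SUP t. ennreal (\<integral>x. approx t x \<partial>\<mu>))"
proof -
  have "(\<integral>\<^sup>+ x. f x \<partial>\<mu>) = (\<integral>\<^sup>+ x. (SUP t. ennreal (approx t x)) \<partial>\<mu>)"
    by (simp add: \<phi>_sup approx_def)
  also have "\<dots> = (SUP t. \<integral>\<^sup>+ x. ennreal (approx t x) \<partial>\<mu>)"
  proof (rule nn_integral_monotone_convergence_SUP)
    show "incseq (\<lambda>t x. ennreal (approx t x))"
      using approx_mono by (auto simp: incseq_def le_fun_def intro!: ennreal_leI)
    show "(\<lambda>x. ennreal (approx t x)) \<in> borel_measurable \<mu>" for t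
      using borel_measurable_integrable[OF approx_integrable] by measurable
  qed
  finally show ?thesis by (simp only: nn_integral_approx)
qed

private definition J :: real where
  "J = enn2real (\<integral>\<^sup>+ x. f x \<partial>\<mu>)"

private lemma integral_approx_le: "(\<integral>x. approx t x \<partial>\<mu>) \<le> J"
proof -
  have "ennreal (\<integral>x. approx t x \<partial>\<mu>) \<le> (\<integral>\<^sup>+ x. f x \<partial>\<mu>)"
    unfolding nn_integral_f by (rule SUP_upper) simp
  also have "\<dots> = ennreal J" using f_finite by (simp add: J_def)
  finally show ?thesis by (simp add: J_def)
qed

private lemma integral_approx_near:
  assumes "0 < \<epsilon>" shows "\<exists>t\<ge>t0. J - \<epsilon> < (\<integral>x. approx t x \<partial>\<mu>)"
proof -
  have "\<exists>t. J - \<epsilon> < (\<integral>x. approx t x \<partial>\<mu>)"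
  proof (rule ccontr)
    assume "\<nexists>t. J - \<epsilon> < (\<integral>x. approx t x \<partial>\<mu>)"
    then have le: "(\<integral>x. approx t x \<partial>\<mu>) \<le> J - \<epsilon>" for t by (simp add: not_less)
    have "0 \<le> (\<integral>x. approx 0 x \<partial>\<mu>)" by (intro integral_nonneg_AE) (simp add: approx_nonneg)
    then have "0 \<le> J - \<epsilon>" using le[of 0] by simp
    have "(\<integral>\<^sup>+ x. f x \<partial>\<mu>) \<le> ennreal (J - \<epsilon>)"
      unfolding nn_integral_f using le by (intro SUP_least ennreal_leI)
    then have "ennreal J \<le> ennreal (J - \<epsilon>)" using f_finite by (simp add: J_def)
    then show False using assms \<open>0 \<le> J - \<epsilon>\<close> by simp
  qed
  then obtain t where "J - \<epsilon> < (\<integral>x. approx t x \<partial>\<mu>)" ..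
  also have "\<dots> \<le> (\<integral>x. approx (max t t0) x \<partial>\<mu>)"
    by (intro integral_mono approx_integrable approx_mono) simp
  finally show ?thesis by (intro exI[of _ "max t t0"]) simp
qed

text \<open>The tail beyond \<open>approx s\<close> is reached through the differences
  \<open>approx (s + t) - approx s\<close>, which are bounded and computable from prefixes of length
  \<open>s + t\<close>. They increase with \<open>t\<close>, so the maximal inequality passes to the
  union.\<close>

lemma oberwolfach_random_tail:
  assumes z: "oberwolfach_random \<mu> z" and d: "0 < d"
  shows "\<exists>s. \<forall>n t. bsum n (\<lambda>x. approx (s + t) x - approx s x) z \<le> n / real d"
proof -
  define h where "h s t x = approx (s + t) x - approx s x" for s t x
  \<comment> \<open>The inequality \<open>n / d < bsum n (h s t) x\<close>, multiplied by
    \<open>d * 2 ^ (s + t)\<close>. Certified prefixes have length \<open>s + t\<close>, and stage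
    \<open>s\<close> reads their lowest \<open>s\<close> bits.\<close>
  define Q where "Q s t n w \<longleftrightarrow> n * 2 ^ (s + t) + d * 2 ^ t * (\<Sum>j<n. \<phi> s (code_nth w j mod 2 ^ s))
    < d * (\<Sum>j<n. \<phi> (s + t) (code_nth w j))" for s t n w
  define V where "V s = {x. \<exists>l t n w. Q s t n w \<and> orbit_cert n (s + t) w l (bits x l)}" for s
  have \<phi>': "total_recursive (\<lambda>xs. \<phi> (G xs) (H xs))" if "total_recursive G" "total_recursive H" for G H
    using total_recursive_subst[OF \<phi>_rec, of "\<lambda>xs. [G xs, H xs]"] that by (simp add: rec_intros)
  have h_nonneg: "0 \<le> h s t x" for s t x by (simp add: h_def approx_mono)
  have h_le: "h s t x \<le> real (s + t)" for s t x
    using approx_le[of "s + t" x] approx_nonneg[of s x] unfolding h_def by linarith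
  have h_meas: "h s t \<in> borel_measurable \<mu>" for s t
    unfolding h_def[abs_def] by (intro borel_measurable_diff borel_measurable_integrable[OF approx_integrable])
  have Q_iff: "Q s t n w \<longleftrightarrow> n * (1 / d) < bsum n (h s t) x"
    if "\<And>j. j < n \<Longrightarrow> code_nth w j = bits (orbit x j) (s + t)" for s t n w x
  proof -
    have 1: "real (\<Sum>j<n. \<phi> (s + t) (code_nth w j)) = 2 ^ (s + t) * bsum n (approx (s + t)) x"
      using that by (simp add: bsum_def approx_def sum_distrib_left)
    have 2: "real (\<Sum>j<n. \<phi> s (code_nth w j mod 2 ^ s)) = 2 ^ s * bsum n (approx s) x"
      using that by (simp add: bsum_def approx_def sum_distrib_left bits_mod)
    have "Q s t n w \<longleftrightarrow> real (n * 2 ^ (s + t) + d * 2 ^ t * (\<Sum>j<n. \<phi> s (code_nth w j mod 2 ^ s)))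
        < real (d * (\<Sum>j<n. \<phi> (s + t) (code_nth w j)))"
      unfolding Q_def of_nat_less_iff ..
    also have "\<dots> \<longleftrightarrow> 2 ^ (s + t) * (n + d * bsum n (approx s) x) < 2 ^ (s + t) * (d * bsum n (approx (s + t)) x)"
      unfolding of_nat_add of_nat_mult 1 2 by (simp add: power_add algebra_simps)
    also have "\<dots> \<longleftrightarrow> n + d * bsum n (approx s) x < d * bsum n (approx (s + t)) x"
      by (rule mult_less_cancel_left_pos) simp
    also have "\<dots> \<longleftrightarrow> n * (1 / d) < bsum n (approx (s + t)) x - bsum n (approx s) x"
      using d by (simp add: field_simps)
    also have "bsum n (approx (s + t)) x - bsum n (approx s) x = bsum n (h s t) x"
      by (simp add: bsum_def h_def sum_subtractf)
    finally show ?thesis .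
  qed
  have V_regular: "x \<in> V s \<longleftrightarrow> (\<exists>t n. n * (1 / d) < bsum n (h s t) x)" if x: "regular x" for x s
  proof
    assume "x \<in> V s"
    then obtain l t n w where *: "Q s t n w" "orbit_cert n (s + t) w l (bits x l)" by (auto simp: V_def)
    then show "\<exists>t n. n * (1 / d) < bsum n (h s t) x" using Q_iff regular_sound[OF x *(2)] by blast
  next
    assume "\<exists>t n. n * (1 / d) < bsum n (h s t) x"
    then obtain t n where tn: "n * (1 / d) < bsum n (h s t) x" by blast
    then have "0 < n" by (cases n) (auto simp: bsum_def)
    then obtain l where "orbit_cert n (s + t) (orbit_code n (s + t) x) l (bits x l)"
      using regular_complete x by blast
    moreover have "Q s t n (orbit_code n (s + t) x)" using tn Q_iff code_nth_orbit_code by blast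
    ultimately show "x \<in> V s" unfolding V_def by blast
  qed
  have Sigma1: "uniformly_Sigma1 V"
  proof (rule uniformly_Sigma1I[where W = "\<lambda>xs. \<exists>t n w. Q (arg 2 xs) t n w \<and>
      orbit_cert n (arg 2 xs + t) w (arg 0 xs) (arg 1 xs)"])
    show "ce (\<lambda>xs. \<exists>t n w. Q (arg 2 xs) t n w \<and> orbit_cert n (arg 2 xs + t) w (arg 0 xs) (arg 1 xs))"
      unfolding Q_def by (intro rec_intros \<phi>')
  qed (auto simp: V_def)
  have V_sets: "V s \<in> sets \<mu>" for s using uniformly_Sigma1_sets[OF Sigma1] by simp
  \<comment> \<open>Moving one unit from \<open>s\<close> to \<open>t\<close> keeps the prefix
    length \<open>s + t\<close>, so the same certificate witnesses membership in the larger
    set.\<close>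
  have Q_mono: "Q s (Suc t) n w" if "Q (Suc s) t n w" for s t n w
  proof -
    have "2 * (\<Sum>j<n. \<phi> s (code_nth w j mod 2 ^ s)) \<le> (\<Sum>j<n. \<phi> (Suc s) (code_nth w j mod 2 ^ Suc s))"
      unfolding sum_distrib_left
    proof (rule sum_mono)
      fix j
      have "code_nth w j mod 2 ^ Suc s mod 2 ^ s = code_nth w j mod 2 ^ s"
        by (simp add: mod_mod_cancel)
      then show "2 * \<phi> s (code_nth w j mod 2 ^ s) \<le> \<phi> (Suc s) (code_nth w j mod 2 ^ Suc s)"
        using \<phi>_mono[of s "code_nth w j mod 2 ^ Suc s"] by simp
    qed
    then have "d * 2 ^ t * (2 * (\<Sum>j<n. \<phi> s (code_nth w j mod 2 ^ s)))
        \<le> d * 2 ^ t * (\<Sum>j<n. \<phi> (Suc s) (code_nth w j mod 2 ^ Suc s))" by (rule mult_le_mono2)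
    then have "d * 2 ^ Suc t * (\<Sum>j<n. \<phi> s (code_nth w j mod 2 ^ s))
        \<le> d * 2 ^ t * (\<Sum>j<n. \<phi> (Suc s) (code_nth w j mod 2 ^ Suc s))" by (simp only: power_Suc mult_ac)
    then show ?thesis using that unfolding Q_def add_Suc_shift by linarith
  qed
  have nested: "V (Suc s) \<subseteq> V s" for s
    unfolding V_def using Q_mono by (fastforce simp del: add_Suc simp: add_Suc_shift)
  have measure_V: "measure \<mu> (V s) \<le> d * (J - (\<integral>x. approx s x \<partial>\<mu>))" for s
  proof -
    define E where "E t = {x\<in>space \<mu>. \<exists>n. n * (1 / d) < bsum n (h s t) x}" for t
    have E_sets: "E t \<in> sets \<mu>" for t
    proof -
      have "E t = (\<Union>n. {x\<in>space \<mu>. n * (1 / d) < bsum n (h s t) x})" by (auto simp: E_def)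
      moreover have "{x\<in>space \<mu>. n * (1 / d) < bsum n (h s t) x} \<in> sets \<mu>" for n
        by (intro borel_measurable_less measurable_bsum h_meas borel_measurable_const)
      ultimately show ?thesis by (simp only:) (rule sets.countable_UN, blast)
    qed
    have E_le: "measure \<mu> (E t) \<le> d * (J - (\<integral>x. approx s x \<partial>\<mu>))" for t
    proof -
      have "1 / d * measure \<mu> (E t) \<le> (\<integral>x. h s t x \<partial>\<mu>)"
        unfolding E_def using d by (intro maximal_inequality[OF h_meas h_nonneg h_le]) simp
      also have "\<dots> = (\<integral>x. approx (s + t) x \<partial>\<mu>) - (\<integral>x. approx s x \<partial>\<mu>)"
        unfolding h_def by (intro Bochner_Integration.integral_diff approx_integrable)
      also have "\<dots> \<le> J - (\<integral>x. approx s x \<partial>\<mu>)" using integral_approx_le by simp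
      finally show ?thesis using d by (simp add: field_simps)
    qed
    have "incseq E"
    proof (rule incseq_SucI)
      fix t
      have "bsum n (h s t) x \<le> bsum n (h s (Suc t)) x" for n x
        unfolding bsum_def h_def by (intro sum_mono diff_right_mono approx_mono) simp
      then show "E t \<subseteq> E (Suc t)" unfolding E_def using less_le_trans by blast
    qed
    then have "(\<lambda>t. measure \<mu> (E t)) \<longlonglongrightarrow> measure \<mu> (\<Union>t. E t)"
      using E_sets by (intro finite_Lim_measure_incseq) auto
    then have "measure \<mu> (\<Union>t. E t) \<le> d * (J - (\<integral>x. approx s x \<partial>\<mu>))"
      by (rule LIMSEQ_le_const2) (use E_le in auto)
    moreover have "measure \<mu> (V s) \<le> measure \<mu> (\<Union>t. E t)"
    proof (rule finite_measure_mono_AE)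
      show "AE x in \<mu>. x \<in> V s \<longrightarrow> x \<in> (\<Union>t. E t)"
        using AE_regular by eventually_elim (auto simp: V_regular E_def)
      show "(\<Union>t. E t) \<in> sets \<mu>" using E_sets by blast
    qed
    ultimately show ?thesis by linarith
  qed
  have int_eq: "(\<integral>x. real (d * \<phi> s (bits x s)) \<partial>\<mu>) / real (2 ^ s) = d * (\<integral>x. approx s x \<partial>\<mu>)" for s
    by (simp add: approx_def)
  have "\<exists>s. z \<notin> V s"
  proof (rule oberwolfach_random_avoids[where F = "\<lambda>s b. d * \<phi> s b" and e = "\<lambda>s. 2 ^ s" and B = "d * J", OF z Sigma1 nested])
    show "total_recursive (\<lambda>xs. d * \<phi> (arg 0 xs) (arg 1 xs))" by (intro rec_intros \<phi>')
    show "total_recursive (\<lambda>xs. 2 ^ arg 0 xs)" by (intro rec_intros)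
    show "measure \<mu> (V s) + (\<integral>x. real (d * \<phi> s (bits x s)) \<partial>\<mu>) / real (2 ^ s) \<le> d * J" for s
      unfolding int_eq using measure_V[of s] by (simp add: algebra_simps)
    show "\<exists>s\<ge>s0. d * J - \<epsilon> < (\<integral>x. real (d * \<phi> s (bits x s)) \<partial>\<mu>) / real (2 ^ s)" if "0 < \<epsilon>" for s0 \<epsilon>
    proof -
      obtain s where "s0 \<le> s" "J - \<epsilon> / d < (\<integral>x. approx s x \<partial>\<mu>)"
        using integral_approx_near[of "\<epsilon> / d" s0] \<open>0 < \<epsilon>\<close> d by auto
      moreover from this have "d * (J - \<epsilon> / d) < d * (\<integral>x. approx s x \<partial>\<mu>)"
        using d by (intro mult_strict_left_mono) auto
      ultimately show ?thesis unfolding int_eq using d by (intro exI[of _ s]) (simp add: right_diff_distrib)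
    qed
  qed simp
  then obtain s where "z \<notin> V s" by blast
  then have "bsum n (h s t) z \<le> n / real d" for n t
    using V_regular[OF oberwolfach_random_regular[OF z]] by (auto simp: not_less)
  then show ?thesis unfolding h_def[abs_def] by blast
qed

end

end

section \<open>Convergence of the averages of \<open>f\<close> at random points\<close>

lemma Cauchy_if_oscillation_small:
  fixes a :: "nat \<Rightarrow> real"
  assumes "\<And>d::nat. 0 < d \<Longrightarrow> \<exists>N. \<forall>n\<ge>N. \<forall>m\<ge>N. a n - a m \<le> C / real d"
  shows "Cauchy a"
proof (rule metric_CauchyI)
  fix e :: real assume "0 < e"
  obtain d :: nat where d: "\<bar>C\<bar> / e < d" using reals_Archimedean2 by blast
  then have "0 < real d" using \<open>0 < e\<close> by (metis abs_ge_zero divide_nonneg_pos le_less_trans)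
  then have "C / d < e" using d \<open>0 < e\<close> by (simp add: field_simps)
  moreover obtain N where "\<forall>n\<ge>N. \<forall>m\<ge>N. a n - a m \<le> C / real d"
    using assms[of d] \<open>0 < real d\<close> by auto
  ultimately show "\<exists>N. \<forall>m\<ge>N. \<forall>n\<ge>N. dist (a m) (a n) < e"
    by (intro exI[of _ N]) (fastforce simp: dist_real_def abs_less_iff)
qed

context computable_system
begin

lemma iterate_partial_regular:
  assumes "regular x" shows "iterate_partial T i x = Some (orbit x i)"
proof (induction i)
  case (Suc i)
  have "iterate_partial T (Suc i) x = Option.bind (iterate_partial T i x) T"
    by (simp add: iterate_partial_def)
  then show ?case using Suc assms by (simp add: regular_def)
qed (simp add: iterate_partial_def)

text \<open>For \<open>n > 0\<close> the average of \<open>f\<close> lies between that of a stage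
  \<open>approx s\<close> and the same plus \<open>1 / d\<close>, with \<open>s\<close> independent
  of \<open>n\<close>. Together with the eventual oscillation \<open>6 / d\<close> of the stage this
  gives \<open>7 / d\<close>, hence a Cauchy sequence; the same comparison with \<open>d = 1\<close>
  shows that all sums are finite.\<close>

lemma oberwolfach_random_birkhoff:
  assumes z: "oberwolfach_random \<mu> z" and f: "lower_semicomputable f" "(\<integral>\<^sup>+ x. f x \<partial>\<mu>) < \<infinity>"
  shows "\<exists>l. (\<lambda>n. (\<Sum>i<n. f (orbit z i)) / of_nat n) \<longlonglongrightarrow> ennreal l"
proof -
  obtain \<phi> where \<phi>: "total_recursive (\<lambda>xs. \<phi> (arg 0 xs) (arg 1 xs))"
    "\<And>t b. 2 * \<phi> t (b mod 2 ^ t) \<le> \<phi> (Suc t) b"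
    "\<And>x. (SUP t. ennreal (\<phi> t (bits x t) / 2 ^ t)) = f x"
    "\<And>t b. \<phi> t b \<le> t * 2 ^ t"
    by (rule lower_semicomputable_stages[OF f(1)]) blast
  let ?f = "approx \<phi>"
  define S where "S n = (\<Sum>i<n. f (orbit z i))" for n
  have approx: "?f t x = \<phi> t (bits x t) / 2 ^ t" for t x by (rule approx_def[OF \<phi> f(2)])
  have mono: "?f s x \<le> ?f t x" if "s \<le> t" for s t x
    by (rule approx_mono[OF \<phi> f(2) that])
  have nonneg: "0 \<le> ?f t x" for t x by (simp add: approx)
  have S_eq: "S n = (SUP t. ennreal (bsum n (?f t) z))" for n
  proof -
    have "S n = (\<Sum>i<n. SUP t. ennreal (?f t (orbit z i)))" by (simp add: S_def approx \<phi>(3))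
    also have "\<dots> = (SUP t. \<Sum>i<n. ennreal (?f t (orbit z i)))"
      by (intro ennreal_SUP_sum[symmetric]) (auto simp: incseq_def intro!: ennreal_leI mono)
    also have "\<dots> = (SUP t. ennreal (bsum n (?f t) z))" by (simp add: bsum_def sum_ennreal nonneg)
    finally show ?thesis .
  qed
  have S_lower: "ennreal (bsum n (?f s) z) \<le> S n" for n s unfolding S_eq by (rule SUP_upper) simp
  have S_upper: "\<exists>s. \<forall>n. S n \<le> ennreal (bsum n (?f s) z + n / d)" if "0 < d" for d :: nat
  proof -
    obtain s where s: "\<And>n t. bsum n (\<lambda>x. ?f (s + t) x - ?f s x) z \<le> n / real d"
      using oberwolfach_random_tail[OF \<phi> f(2) z \<open>0 < d\<close>] by blast
    have "S n \<le> ennreal (bsum n (?f s) z + n / d)" for n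
      unfolding S_eq
    proof (rule SUP_least)
      fix t
      have "bsum n (?f t) z \<le> bsum n (?f (s + t)) z"
        unfolding bsum_def by (intro sum_mono mono) simp
      also have "\<dots> \<le> bsum n (?f s) z + n / d"
        using s[of n t] by (simp add: bsum_def sum_subtractf)
      finally show "ennreal (bsum n (?f t) z) \<le> ennreal (bsum n (?f s) z + n / d)" by (rule ennreal_leI)
    qed
    then show ?thesis by blast
  qed
  have S_real: "S n = ennreal (enn2real (S n))" for n
  proof -
    obtain s where "S n \<le> ennreal (bsum n (?f s) z + n / 1)" using S_upper[of 1] by auto
    also have "\<dots> < \<top>" by simp
    finally show ?thesis by simp
  qed
  have bsum_nonneg: "0 \<le> bsum n (?f s) z" for n s by (simp add: bsum_def sum_nonneg nonneg)
  have lower: "bsum n (?f s) z \<le> enn2real (S n)" for n s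
    using S_lower[of n s] S_real[of n] by (metis ennreal_le_iff enn2real_nonneg)
  have upper: "\<exists>s. \<forall>n. enn2real (S n) \<le> bsum n (?f s) z + n / d" if d: "0 < d" for d :: nat
  proof -
    obtain s where s: "\<And>n. S n \<le> ennreal (bsum n (?f s) z + n / d)" using S_upper[OF d] by blast
    have "enn2real (S n) \<le> bsum n (?f s) z + n / d" for n
      using s[of n] bsum_nonneg[of n s] by (intro enn2real_leI) auto
    then show ?thesis by blast
  qed
  \<comment> \<open>The oscillation lemma takes integer-valued step functions, so it is applied to
    \<open>2 ^ s\<close> times \<open>approx s\<close>; dividing back only shrinks the
    bound.\<close>
  have step: "\<exists>N. \<forall>n\<ge>N. \<forall>m\<ge>N. avg n (?f s) z - avg m (?f s) z \<le> 6 / real d" if d: "0 < d" for s and d :: nat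
  proof -
    have "total_recursive (\<lambda>xs. \<phi> s (arg 0 xs))"
      using total_recursive_subst[OF \<phi>(1), of "\<lambda>xs. [s, arg 0 xs]"] by (simp add: rec_intros)
    then obtain N where N: "\<And>n m. N \<le> n \<Longrightarrow> N \<le> m \<Longrightarrow>
        avg n (\<lambda>x. real (\<phi> s (bits x s))) z - avg m (\<lambda>x. real (\<phi> s (bits x s))) z \<le> 6 / real d"
      using oberwolfach_random_step_oscillation[of "\<phi> s" "s * 2 ^ s" z d s] \<phi>(4) z d by blast
    have scale: "avg n (?f s) z = avg n (\<lambda>x. real (\<phi> s (bits x s))) z / 2 ^ s" for n
      by (simp add: avg_def bsum_def approx sum_divide_distrib[symmetric])
    have "avg n (?f s) z - avg m (?f s) z \<le> 6 / real d" if "N \<le> n" "N \<le> m" for n m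
    proof -
      have "avg n (?f s) z - avg m (?f s) z \<le> 6 / real d / 2 ^ s"
        unfolding scale diff_divide_distrib[symmetric] by (intro divide_right_mono N that) simp
      also have "\<dots> \<le> 6 / real d"
        using divide_left_mono[of 1 "2 ^ s" "6 / real d"] by simp
      finally show ?thesis .
    qed
    then show ?thesis by blast
  qed
  define a where "a n = enn2real (S n) / n" for n
  have "Cauchy a"
  proof (rule Cauchy_if_oscillation_small[where C = 7])
    fix d :: nat assume d: "0 < d"
    obtain s where s: "\<And>n. enn2real (S n) \<le> bsum n (?f s) z + n / d" using upper[OF d] by blast
    obtain N where N: "\<And>n m. N \<le> n \<Longrightarrow> N \<le> m \<Longrightarrow> avg n (?f s) z - avg m (?f s) z \<le> 6 / real d"
      using step[OF d] by blast
    \<comment> \<open>Starting at \<open>Suc N\<close> excludes the index \<open>0\<close>, so that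
      the error \<open>n / d\<close> becomes \<open>1 / d\<close> after division by
      \<open>n\<close>.\<close>
    have "a n - a m \<le> 7 / d" if nm: "Suc N \<le> n" "Suc N \<le> m" for n m
    proof -
      have pos: "0 < real n" "0 < real m" using nm by auto
      have "a n \<le> (bsum n (?f s) z + n / d) / n"
        unfolding a_def by (intro divide_right_mono s) simp
      also have "\<dots> = avg n (?f s) z + 1 / d" using pos by (simp add: avg_def add_divide_distrib)
      finally have "a n \<le> avg n (?f s) z + 1 / d" .
      moreover have "avg m (?f s) z \<le> a m"
        unfolding a_def avg_def by (intro divide_right_mono lower) simp
      moreover have "avg n (?f s) z - avg m (?f s) z \<le> 6 / d" using N nm by simp
      moreover have "7 / real d = 6 / d + 1 / d" by (simp add: add_divide_distrib[symmetric])
      ultimately show ?thesis by linarith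
    qed
    then show "\<exists>N. \<forall>n\<ge>N. \<forall>m\<ge>N. a n - a m \<le> 7 / real d" by blast
  qed
  then obtain l where "a \<longlonglongrightarrow> l" using convergent_eq_Cauchy by (auto simp: Cauchy_convergent_iff convergent_def)
  then have "(\<lambda>n. ennreal (a n)) \<longlonglongrightarrow> ennreal l" by (rule tendsto_ennrealI)
  moreover have "\<forall>\<^sub>F n in sequentially. ennreal (a n) = S n / of_nat n"
    using eventually_gt_at_top[of 0]
  proof eventually_elim
    fix n :: nat assume "0 < n"
    then have "ennreal (a n) = ennreal (enn2real (S n)) / ennreal (real n)"
      unfolding a_def by (intro divide_ennreal[symmetric]) auto
    then show "ennreal (a n) = S n / of_nat n"
      using S_real[of n] by (simp add: ennreal_of_nat_eq_real_of_nat)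
  qed
  ultimately show ?thesis
    unfolding S_def by (intro exI[of _ l]) (rule Lim_transform_eventually)
qed

end

theorem theorem6p1:
  fixes \<mu> :: "cantor measure"
    and T :: "cantor \<Rightarrow> cantor option"
    and f :: "cantor \<Rightarrow> ennreal"
    and z :: cantor
  assumes "computable_prob_measure \<mu>"
    and "computable_partial_map T"
    and "measure_preserving_partial \<mu> T"
    and "lower_semicomputable f"
    and "(\<integral>\<^sup>+ x. f x \<partial>\<mu>) < \<infinity>"
    and "oberwolfach_random \<mu> z"
  shows "(\<forall>i. iterate_partial T i z \<noteq> None) \<and>
    (\<exists>L. L < \<infinity> \<and> (\<lambda>n. birkhoff_average T f n z) \<longlonglongrightarrow> L)"
proof -
  obtain R where "ce_relation R"
    "\<forall>\<sigma> \<tau> \<sigma>' \<tau>'. R (string_encode \<sigma>) (string_encode \<tau>) \<longrightarrow>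
         R (string_encode \<sigma>') (string_encode \<tau>') \<longrightarrow> prefix \<sigma> \<sigma>' \<longrightarrow> prefix \<tau> \<tau>' \<or> prefix \<tau>' \<tau>"
    "\<forall>x y. T x = Some y \<longleftrightarrow>
         (\<forall>n. \<exists>\<sigma> \<tau>. R (string_encode \<sigma>) (string_encode \<tau>) \<and>
                 x \<in> cylinder \<sigma> \<and> y \<in> cylinder \<tau> \<and> n \<le> length \<tau>)"
    using assms(2) unfolding computable_partial_map_def by blast
  then have "functional T R" by unfold_locales blast+
  moreover have "computable_measure \<mu>"
    using assms(1) by (auto simp: computable_measure_def computable_measure_axioms_def computable_prob_measure_def)
  ultimately interpret computable_system \<mu> T R
    using assms(3) by (simp add: computable_system_def computable_system_axioms_def)
  have it: "iterate_partial T i z = Some (orbit z i)" for i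
    using iterate_partial_regular oberwolfach_random_regular assms(6) by blast
  obtain l where "(\<lambda>n. (\<Sum>i<n. f (orbit z i)) / of_nat n) \<longlonglongrightarrow> ennreal l"
    using oberwolfach_random_birkhoff[OF assms(6,4,5)] by blast
  then have "(\<lambda>n. birkhoff_average T f n z) \<longlonglongrightarrow> ennreal l"
    by (simp add: birkhoff_average_def it)
  then show ?thesis using it by (intro conjI exI[of _ "ennreal l"]) auto
qed

end
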